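(* Fix the training set $\mathcal{D}_n$ and consider a random forest for which one of the following two properties holds: (a) the random forest is discrete; (b) there exist $C, A>0$ and $\alpha<2$ such that, for all $\varepsilon>0$, $\delta(\varepsilon)\ge C\exp(-A/\varepsilon^{\alpha})$, where $\delta$ is the random forest grid step. Then, conditionally on $\mathcal{D}_n$, as $M\to\infty$, $$\sqrt{M}\,\big(m_{M,n}(\bullet)-m_{\infty,n}(\bullet)\big)\ \overset{\mathcal{L}}{\longrightarrow}\ \mathbb{G}g_{\bullet},$$ where the convergence is that of a uniform central limit theorem over the class $\mathcal{F}_2=\{g_{\mathbf x}:\theta\mapsto m_n(\mathbf x,\theta);\ \mathbf x\in[0,1]^d\}$ (convergence in distribution in $\ell^\infty(\mathcal F_2)$), and $\mathbb{G}$ is a Gaussian process with mean zero and covariance function $$\mathrm{Cov}_{\Theta}(\mathbb{G}g_{\mathbf x},\mathbb{G}g_{\mathbf z})=\mathrm{Cov}_{\Theta}\left(\sum_{i=1}^n Y_i\frac{\mathbf 1_{\mathbf x\overset{\Theta}{\leftrightarrow}\mathbf X_i}}{N_n(\mathbf x,\Theta)},\ \sum_{i=1}^n Y_i\frac{\mathbf 1_{\mathbf z\overset{\Theta}{\leftrightarrow}\mathbf X_i}}{N_n(\mathbf z,\Theta)}\right),\qquad \mathbf x,\mathbf z\in[0,1]^d.$$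
   Context: Data: $\mathcal{D}_n=((\mathbf X_1,Y_1),\dots,(\mathbf X_n,Y_n))$ is a sample of independent $[0,1]^d\times\mathbb{R}$-valued random variables distributed as $(\mathbf X,Y)$ with $\mathbb{E}[Y^2]<\infty$. Random forest: let $\Theta,\Theta_1,\Theta_2,\dots$ be i.i.d. random variables independent of $\mathcal{D}_n$. For each value $\theta$ of $\Theta$ (and given $\mathcal D_n$) there is a regression tree $\mathcal{T}_n(\theta)$, i.e. a partition of $[0,1]^d$ into finitely many cells that are axis-parallel hyperrectangles, obtained by successive axis-parallel cuts; the construction may depend on $\theta$ and $\mathcal{D}_n$. Write $\mathbf x\overset{\theta}{\leftrightarrow}\mathbf z$ if $\mathbf x$ and $\mathbf z$ belong to the same cell of $\mathcal{T}_n(\theta)$, and let $N_n(\mathbf x,\theta)$ be the number of data points $\mathbf X_i$ in the cell of $\mathcal{T}_n(\theta)$ containing $\mathbf x$. The tree estimate is $m_n(\mathbf x,\theta)=\sum_{i=1}^n Y_i\,\mathbf 1_{\mathbf x\overset{\theta}{\leftrightarrow}\mathbf X_i}/N_n(\mathbf x,\theta)$ (with $0/0=0$). The finite forest estimate is $m_{M,n}(\mathbf x)=m_{M,n}(\mathbf x,\Theta_1,\dots,\Theta_M)=\frac1M\sum_{m=1}^M m_n(\mathbf x,\Theta_m)$ and the infinite forest estimate is $m_{\infty,n}(\mathbf x)=\mathbb{E}_\Theta[m_n(\mathbf x,\Theta)]$. Here $\mathbb{P}_\Theta,\mathbb{E}_\Theta,\mathrm{Cov}_\Theta$ are taken with respect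 to $\Theta$, conditionally on $\mathcal{D}_n$. Connection function: $K_n(\mathbf x,\mathbf z)=\mathbb{P}_\Theta[\mathbf x\overset{\Theta}{\leftrightarrow}\mathbf z]$ for $\mathbf x,\mathbf z\in[0,1]^d$. The forest is discrete if, with $\mathcal{D}_n$ fixed, $K_n$ is piecewise constant, i.e. there is a finite partition $\{A_1,\dots,A_p\}$ of $[0,1]^d$ such that $K_n$ is constant on each $A_i\times A_j$. Grid step: for $\varepsilon>0$, $$\delta(\varepsilon)=\sup\Big\{\eta\in\mathbb{R}:\ \sup_{\mathbf x_1,\mathbf x_2\in[0,1]^d,\ \|\mathbf x_1-\mathbf x_2\|_\infty\le\eta}|1-K_n(\mathbf x_1,\mathbf x_2)|\le\varepsilon^2/8\Big\}.$$ Empirical process: $\mathbb{G}_M=\sqrt{M}\big(\frac1M\sum_{m=1}^M\delta_{\Theta_m}-\mathbb{P}_\Theta\big)$, with $\delta_{\Theta_m}$ the Dirac mass at $\Theta_m$, so that $\mathbb{G}_M g_{\mathbf x}=\sqrt M(m_{M,n}(\mathbf x)-m_{\infty,n}(\mathbf x))$. *)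

theory Defs
  imports "HOL-Probability.Probability"
begin

section \<open>Regression trees and random forests\<close>

abbreviation unit_cube :: "(real ^ 'd) set" where
  "unit_cube \<equiv> cbox 0 1"

text \<open>
  Partitions of the unit cube obtained by successive axis-parallel cuts.  The
  side of the cut that keeps the boundary hyperplane is left free, and a cut has to be
  effective (two nonempty sides), so that the cells always form a partition.
\<close>

inductive cut_partition :: "(real ^ 'd) set set \<Rightarrow> bool" where
  root: "cut_partition {unit_cube}"
| cut_le: "cut_partition T \<Longrightarrow> A \<in> T \<Longrightarrow>
    {x \<in> A. x $ j \<le> s} \<noteq> {} \<Longrightarrow> {x \<in> A. s < x $ j} \<noteq> {} \<Longrightarrow>
    cut_partition (T - {A} \<union> {{x \<in> A. x $ j \<le> s}, {x \<in> A. s < x $ j}})"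
| cut_less: "cut_partition T \<Longrightarrow> A \<in> T \<Longrightarrow>
    {x \<in> A. x $ j < s} \<noteq> {} \<Longrightarrow> {x \<in> A. s \<le> x $ j} \<noteq> {} \<Longrightarrow>
    cut_partition (T - {A} \<union> {{x \<in> A. x $ j < s}, {x \<in> A. s \<le> x $ j}})"

lemma partition_on_split:
  assumes "partition_on S T" "A \<in> T" "B \<union> C = A" "B \<inter> C = {}" "B \<noteq> {}" "C \<noteq> {}"
  shows "partition_on S (T - {A} \<union> {B, C})"
proof (rule partition_onI)
  show "\<Union> (T - {A} \<union> {B, C}) = S"
    using assms(1-3) by (auto simp: partition_on_def)
  show "{} \<notin> T - {A} \<union> {B, C}"
    using assms by (auto simp: partition_on_def)
  have "disjnt p A" if "p \<in> T" "p \<noteq> A" for p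
    using that assms(1,2) by (auto simp: partition_on_def disjoint_def disjnt_def)
  then have *: "disjnt p B \<and> disjnt p C" if "p \<in> T" "p \<noteq> A" for p
    using that assms(3) by (auto simp: disjnt_def)
  have "disjnt p q" if "p \<in> T" "q \<in> T" "p \<noteq> q" for p q
    using that assms(1) by (auto simp: partition_on_def disjoint_def disjnt_def)
  moreover have "disjnt B p \<and> disjnt C p" if "p \<in> T" "p \<noteq> A" for p
    using *[OF that] by (simp add: disjnt_sym)
  moreover have "disjnt B C" "disjnt C B" using assms(4) by (auto simp: disjnt_def)
  ultimately show "disjnt p q" if "p \<in> T - {A} \<union> {B, C}" "q \<in> T - {A} \<union> {B, C}" "p \<noteq> q" for p q
    using that * by blast
qed

lemma cut_partition_finite_partition:
  fixes T :: "(real ^ 'd) set set"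
  assumes "cut_partition T"
  shows "finite T \<and> partition_on unit_cube T"
  using assms
proof induction
  case root
  have "(0 :: real ^ 'd) \<in> cbox 0 1" by (simp add: mem_box_cart)
  then have "cbox 0 (1 :: real ^ 'd) \<noteq> {}" by blast
  then show ?case by (auto intro: partition_on_space)
next
  case (cut_le T A j s)
  then show ?case by (intro conjI partition_on_split) auto
next
  case (cut_less T A j s)
  then show ?case by (intro conjI partition_on_split) auto
qed

definition same_cell :: "(real ^ 'd) set set \<Rightarrow> real ^ 'd \<Rightarrow> real ^ 'd \<Rightarrow> bool" where
  "same_cell T x z \<longleftrightarrow> (\<exists>A\<in>T. x \<in> A \<and> z \<in> A)"

definition cell_count :: "nat \<Rightarrow> (nat \<Rightarrow> real ^ 'd) \<Rightarrow> (real ^ 'd) set set \<Rightarrow> real ^ 'd \<Rightarrow> nat" where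
  "cell_count n X T x = card {i. i < n \<and> same_cell T x (X i)}"

definition tree_estimate ::
    "nat \<Rightarrow> (nat \<Rightarrow> real ^ 'd) \<Rightarrow> (nat \<Rightarrow> real) \<Rightarrow> (real ^ 'd) set set \<Rightarrow> real ^ 'd \<Rightarrow> real" where
  "tree_estimate n X Y T x =
     (\<Sum>i<n. Y i * of_bool (same_cell T x (X i)) / real (cell_count n X T x))"

text \<open>
  The training set is fixed, so a forest is given by the law \<^term>\<open>P\<close> of the randomization
  variable and the map \<^term>\<open>T\<close> sending a value of it to its tree; \<^term>\<open>T\<close> may depend on the
  training set in any way.  Measurability of the connection events is what makes the
  connection function meaningful.
\<close>

definition random_forest :: "'t measure \<Rightarrow> ('t \<Rightarrow> (real ^ 'd) set set) \<Rightarrow> bool" where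
  "random_forest P T \<longleftrightarrow> prob_space P \<and> (\<forall>\<theta>\<in>space P. cut_partition (T \<theta>)) \<and>
     (\<forall>x\<in>unit_cube. \<forall>z\<in>unit_cube. {\<theta>\<in>space P. same_cell (T \<theta>) x z} \<in> sets P)"

definition connection ::
    "'t measure \<Rightarrow> ('t \<Rightarrow> (real ^ 'd) set set) \<Rightarrow> real ^ 'd \<Rightarrow> real ^ 'd \<Rightarrow> real" where
  "connection P T x z = measure P {\<theta>\<in>space P. same_cell (T \<theta>) x z}"

definition finite_forest ::
    "nat \<Rightarrow> (nat \<Rightarrow> real ^ 'd) \<Rightarrow> (nat \<Rightarrow> real) \<Rightarrow> ('t \<Rightarrow> (real ^ 'd) set set) \<Rightarrow>
     (nat \<Rightarrow> 't) \<Rightarrow> nat \<Rightarrow> real ^ 'd \<Rightarrow> real" where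
  "finite_forest n X Y T \<theta> M x = 1 / real M * (\<Sum>m=1..M. tree_estimate n X Y (T (\<theta> m)) x)"

definition infinite_forest ::
    "nat \<Rightarrow> (nat \<Rightarrow> real ^ 'd) \<Rightarrow> (nat \<Rightarrow> real) \<Rightarrow> 't measure \<Rightarrow> ('t \<Rightarrow> (real ^ 'd) set set) \<Rightarrow>
     real ^ 'd \<Rightarrow> real" where
  "infinite_forest n X Y P T x = (LINT \<theta>|P. tree_estimate n X Y (T \<theta>) x)"

definition discrete_forest :: "'t measure \<Rightarrow> ('t \<Rightarrow> (real ^ 'd) set set) \<Rightarrow> bool" where
  "discrete_forest P T \<longleftrightarrow>
     (\<exists>\<A>. finite \<A> \<and> partition_on unit_cube \<A> \<and>
        (\<forall>A\<in>\<A>. \<forall>B\<in>\<A>. \<exists>c. \<forall>x\<in>A. \<forall>z\<in>B. connection P T x z = c))"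

text \<open>
  Both suprema are taken in the extended reals: the outer one is infinite as soon as
  \<open>\<epsilon>\<^sup>2 / 8 \<ge> 1\<close>, and the inner one is over the empty set when \<open>\<eta> < 0\<close>.
\<close>

definition grid_step :: "'t measure \<Rightarrow> ('t \<Rightarrow> (real ^ 'd) set set) \<Rightarrow> real \<Rightarrow> ereal" where
  "grid_step P T \<epsilon> = Sup {ereal \<eta> | \<eta>.
     Sup {ereal \<bar>1 - connection P T x1 x2\<bar> | x1 x2.
        x1 \<in> unit_cube \<and> x2 \<in> unit_cube \<and> infnorm (x1 - x2) \<le> \<eta>} \<le> ereal (\<epsilon>\<^sup>2 / 8)}"

text \<open>Members of the class are restricted to \<^term>\<open>space P\<close>, where the trees are specified.\<close>

definition forest_fun ::
    "nat \<Rightarrow> (nat \<Rightarrow> real ^ 'd) \<Rightarrow> (nat \<Rightarrow> real) \<Rightarrow> 't measure \<Rightarrow> ('t \<Rightarrow> (real ^ 'd) set set) \<Rightarrow>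
     real ^ 'd \<Rightarrow> 't \<Rightarrow> real" where
  "forest_fun n X Y P T x = (\<lambda>\<theta>\<in>space P. tree_estimate n X Y (T \<theta>) x)"

definition forest_class ::
    "nat \<Rightarrow> (nat \<Rightarrow> real ^ 'd) \<Rightarrow> (nat \<Rightarrow> real) \<Rightarrow> 't measure \<Rightarrow> ('t \<Rightarrow> (real ^ 'd) set set) \<Rightarrow>
     ('t \<Rightarrow> real) set" where
  "forest_class n X Y P T = forest_fun n X Y P T ` unit_cube"

definition empirical_process ::
    "'t measure \<Rightarrow> (nat \<Rightarrow> 't) \<Rightarrow> nat \<Rightarrow> ('t \<Rightarrow> real) \<Rightarrow> real" where
  "empirical_process P \<theta> M g = sqrt (real M) * (1 / real M * (\<Sum>m=1..M. g (\<theta> m)) - (LINT t|P. g t))"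


section \<open>Weak convergence in spaces of bounded functions\<close>

text \<open>
  The space of all bounded real functions on \<^term>\<open>F\<close> with the supremum distance.
\<close>

abbreviation linf :: "'i set \<Rightarrow> ('i \<Rightarrow> real) metric" where
  "linf F \<equiv> funspace F euclidean_metric"

definition borel_of_metric :: "'a metric \<Rightarrow> 'a measure" where
  "borel_of_metric m = sigma (mspace m) {U. openin (mtopology_of m) U}"

text \<open>
  The outer expectation, used below only for bounded functions on a probability space; for
  these it does not matter that only integrable, real-valued majorants are allowed.
\<close>

definition outer_expectation :: "'w measure \<Rightarrow> ('w \<Rightarrow> real) \<Rightarrow> real" where
  "outer_expectation M f =
     Inf {integral\<^sup>L M U | U. integrable M U \<and> (\<forall>\<omega>\<in>space M. f \<omega> \<le> U \<omega>)}"

text \<open>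
  Convergence in distribution in the sense of Hoffmann-Jorgensen: the maps \<^term>\<open>Z k\<close> need not
  be Borel measurable (in a nonseparable space such as \<^term>\<open>linf F\<close> they usually
  are not), the limit law \<^term>\<open>L\<close> is a Borel probability measure.
\<close>

definition converges_in_law ::
    "'a metric \<Rightarrow> 'w measure \<Rightarrow> (nat \<Rightarrow> 'w \<Rightarrow> 'a) \<Rightarrow> 'a measure \<Rightarrow> bool" where
  "converges_in_law m M Z L \<longleftrightarrow>
     prob_space L \<and> sets L = sets (borel_of_metric m) \<and>
     (\<forall>k. \<forall>\<omega>\<in>space M. Z k \<omega> \<in> mspace m) \<and>
     (\<forall>h :: 'a \<Rightarrow> real. continuous_map (mtopology_of m) euclideanreal h \<and> bounded (h ` mspace m) \<longrightarrow>
        (\<lambda>k. outer_expectation M (\<lambda>\<omega>. h (Z k \<omega>))) \<longlonglongrightarrow> (LINT z|L. h z))"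

definition tight_law :: "'a metric \<Rightarrow> 'a measure \<Rightarrow> bool" where
  "tight_law m L \<longleftrightarrow>
     (\<forall>e>0. \<exists>K. compactin (mtopology_of m) K \<and> measure L K \<ge> 1 - e)"

text \<open>Normal distributions with variance zero (point masses) are included.\<close>

definition normal_rv :: "'w measure \<Rightarrow> ('w \<Rightarrow> real) \<Rightarrow> bool" where
  "normal_rv M Z \<longleftrightarrow> Z \<in> borel_measurable M \<and>
     ((\<exists>\<mu> \<sigma>. \<sigma> > 0 \<and> distributed M lborel Z (normal_density \<mu> \<sigma>)) \<or>
      (\<exists>\<mu>. AE \<omega> in M. Z \<omega> = \<mu>))"

definition gaussian_process :: "'w measure \<Rightarrow> 'i set \<Rightarrow> ('i \<Rightarrow> 'w \<Rightarrow> real) \<Rightarrow> bool" where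
  "gaussian_process M F G \<longleftrightarrow>
     (\<forall>J c. finite J \<and> J \<subseteq> F \<longrightarrow> normal_rv M (\<lambda>\<omega>. \<Sum>j\<in>J. c j * G j \<omega>))"

definition covariance :: "'w measure \<Rightarrow> ('w \<Rightarrow> real) \<Rightarrow> ('w \<Rightarrow> real) \<Rightarrow> real" where
  "covariance M U V =
     (LINT \<omega>|M. (U \<omega> - (LINT \<omega>'|M. U \<omega>')) * (V \<omega> - (LINT \<omega>'|M. V \<omega>')))"

end

theory Submission
  imports Defs
begin

text \<open>
  Every cell of a tree is a product of intervals, so a point \<open>x\<close> lies in the cell of the data
  point \<open>X i\<close> iff each coordinate of \<open>x\<close>, substituted into \<open>X i\<close>, does not leave this cell.
  For fixed \<open>i\<close> and fixed coordinate these events form a one-parameter family that is monotone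
  on either side of \<open>X i\<close>; hence they, and with them the tree estimates, have polynomial
  $L^1$ bracketing numbers.  The uniform central limit theorem for such a class follows by
  chaining along the lower brackets with the bound $E \exp(|G_M h| / s) \le 2 e$, which holds as
  long as $\|h\|_2 \le s$ and $2 \|h\|_\infty \le s \sqrt M$.  The limit is built by hand:
  orthogonalizing the countably many lower brackets represents each of them by a finite
  combination of independent normal variables, and the same chaining bound makes these
  combinations converge uniformly, on compact sets of arbitrarily large probability.
\<close>

section \<open>Gaussian sequences and convergence of random vectors\<close>

text \<open>Uniform bounds over the class are never taken as suprema of the process itself, which
  need not be measurable. Each is dominated by finitely many terms attached to pairs of bracket
  functions, so that Lipschitz test functions of the process are enclosed between integrable
  functions and outer expectations are estimated by ordinary integrals. Only the lower functions,
  finitely many per level, are compared with Gaussian variables. Since they are combinations of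
  orthogonal functions, their limits have independent coordinates, and no normal law with a general
  covariance matrix has to be constructed. The base 64 is chosen so that its powers can be spent
  several times. For bounded functions an L1 size of 64^(-k) means an L2 size of order 8^(-k). Of
  this decay a factor 2^k pays for the logarithm of the number of links, and another 2^k weights the
  increments in the compact sets that carry the limit law; what remains is still geometric.\<close>

abbreviation gauss_seq :: "(nat \<Rightarrow> real) measure" where
  "gauss_seq \<equiv> Pi\<^sub>M UNIV (\<lambda>_. std_normal_distribution)"

lemma prob_space_std_normal: "prob_space std_normal_distribution"
  by (rule prob_space_normal_density) simp

lemma prob_space_gauss_seq: "prob_space gauss_seq"
  by (intro prob_space_PiM prob_space_std_normal)

text \<open>The index set is countable, so the product sigma-algebra is the Borel sigma-algebra of
  the product topology. Continuity and closedness then give measurability throughout.\<close>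

lemma sets_gauss_seq [measurable_cong]: "sets gauss_seq = sets (borel :: (nat \<Rightarrow> real) measure)"
proof -
  have "sets gauss_seq = sets (Pi\<^sub>M UNIV (\<lambda>_. borel) :: (nat \<Rightarrow> real) measure)"
    by (rule sets_PiM_cong) auto
  then show ?thesis by (simp add: sets_PiM_equal_borel)
qed

lemma space_gauss_seq [simp]: "space gauss_seq = UNIV"
  using sets_eq_imp_space_eq[OF sets_gauss_seq] by simp

lemma measurable_coordinate [measurable]: "(\<lambda>y. y i) \<in> borel_measurable (borel :: (nat \<Rightarrow> real) measure)"
  by (intro borel_measurable_continuous_onI continuous_on_product_coordinates)

lemma distr_gauss_seq_coordinate: "distr gauss_seq borel (\<lambda>y. y i) = std_normal_distribution"
proof -
  have "distr gauss_seq borel (\<lambda>y. y i) = distr gauss_seq std_normal_distribution (\<lambda>y. y i)"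
    by (rule distr_cong) auto
  also have "\<dots> = std_normal_distribution"
    by (rule distr_PiM_component) (auto intro: prob_space_std_normal)
  finally show ?thesis .
qed

lemma indep_vars_gauss_seq: "prob_space.indep_vars gauss_seq (\<lambda>_. borel) (\<lambda>i y. y i) UNIV"
proof -
  interpret prob_space gauss_seq by (rule prob_space_gauss_seq)
  have "distr gauss_seq (Pi\<^sub>M UNIV (\<lambda>_. borel)) (\<lambda>x. x) = distr gauss_seq gauss_seq (\<lambda>x. x)"
    by (rule distr_cong) (auto simp: sets_PiM_equal_borel sets_gauss_seq)
  then show ?thesis
    by (subst indep_vars_iff_distr_eq_PiM) (simp_all add: distr_gauss_seq_coordinate distr_id restrict_UNIV)
qed

lemma
  fixes f :: "nat \<Rightarrow> real \<Rightarrow> 'b :: {real_normed_field, banach, second_countable_topology}"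
  assumes I: "finite I" and f: "\<And>i. i \<in> I \<Longrightarrow> integrable std_normal_distribution (f i)"
  shows integrable_gauss_seq_prod: "integrable gauss_seq (\<lambda>y. \<Prod>i\<in>I. f i (y i))"
    and integral_gauss_seq_prod:
      "(LINT y|gauss_seq. (\<Prod>i\<in>I. f i (y i))) = (\<Prod>i\<in>I. LINT t|std_normal_distribution. f i t)"
proof -
  interpret prob_space gauss_seq by (rule prob_space_gauss_seq)
  have f_meas: "f i \<in> borel_measurable borel" if "i \<in> I" for i
    using f[OF that] by (auto dest!: borel_measurable_integrable)
  have ind: "indep_vars (\<lambda>_. borel) (\<lambda>i y. f i (y i)) I"
    by (rule indep_vars_compose2[OF indep_vars_subset[OF indep_vars_gauss_seq]]) (use f_meas in auto)
  have int: "integrable gauss_seq (\<lambda>y. f i (y i)) \<and>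
      (LINT y|gauss_seq. f i (y i)) = (LINT t|std_normal_distribution. f i t)" if "i \<in> I" for i
    using f[OF that] f_meas[OF that]
    by (subst (asm) distr_gauss_seq_coordinate[symmetric, of i], subst distr_gauss_seq_coordinate[symmetric, of i])
       (simp add: integrable_distr_eq integral_distr)
  show "integrable gauss_seq (\<lambda>y. \<Prod>i\<in>I. f i (y i))"
    using indep_vars_integrable[OF I ind] int by simp
  show "(LINT y|gauss_seq. (\<Prod>i\<in>I. f i (y i))) = (\<Prod>i\<in>I. LINT t|std_normal_distribution. f i t)"
    using indep_vars_lebesgue_integral[OF I ind] int by simp
qed

lemma integrable_std_normal_iff:
  fixes f :: "real \<Rightarrow> 'b :: {banach, second_countable_topology}"
  assumes "f \<in> borel_measurable borel"
  shows "integrable std_normal_distribution f \<longleftrightarrow> integrable lborel (\<lambda>x. std_normal_density x *\<^sub>R f x)"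
  by (rule integrable_density) (use assms in \<open>auto\<close>)

lemma integral_std_normal:
  fixes f :: "real \<Rightarrow> 'b :: {banach, second_countable_topology}"
  assumes "f \<in> borel_measurable borel"
  shows "integral\<^sup>L std_normal_distribution f = (LINT x|lborel. std_normal_density x *\<^sub>R f x)"
  by (rule integral_density) (use assms in \<open>auto\<close>)

text \<open>The exact value is \<open>sqrt (2 / pi)\<close>; the bound 1 is all that the estimate of
  \<open>load\<close> uses.\<close>

lemma integrable_abs_coordinate: "integrable gauss_seq (\<lambda>y. \<bar>y k\<bar>)"
  and integral_abs_coordinate_le: "(LINT y|gauss_seq. \<bar>y k\<bar>) \<le> 1"
proof -
  have "has_bochner_integral lborel (\<lambda>x. std_normal_density x * \<bar>x\<bar>) (sqrt (2 / pi))"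
    using std_normal_moment_abs_odd[of 0] by simp
  then have "has_bochner_integral std_normal_distribution (\<lambda>x. \<bar>x\<bar>) (sqrt (2 / pi))"
    by (simp add: has_bochner_integral_iff integrable_std_normal_iff integral_std_normal)
  then have *: "integrable gauss_seq (\<lambda>y. \<bar>y k\<bar>) \<and> (LINT y|gauss_seq. \<bar>y k\<bar>) = sqrt (2 / pi)"
    unfolding has_bochner_integral_iff
    by (subst (asm) (1 2) distr_gauss_seq_coordinate[of k, symmetric])
       (simp add: integrable_distr_eq integral_distr)
  moreover have "sqrt (2 / pi) \<le> 1" using pi_gt3 by simp
  ultimately show "integrable gauss_seq (\<lambda>y. \<bar>y k\<bar>)" "(LINT y|gauss_seq. \<bar>y k\<bar>) \<le> 1" by auto
qed

section \<open>Gaussian smoothing kernels\<close>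

text \<open>The density of \<open>a + s \<eta>\<close> relative to that of \<open>\<eta>\<close>, for a standard normal \<open>\<eta>\<close>.\<close>

definition shift_kernel :: "real \<Rightarrow> real \<Rightarrow> real \<Rightarrow> real" where
  "shift_kernel s a y = normal_density a s y / std_normal_density y"

lemma shift_kernel_nonneg [simp]: "0 \<le> shift_kernel s a y"
  by (simp add: shift_kernel_def)

lemma shift_kernel_measurable [measurable]:
  assumes [measurable]: "f \<in> borel_measurable M" "g \<in> borel_measurable M"
  shows "(\<lambda>\<omega>. shift_kernel s (f \<omega>) (g \<omega>)) \<in> borel_measurable M"
  unfolding shift_kernel_def normal_density_def by measurable

lemma std_normal_density_mult_shift_kernel:
  "std_normal_density y * shift_kernel s a y = normal_density a s y"
  using normal_density_pos[of 1 0 y] by (simp add: shift_kernel_def)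

text \<open>Up to normalization the Gaussian density is its own Fourier transform. This is the link
  between smoothed densities and characteristic functions.\<close>

lemma shift_kernel_eq_char:
  assumes "s > 0"
  shows "complex_of_real (shift_kernel s a y) =
    complex_of_real (1 / (sqrt (2 * pi * s\<^sup>2) * std_normal_density y)) *
      (CLINT z|std_normal_distribution. iexp ((y - a) / s * z))"
proof -
  have "(CLINT z|std_normal_distribution. iexp ((y - a) / s * z)) = char std_normal_distribution ((y - a) / s)"
    by (simp add: char_def)
  also have "\<dots> = complex_of_real (exp (- ((y - a) / s)\<^sup>2 / 2))"
    by (simp only: char_std_normal_distribution)
  finally show ?thesis
    unfolding shift_kernel_def normal_density_def[of a s y] of_real_mult[symmetric]
    by (simp only: ) (simp add: power_divide)
qed

lemma
  assumes s: "s > 0"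
  shows integrable_shift_kernel: "integrable std_normal_distribution (shift_kernel s a)"
    and integral_shift_kernel: "(LINT y|std_normal_distribution. shift_kernel s a y) = 1"
    and integrable_dist_shift_kernel:
      "integrable std_normal_distribution (\<lambda>y. \<bar>y - a\<bar> * shift_kernel s a y)"
    and integral_dist_shift_kernel_le:
      "(LINT y|std_normal_distribution. \<bar>y - a\<bar> * shift_kernel s a y) \<le> s"
proof -
  have [simp]: "std_normal_density y * shift_kernel s a y = normal_density a s y"
    "std_normal_density y * (\<bar>y - a\<bar> * shift_kernel s a y) = normal_density a s y * \<bar>y - a\<bar>" for y
    using std_normal_density_mult_shift_kernel[of y s a] by (simp_all add: ac_simps)
  show "integrable std_normal_distribution (shift_kernel s a)"
    using s by (subst integrable_std_normal_iff) simp_all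
  show "(LINT y|std_normal_distribution. shift_kernel s a y) = 1"
    using s by (subst integral_std_normal) simp_all
  have "has_bochner_integral lborel (\<lambda>x. normal_density a s x * \<bar>x - a\<bar>) (s * sqrt (2 / pi))"
    using normal_moment_abs_odd[OF s, of a 0] by simp
  then have *: "integrable lborel (\<lambda>x. normal_density a s x * \<bar>x - a\<bar>)"
     "(LINT x|lborel. normal_density a s x * \<bar>x - a\<bar>) = s * sqrt (2 / pi)"
    by (auto simp: has_bochner_integral_iff)
  show "integrable std_normal_distribution (\<lambda>y. \<bar>y - a\<bar> * shift_kernel s a y)"
    by (subst integrable_std_normal_iff) (simp_all add: *)
  have "sqrt (2 / pi) \<le> 1" using pi_gt3 by simp
  then show "(LINT y|std_normal_distribution. \<bar>y - a\<bar> * shift_kernel s a y) \<le> s"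
    using s by (subst integral_std_normal) (simp_all add: *)
qed

text \<open>The density, relative to \<open>gauss_seq\<close>, of the law that places coordinate
  \<open>i < r\<close> at \<open>x i\<close> plus \<open>s\<close> times a standard normal variable
  and leaves all other coordinates standard normal. A probability measure as reference measure makes
  bounded functions integrable.\<close>

definition gauss_kernel :: "nat \<Rightarrow> real \<Rightarrow> (nat \<Rightarrow> real) \<Rightarrow> (nat \<Rightarrow> real) \<Rightarrow> real" where
  "gauss_kernel r s x y = (\<Prod>i<r. shift_kernel s (x i) (y i))"

lemma gauss_kernel_nonneg [simp]: "0 \<le> gauss_kernel r s x y"
  by (auto simp: gauss_kernel_def intro!: prod_nonneg)

lemma gauss_kernel_measurable [measurable]:
  assumes [measurable]: "\<And>i. (\<lambda>\<omega>. f \<omega> i) \<in> borel_measurable M" "\<And>i. (\<lambda>\<omega>. g \<omega> i) \<in> borel_measurable M"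
  shows "(\<lambda>\<omega>. gauss_kernel r s (f \<omega>) (g \<omega>)) \<in> borel_measurable M"
  unfolding gauss_kernel_def by measurable

lemma
  assumes "s > 0"
  shows integrable_gauss_kernel: "integrable gauss_seq (gauss_kernel r s x)"
    and integral_gauss_kernel: "(LINT y|gauss_seq. gauss_kernel r s x y) = 1"
  using integrable_gauss_seq_prod[of "{..<r}" "\<lambda>i. shift_kernel s (x i)"]
    integral_gauss_seq_prod[of "{..<r}" "\<lambda>i. shift_kernel s (x i)"]
    integrable_shift_kernel[OF assms] integral_shift_kernel[OF assms]
  by (simp_all add: gauss_kernel_def[abs_def])

lemma
  assumes s: "s > 0" and k: "k < r"
  shows integrable_dist_gauss_kernel: "integrable gauss_seq (\<lambda>y. \<bar>y k - x k\<bar> * gauss_kernel r s x y)"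
    and integral_dist_gauss_kernel_le: "(LINT y|gauss_seq. \<bar>y k - x k\<bar> * gauss_kernel r s x y) \<le> s"
proof -
  \<comment> \<open>Only the factor with index \<open>k\<close> carries the distance; every other
    factor integrates to 1.\<close>
  define f where "f i t = (if i = k then \<bar>t - x i\<bar> * shift_kernel s (x i) t else shift_kernel s (x i) t)" for i t
  have f_eq: "f k = (\<lambda>t. \<bar>t - x k\<bar> * shift_kernel s (x k) t)" "i \<noteq> k \<Longrightarrow> f i = shift_kernel s (x i)" for i
    by (auto simp: f_def fun_eq_iff)
  have int: "integrable std_normal_distribution (f i)" for i
    by (cases "i = k") (simp_all add: f_eq integrable_shift_kernel integrable_dist_shift_kernel s)
  have split: "{..<r} = insert k ({..<r} - {k})" using k by auto
  have eq: "(\<Prod>i<r. f i (y i)) = \<bar>y k - x k\<bar> * gauss_kernel r s x y" for y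
    unfolding gauss_kernel_def by (subst (1 2) split, subst (1 2) prod.insert) (simp_all add: f_eq)
  have int_eq: "(LINT t|std_normal_distribution. f i t) = 1" if "i \<noteq> k" for i
    using that by (simp add: f_eq integral_shift_kernel s)
  show "integrable gauss_seq (\<lambda>y. \<bar>y k - x k\<bar> * gauss_kernel r s x y)"
    using integrable_gauss_seq_prod[of "{..<r}" f] int by (simp add: eq)
  have "(LINT y|gauss_seq. \<bar>y k - x k\<bar> * gauss_kernel r s x y) = (\<Prod>i<r. LINT t|std_normal_distribution. f i t)"
    using integral_gauss_seq_prod[of "{..<r}" f] int by (simp add: eq)
  also have "\<dots> = (LINT t|std_normal_distribution. f k t)"
    by (subst split, subst prod.insert) (auto simp: int_eq)
  also have "\<dots> \<le> s" by (simp add: f_eq integral_dist_shift_kernel_le s)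
  finally show "(LINT y|gauss_seq. \<bar>y k - x k\<bar> * gauss_kernel r s x y) \<le> s" .
qed

lemma gauss_kernel_eq_char:
  assumes s: "s > 0"
  shows "complex_of_real (gauss_kernel r s x y) =
    complex_of_real (\<Prod>i<r. 1 / (sqrt (2 * pi * s\<^sup>2) * std_normal_density (y i))) *
      (CLINT z|gauss_seq. iexp (\<Sum>i<r. (y i - x i) / s * z i))"
proof -
  have "(CLINT z|gauss_seq. iexp (\<Sum>i<r. (y i - x i) / s * z i)) =
      (CLINT z|gauss_seq. (\<Prod>i<r. iexp ((y i - x i) / s * z i)))"
    by (simp add: exp_sum[symmetric] sum_distrib_left)
  also have "\<dots> = (\<Prod>i<r. CLINT t|std_normal_distribution. iexp ((y i - x i) / s * t))"
  proof (rule integral_gauss_seq_prod)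
    fix i
    interpret N: prob_space std_normal_distribution by (rule prob_space_std_normal)
    show "integrable std_normal_distribution (\<lambda>t. iexp ((y i - x i) / s * t))"
    proof (rule N.integrable_iexp)
      have "(\<lambda>t. complex_of_real ((y i - x i) / s * t)) \<in> borel_measurable borel"
        by (intro borel_measurable_continuous_onI continuous_intros) (use s in simp)
      then show "(\<lambda>t. complex_of_real ((y i - x i) / s * t)) \<in> borel_measurable std_normal_distribution"
        by simp
    qed (simp only: Im_complex_of_real)
  qed simp
  finally have *: "(CLINT z|gauss_seq. iexp (\<Sum>i<r. (y i - x i) / s * z i)) =
     (\<Prod>i<r. CLINT t|std_normal_distribution. iexp ((y i - x i) / s * t))" .
  show ?thesis
    unfolding * gauss_kernel_def of_real_prod prod.distrib[symmetric]
    by (intro prod.cong refl shift_kernel_eq_char s)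
qed

text \<open>
  Smoothing a law with a Gaussian kernel gives it a density that is a mixture of values of
  its characteristic function.  So convergence of the characteristic functions entails
  pointwise, hence by Scheffe's lemma $L^1$, convergence of the smoothed densities.
\<close>

lemma tendsto_expectation_gauss_kernel:
  fixes S :: "nat \<Rightarrow> nat \<Rightarrow> 'w \<Rightarrow> real" and Z :: "nat \<Rightarrow> 'v \<Rightarrow> real"
  assumes M: "prob_space M" and M': "prob_space M'"
    and S [measurable]: "\<And>n i. S n i \<in> borel_measurable M"
    and Z [measurable]: "\<And>i. Z i \<in> borel_measurable M'"
    and conv: "\<And>c. (\<lambda>n. CLINT \<omega>|M. iexp (\<Sum>i<r. c i * S n i \<omega>))
       \<longlonglongrightarrow> (CLINT \<omega>|M'. iexp (\<Sum>i<r. c i * Z i \<omega>))"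
    and s: "s > 0"
  shows "(\<lambda>n. LINT \<omega>|M. gauss_kernel r s (\<lambda>i. S n i \<omega>) y) \<longlonglongrightarrow>
     (LINT \<omega>|M'. gauss_kernel r s (\<lambda>i. Z i \<omega>) y)"
proof -
  interpret G: prob_space gauss_seq by (rule prob_space_gauss_seq)
  define D where "D = complex_of_real (\<Prod>i<r. 1 / (sqrt (2 * pi * s\<^sup>2) * std_normal_density (y i)))"
  \<comment> \<open>Fubini exchanges the expectation with the mixture over \<open>z\<close>. The
    phase splits into two factors, and \<open>U\<close> enters only through its characteristic
    function at \<open>- z / s\<close>.\<close>
  have *: "complex_of_real (LINT \<omega>|N. gauss_kernel r s (\<lambda>i. U i \<omega>) y) =
      D * (CLINT z|gauss_seq. iexp (\<Sum>i<r. y i / s * z i) * (CLINT \<omega>|N. iexp (\<Sum>i<r. (- z i / s) * U i \<omega>)))"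
    if N: "prob_space N" and [measurable]: "\<And>i. U i \<in> borel_measurable N"
    for N :: "'u measure" and U :: "nat \<Rightarrow> 'u \<Rightarrow> real"
  proof -
    interpret N: prob_space N by fact
    interpret GN: pair_prob_space N gauss_seq ..
    have int: "integrable (N \<Otimes>\<^sub>M gauss_seq) (\<lambda>(\<omega>, z). iexp (\<Sum>i<r. (y i - U i \<omega>) / s * z i))"
      unfolding split_beta by (rule GN.P.integrable_iexp) measurable
    have "complex_of_real (LINT \<omega>|N. gauss_kernel r s (\<lambda>i. U i \<omega>) y) =
        (CLINT \<omega>|N. D * (CLINT z|gauss_seq. iexp (\<Sum>i<r. (y i - U i \<omega>) / s * z i)))"
      unfolding integral_complex_of_real[symmetric] D_def
      by (intro Bochner_Integration.integral_cong refl gauss_kernel_eq_char s)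
    also have "\<dots> = D * (CLINT \<omega>|N. CLINT z|gauss_seq. iexp (\<Sum>i<r. (y i - U i \<omega>) / s * z i))"
      by simp
    also have "(CLINT \<omega>|N. CLINT z|gauss_seq. iexp (\<Sum>i<r. (y i - U i \<omega>) / s * z i)) =
        (CLINT z|gauss_seq. CLINT \<omega>|N. iexp (\<Sum>i<r. (y i - U i \<omega>) / s * z i))"
      using GN.Fubini_integral[OF int] by simp
    also have "\<dots> = (CLINT z|gauss_seq. iexp (\<Sum>i<r. y i / s * z i) * (CLINT \<omega>|N. iexp (\<Sum>i<r. (- z i / s) * U i \<omega>)))"
    proof (rule Bochner_Integration.integral_cong[OF refl])
      fix z
      have "iexp (\<Sum>i<r. (y i - U i \<omega>) / s * z i) =
         iexp (\<Sum>i<r. y i / s * z i) * iexp (\<Sum>i<r. (- z i / s) * U i \<omega>)" for \<omega>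
        unfolding exp_add[symmetric] distrib_left[symmetric] of_real_add[symmetric] sum.distrib[symmetric]
        by (intro arg_cong[of _ _ exp] arg_cong[of _ _ "\<lambda>u. \<i> * complex_of_real u"] sum.cong refl)
           (simp add: diff_divide_distrib algebra_simps)
      then show "(CLINT \<omega>|N. iexp (\<Sum>i<r. (y i - U i \<omega>) / s * z i)) =
          iexp (\<Sum>i<r. y i / s * z i) * (CLINT \<omega>|N. iexp (\<Sum>i<r. (- z i / s) * U i \<omega>))"
        by simp
    qed
    finally show ?thesis .
  qed
  have "(\<lambda>n. CLINT z|gauss_seq. iexp (\<Sum>i<r. y i / s * z i) * (CLINT \<omega>|M. iexp (\<Sum>i<r. (- z i / s) * S n i \<omega>)))
     \<longlonglongrightarrow> (CLINT z|gauss_seq. iexp (\<Sum>i<r. y i / s * z i) * (CLINT \<omega>|M'. iexp (\<Sum>i<r. (- z i / s) * Z i \<omega>)))"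
  proof (rule integral_dominated_convergence[where w = "\<lambda>_. 1"])
    interpret M: prob_space M by fact
    interpret M': prob_space M' by fact
    have [measurable]: "(\<lambda>z. CLINT \<omega>|M. iexp (\<Sum>i<r. (- z i / s) * S n i \<omega>)) \<in> borel_measurable gauss_seq" for n
      by (rule M.borel_measurable_lebesgue_integral) (unfold split_beta, measurable)
    have [measurable]: "(\<lambda>z. CLINT \<omega>|M'. iexp (\<Sum>i<r. (- z i / s) * Z i \<omega>)) \<in> borel_measurable gauss_seq"
      by (rule M'.borel_measurable_lebesgue_integral) (unfold split_beta, measurable)
    show "(\<lambda>z. iexp (\<Sum>i<r. y i / s * z i) * (CLINT \<omega>|M. iexp (\<Sum>i<r. (- z i / s) * S n i \<omega>)))
      \<in> borel_measurable gauss_seq" for n by measurable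
    show "(\<lambda>z. iexp (\<Sum>i<r. y i / s * z i) * (CLINT \<omega>|M'. iexp (\<Sum>i<r. (- z i / s) * Z i \<omega>)))
      \<in> borel_measurable gauss_seq" by measurable
    show "AE z in gauss_seq. (\<lambda>n. iexp (\<Sum>i<r. y i / s * z i) * (CLINT \<omega>|M. iexp (\<Sum>i<r. (- z i / s) * S n i \<omega>)))
      \<longlonglongrightarrow> iexp (\<Sum>i<r. y i / s * z i) * (CLINT \<omega>|M'. iexp (\<Sum>i<r. (- z i / s) * Z i \<omega>))"
      by (intro AE_I2 tendsto_mult tendsto_const conv)
    have "norm (CLINT \<omega>|M. iexp (\<Sum>i<r. (- z i / s) * S n i \<omega>)) \<le> 1" for z n
    proof -
      have "norm (CLINT \<omega>|M. iexp (\<Sum>i<r. (- z i / s) * S n i \<omega>)) \<le>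
          (LINT \<omega>|M. norm (iexp (\<Sum>i<r. (- z i / s) * S n i \<omega>)))"
        by (rule integral_norm_bound)
      then show ?thesis by (simp only: norm_exp_i_times) (simp add: M.prob_space)
    qed
    then show "AE z in gauss_seq. norm (iexp (\<Sum>i<r. y i / s * z i) * (CLINT \<omega>|M. iexp (\<Sum>i<r. (- z i / s) * S n i \<omega>))) \<le> 1" for n
      by (simp add: norm_mult)
  qed simp
  from tendsto_mult_left[OF this, of D]
  have "(\<lambda>n. complex_of_real (LINT \<omega>|M. gauss_kernel r s (\<lambda>i. S n i \<omega>) y)) \<longlonglongrightarrow>
     complex_of_real (LINT \<omega>|M'. gauss_kernel r s (\<lambda>i. Z i \<omega>) y)"
    by (subst (1 2) *) (use M M' in simp_all)
  then show ?thesis by (simp only: tendsto_of_real_iff)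
qed

text \<open>Replacing \<open>\<phi>\<close> by its smoothing costs at most \<open>K * r * s\<close>,
  uniformly over all laws. For fixed \<open>s\<close> the smoothed expectations converge because
  \<open>\<phi>\<close> is bounded and the smoothed densities converge in L1.\<close>

theorem tendsto_expectation_lipschitz:
  fixes S :: "nat \<Rightarrow> nat \<Rightarrow> 'w \<Rightarrow> real" and Z :: "nat \<Rightarrow> 'v \<Rightarrow> real"
  assumes M: "prob_space M" and M': "prob_space M'"
    and S [measurable]: "\<And>n i. S n i \<in> borel_measurable M"
    and Z [measurable]: "\<And>i. Z i \<in> borel_measurable M'"
    and conv: "\<And>c. (\<lambda>n. CLINT \<omega>|M. iexp (\<Sum>i<r. c i * S n i \<omega>))
       \<longlonglongrightarrow> (CLINT \<omega>|M'. iexp (\<Sum>i<r. c i * Z i \<omega>))"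
    and \<phi> [measurable]: "\<phi> \<in> borel_measurable (borel :: (nat \<Rightarrow> real) measure)"
    and H: "\<And>x. \<bar>\<phi> x\<bar> \<le> H"
    and K: "\<And>x y. \<bar>\<phi> x - \<phi> y\<bar> \<le> K * (\<Sum>i<r. \<bar>x i - y i\<bar>)" "0 \<le> K"
  shows "(\<lambda>n. LINT \<omega>|M. \<phi> (\<lambda>i. S n i \<omega>)) \<longlonglongrightarrow> (LINT \<omega>|M'. \<phi> (\<lambda>i. Z i \<omega>))"
proof -
  interpret G: prob_space gauss_seq by (rule prob_space_gauss_seq)
  define smooth where "smooth s x = (LINT y|gauss_seq. \<phi> y * gauss_kernel r s x y)" for s x
  have H0: "0 \<le> H" using H[of undefined] by linarith
  have int_smooth: "integrable gauss_seq (\<lambda>y. \<phi> y * gauss_kernel r s x y)" if "s > 0" for s x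
    by (rule Bochner_Integration.integrable_bound[OF integrable_mult_right[OF integrable_gauss_kernel[OF that, of r x], of H]])
       (use H0 in \<open>auto simp: abs_mult intro!: mult_right_mono H\<close>)
  have smooth_close: "\<bar>smooth s x - \<phi> x\<bar> \<le> K * r * s" if s: "s > 0" for s x
  proof -
    have "smooth s x - \<phi> x = (LINT y|gauss_seq. (\<phi> y - \<phi> x) * gauss_kernel r s x y)"
      using int_smooth[OF s, of x] integrable_gauss_kernel[OF s, of r x] integral_gauss_kernel[OF s, of r x]
      by (simp add: smooth_def left_diff_distrib)
    also have "\<bar>\<dots>\<bar> \<le> (LINT y|gauss_seq. \<bar>(\<phi> y - \<phi> x) * gauss_kernel r s x y\<bar>)"
      by (rule integral_abs_bound)
    also have "\<dots> \<le> (LINT y|gauss_seq. K * (\<Sum>i<r. \<bar>y i - x i\<bar> * gauss_kernel r s x y))"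
    proof (rule integral_mono)
      show "integrable gauss_seq (\<lambda>y. \<bar>(\<phi> y - \<phi> x) * gauss_kernel r s x y\<bar>)"
        using int_smooth[OF s, of x] integrable_gauss_kernel[OF s, of r x]
        by (simp add: left_diff_distrib)
      show "integrable gauss_seq (\<lambda>y. K * (\<Sum>i<r. \<bar>y i - x i\<bar> * gauss_kernel r s x y))"
        by (intro integrable_mult_right Bochner_Integration.integrable_sum integrable_dist_gauss_kernel s) auto
      show "\<bar>(\<phi> y - \<phi> x) * gauss_kernel r s x y\<bar> \<le> K * (\<Sum>i<r. \<bar>y i - x i\<bar> * gauss_kernel r s x y)" for y
        using mult_right_mono[OF K(1)[of y x] gauss_kernel_nonneg[of r s x y]]
        by (simp add: abs_mult sum_distrib_right mult.assoc)
    qed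
    also have "\<dots> = K * (\<Sum>i<r. LINT y|gauss_seq. \<bar>y i - x i\<bar> * gauss_kernel r s x y)"
      by (subst integral_mult_right_zero, subst Bochner_Integration.integral_sum)
         (auto intro!: integrable_dist_gauss_kernel s)
    also have "\<dots> \<le> K * (\<Sum>i<r. s)"
      by (intro mult_left_mono sum_mono integral_dist_gauss_kernel_le s K) auto
    finally show ?thesis by simp
  qed
  have smooth_measurable [measurable]: "(\<lambda>\<omega>. smooth s (\<lambda>i. U i \<omega>)) \<in> borel_measurable N"
    if [measurable]: "\<And>i. U i \<in> borel_measurable N" for N :: "'u measure" and U :: "nat \<Rightarrow> 'u \<Rightarrow> real" and s
    unfolding smooth_def
    by (rule G.borel_measurable_lebesgue_integral) (unfold split_beta, measurable)
  have smooth_bound: "\<bar>smooth s x\<bar> \<le> H" if s: "s > 0" for s x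
  proof -
    have "\<bar>smooth s x\<bar> \<le> (LINT y|gauss_seq. \<bar>\<phi> y * gauss_kernel r s x y\<bar>)"
      unfolding smooth_def by (rule integral_abs_bound)
    also have "\<dots> \<le> (LINT y|gauss_seq. H * gauss_kernel r s x y)"
      by (rule integral_mono[OF integrable_abs[OF int_smooth[OF s]] integrable_mult_right[OF integrable_gauss_kernel[OF s]]])
         (auto simp: abs_mult intro!: mult_right_mono H)
    finally show ?thesis by (simp add: integral_gauss_kernel[OF s])
  qed
  \<comment> \<open>By Fubini the smoothing moves from the test function to the law: the expectation
    of \<open>smooth\<close> is an integral of \<open>\<phi>\<close> against the density
    \<open>q\<close>.\<close>
  have density: "integrable gauss_seq (\<lambda>y. \<phi> y * q y) \<and> integrable gauss_seq q \<and> (LINT y|gauss_seq. q y) = 1 \<and>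
      (LINT \<omega>|N. smooth s (\<lambda>i. U i \<omega>)) = (LINT y|gauss_seq. \<phi> y * q y)"
    if s: "s > 0" and N: "prob_space N" and [measurable]: "\<And>i. U i \<in> borel_measurable N"
      and q: "q = (\<lambda>y. LINT \<omega>|N. gauss_kernel r s (\<lambda>i. U i \<omega>) y)"
    for N :: "'u measure" and U :: "nat \<Rightarrow> 'u \<Rightarrow> real" and s q
  proof -
    interpret N: prob_space N by fact
    interpret GN: pair_prob_space N gauss_seq ..
    have int: "integrable (N \<Otimes>\<^sub>M gauss_seq) (\<lambda>(\<omega>, y). gauss_kernel r s (\<lambda>i. U i \<omega>) y)"
      by (rule GN.Fubini_integrable)
         (unfold split_beta, measurable, simp_all add: integral_gauss_kernel integrable_gauss_kernel s)
    have int\<phi>: "integrable (N \<Otimes>\<^sub>M gauss_seq) (\<lambda>(\<omega>, y). \<phi> y * gauss_kernel r s (\<lambda>i. U i \<omega>) y)"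
    proof (rule Bochner_Integration.integrable_bound[OF integrable_mult_right[OF int, of H]])
      have [measurable]: "(\<lambda>p. \<phi> (snd p)) \<in> borel_measurable (N \<Otimes>\<^sub>M gauss_seq)"
        by (rule measurable_compose[OF measurable_snd]) simp
      show "(\<lambda>(\<omega>, y). \<phi> y * gauss_kernel r s (\<lambda>i. U i \<omega>) y) \<in> borel_measurable (N \<Otimes>\<^sub>M gauss_seq)"
        unfolding split_beta by measurable
    qed (use H0 in \<open>auto simp: abs_mult split_beta intro!: AE_I2 mult_right_mono H\<close>)
    show ?thesis
      using GN.integrable_snd[OF int] GN.integrable_snd[OF int\<phi>] GN.Fubini_integral[OF int] GN.Fubini_integral[OF int\<phi>]
      by (simp add: q smooth_def integral_gauss_kernel[OF s] N.prob_space)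
  qed
  have smooth_conv: "(\<lambda>n. LINT \<omega>|M. smooth s (\<lambda>i. S n i \<omega>)) \<longlonglongrightarrow> (LINT \<omega>|M'. smooth s (\<lambda>i. Z i \<omega>))"
    if s: "s > 0" for s
  proof -
    define q where "q n y = (LINT \<omega>|M. gauss_kernel r s (\<lambda>i. S n i \<omega>) y)" for n y
    define q' where "q' y = (LINT \<omega>|M'. gauss_kernel r s (\<lambda>i. Z i \<omega>) y)" for y
    have dq: "integrable gauss_seq (\<lambda>y. \<phi> y * q n y) \<and> integrable gauss_seq (q n) \<and> (LINT y|gauss_seq. q n y) = 1 \<and>
      (LINT \<omega>|M. smooth s (\<lambda>i. S n i \<omega>)) = (LINT y|gauss_seq. \<phi> y * q n y)" for n
      by (rule density[OF s M]) (simp_all add: q_def fun_eq_iff)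
    have dq': "integrable gauss_seq (\<lambda>y. \<phi> y * q' y) \<and> integrable gauss_seq q' \<and> (LINT y|gauss_seq. q' y) = 1 \<and>
      (LINT \<omega>|M'. smooth s (\<lambda>i. Z i \<omega>)) = (LINT y|gauss_seq. \<phi> y * q' y)"
      by (rule density[OF s M']) (simp_all add: q'_def fun_eq_iff)
    have int_q: "integrable gauss_seq (q n)" "integrable gauss_seq q'" for n
      using dq dq' by auto
    then have [measurable]: "q n \<in> borel_measurable borel" "q' \<in> borel_measurable borel" for n
      by (auto dest!: borel_measurable_integrable simp: measurable_cong_sets[OF sets_gauss_seq refl])
    have q_nonneg: "0 \<le> q n y" "0 \<le> q' y" for n y by (auto simp: q_def q'_def)
    have nn: "(\<integral>\<^sup>+y. norm (q n y) \<partial>gauss_seq) = 1" "(\<integral>\<^sup>+y. norm (q' y) \<partial>gauss_seq) = 1" for n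
      using dq dq' q_nonneg int_q
      by (simp_all add: nn_integral_eq_integral)
    have "(\<lambda>n. \<integral>\<^sup>+y. norm (q n y - q' y) \<partial>gauss_seq) \<longlonglongrightarrow> 0"
    proof (rule Scheffe_lemma2[OF _ int_q(2)])
      show "AE y in gauss_seq. (\<lambda>n. q n y) \<longlonglongrightarrow> q' y"
        unfolding q_def q'_def by (intro AE_I2 tendsto_expectation_gauss_kernel[OF M M' S Z conv s])
      show "(\<integral>\<^sup>+y. norm (q n y) \<partial>gauss_seq) \<le> (\<integral>\<^sup>+y. norm (q' y) \<partial>gauss_seq)" for n
        by (simp only: nn)
    qed simp
    then have lim: "(\<lambda>n. ennreal H * (\<integral>\<^sup>+y. norm (q n y - q' y) \<partial>gauss_seq)) \<longlonglongrightarrow> ennreal H * 0"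
      by (intro ennreal_tendsto_cmult) simp_all
    have "(\<lambda>n. \<integral>\<^sup>+y. norm (\<phi> y * q n y - \<phi> y * q' y) \<partial>gauss_seq) \<longlonglongrightarrow> 0"
    proof (rule tendsto_sandwich[OF _ _ tendsto_const lim[simplified]])
      have "(\<integral>\<^sup>+y. norm (\<phi> y * q n y - \<phi> y * q' y) \<partial>gauss_seq) \<le>
          (\<integral>\<^sup>+y. ennreal H * norm (q n y - q' y) \<partial>gauss_seq)" for n
        by (intro nn_integral_mono)
           (auto simp: ennreal_mult'[symmetric] H0 right_diff_distrib[symmetric] abs_mult intro!: ennreal_leI mult_right_mono H)
      moreover have "(\<integral>\<^sup>+y. ennreal H * norm (q n y - q' y) \<partial>gauss_seq) =
          ennreal H * (\<integral>\<^sup>+y. norm (q n y - q' y) \<partial>gauss_seq)" for n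
        by (rule nn_integral_cmult) simp
      ultimately show "\<forall>\<^sub>F n in sequentially. (\<integral>\<^sup>+y. norm (\<phi> y * q n y - \<phi> y * q' y) \<partial>gauss_seq) \<le>
          ennreal H * (\<integral>\<^sup>+y. \<bar>q n y - q' y\<bar> \<partial>gauss_seq)" by simp
    qed simp
    from tendsto_L1_int[OF _ _ this] show ?thesis
      using dq dq' by simp
  qed
  have expect_close: "\<bar>(LINT \<omega>|N. \<phi> (\<lambda>i. U i \<omega>)) - (LINT \<omega>|N. smooth s (\<lambda>i. U i \<omega>))\<bar> \<le> K * r * s"
    if s: "s > 0" and N: "prob_space N" and [measurable]: "\<And>i. U i \<in> borel_measurable N"
    for N :: "'u measure" and U :: "nat \<Rightarrow> 'u \<Rightarrow> real" and s
  proof -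
    interpret N: prob_space N by fact
    have [measurable]: "(\<lambda>\<omega> i. U i \<omega>) \<in> borel_measurable N"
      by (rule measurable_coordinatewise_then_product) simp
    have int1: "integrable N (\<lambda>\<omega>. \<phi> (\<lambda>i. U i \<omega>))"
      by (rule N.integrable_const_bound[of _ H]) (auto intro: H)
    have int2: "integrable N (\<lambda>\<omega>. smooth s (\<lambda>i. U i \<omega>))"
      by (rule N.integrable_const_bound[of _ H]) (auto intro: smooth_bound s)
    have "\<bar>LINT \<omega>|N. \<phi> (\<lambda>i. U i \<omega>) - smooth s (\<lambda>i. U i \<omega>)\<bar> \<le> (LINT \<omega>|N. K * r * s)"
      by (rule order_trans[OF integral_abs_bound integral_mono])
         (use int1 int2 smooth_close[OF s] in \<open>auto simp: abs_minus_commute\<close>)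
    then show ?thesis using int1 int2 by (simp add: N.prob_space)
  qed
  show ?thesis
  proof (rule LIMSEQ_I)
    fix e :: real assume "e > 0"
    \<comment> \<open>The smoothing errors for the two laws and the error at fixed \<open>s\<close>
      take \<open>e / 4\<close> each. The \<open>+ 1\<close> keeps the denominator positive when
      \<open>K * r = 0\<close>.\<close>
    define s where "s = e / 4 / (K * r + 1)"
    have Kr: "0 \<le> K * r" using K(2) by simp
    have s: "s > 0" using \<open>e > 0\<close> Kr by (simp add: s_def)
    have "K * r * s \<le> (K * r + 1) * s" using s by simp
    also have "\<dots> = e / 4"
      unfolding s_def by (subst times_divide_eq_right, rule nonzero_mult_div_cancel_left) (use Kr in simp)
    finally have s_le: "K * r * s \<le> e / 4" .
    have "e / 4 > 0" using \<open>e > 0\<close> by simp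
    from LIMSEQ_D[OF smooth_conv[OF s] this] obtain N where
      N: "\<And>n. n \<ge> N \<Longrightarrow> \<bar>(LINT \<omega>|M. smooth s (\<lambda>i. S n i \<omega>)) - (LINT \<omega>|M'. smooth s (\<lambda>i. Z i \<omega>))\<bar> < e / 4"
      by auto
    show "\<exists>N. \<forall>n\<ge>N. norm ((LINT \<omega>|M. \<phi> (\<lambda>i. S n i \<omega>)) - (LINT \<omega>|M'. \<phi> (\<lambda>i. Z i \<omega>))) < e"
    proof (intro exI allI impI)
      fix n assume "n \<ge> N"
      from N[OF this] expect_close[OF s M, of "S n", OF S] expect_close[OF s M', of Z, OF Z] s_le \<open>e > 0\<close>
      show "norm ((LINT \<omega>|M. \<phi> (\<lambda>i. S n i \<omega>)) - (LINT \<omega>|M'. \<phi> (\<lambda>i. Z i \<omega>))) < e"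
        unfolding real_norm_def by linarith
    qed
  qed
qed

section \<open>Linear combinations of independent normal variables\<close>

lemma char_gauss_seq_sum:
  "char (distr gauss_seq borel (\<lambda>y. \<Sum>i<r. a i * y i)) t =
     complex_of_real (exp (- (t\<^sup>2 * (\<Sum>i<r. (a i)\<^sup>2)) / 2))"
proof -
  interpret prob_space gauss_seq by (rule prob_space_gauss_seq)
  have "indep_vars (\<lambda>_. borel) (\<lambda>i y. a i * y i) {..<r}"
    by (rule indep_vars_compose2[OF indep_vars_subset[OF indep_vars_gauss_seq]]) auto
  from char_distr_sum[OF this, of t]
  have "char (distr gauss_seq borel (\<lambda>y. \<Sum>i<r. a i * y i)) t = (\<Prod>i<r. char (distr gauss_seq borel (\<lambda>y. a i * y i)) t)" .
  also have "\<dots> = (\<Prod>i<r. complex_of_real (exp (- (t\<^sup>2 * (a i)\<^sup>2) / 2)))"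
  proof (rule prod.cong[OF refl])
    fix i
    have "char (distr gauss_seq borel (\<lambda>y. a i * y i)) t = char (distr gauss_seq borel (\<lambda>y. y i)) (t * a i)"
      by (simp add: char_def integral_distr ac_simps)
    also have "\<dots> = complex_of_real (exp (- (t * a i)\<^sup>2 / 2))"
      unfolding distr_gauss_seq_coordinate by (simp only: char_std_normal_distribution)
    finally show "char (distr gauss_seq borel (\<lambda>y. a i * y i)) t = complex_of_real (exp (- (t\<^sup>2 * (a i)\<^sup>2) / 2))"
      by (simp add: power_mult_distrib)
  qed
  also have "\<dots> = complex_of_real (exp (\<Sum>i<r. - (t\<^sup>2 * (a i)\<^sup>2) / 2))"
    by (simp only: exp_sum finite_lessThan of_real_prod)
  also have "(\<Sum>i<r. - (t\<^sup>2 * (a i)\<^sup>2) / 2) = - (t\<^sup>2 * (\<Sum>i<r. (a i)\<^sup>2)) / 2"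
    by (simp add: sum_distrib_left sum_divide_distrib sum_negf)
  finally show ?thesis .
qed

lemma
  shows integrable_exp_gauss_seq_sum: "integrable gauss_seq (\<lambda>y. exp (\<Sum>i<r. a i * y i))"
    and integral_exp_gauss_seq_sum:
      "(LINT y|gauss_seq. exp (\<Sum>i<r. a i * y i)) = exp ((\<Sum>i<r. (a i)\<^sup>2) / 2)"
proof -
  \<comment> \<open>Completing the square: tilting the standard normal density by
    \<open>exp (c * x)\<close> moves its mean to \<open>c\<close>.\<close>
  have *: "std_normal_density x * exp (c * x) = exp (c\<^sup>2 / 2) * normal_density c 1 x" for c x :: real
    by (simp add: normal_density_def exp_add[symmetric] field_simps power2_eq_square)
  have int: "integrable std_normal_distribution (\<lambda>x. exp (c * x))" for c :: real
    by (subst integrable_std_normal_iff) (simp_all add: *)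
  have eq: "(LINT x|std_normal_distribution. exp (c * x)) = exp (c\<^sup>2 / 2)" for c :: real
    by (subst integral_std_normal) (simp_all add: *)
  show "integrable gauss_seq (\<lambda>y. exp (\<Sum>i<r. a i * y i))"
    using integrable_gauss_seq_prod[of "{..<r}" "\<lambda>i x. exp (a i * x)"] int by (simp add: exp_sum)
  show "(LINT y|gauss_seq. exp (\<Sum>i<r. a i * y i)) = exp ((\<Sum>i<r. (a i)\<^sup>2) / 2)"
    using integral_gauss_seq_prod[of "{..<r}" "\<lambda>i x. exp (a i * x)"] int
    by (simp add: exp_sum eq sum_divide_distrib)
qed

section \<open>Orthogonalization of bounded functions\<close>

text \<open>Gram-Schmidt in L2 on the centered functions, without normalization. If an earlier
  residual vanishes almost everywhere, its coefficient is a division by zero, hence 0, so linear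
  dependence does no harm.\<close>

fun gram_schmidt :: "'t measure \<Rightarrow> (nat \<Rightarrow> 't \<Rightarrow> real) \<Rightarrow> nat \<Rightarrow> 't \<Rightarrow> real" where
  "gram_schmidt P \<phi> j t = \<phi> j t - (LINT u|P. \<phi> j u) -
     (\<Sum>i<j. (LINT u|P. \<phi> j u * gram_schmidt P \<phi> i u) / (LINT u|P. (gram_schmidt P \<phi> i u)\<^sup>2) * gram_schmidt P \<phi> i t)"

declare gram_schmidt.simps [simp del]

definition bounded_rv :: "'t measure \<Rightarrow> ('t \<Rightarrow> real) set" where
  "bounded_rv P = {f \<in> borel_measurable P. \<exists>B. \<forall>t\<in>space P. \<bar>f t\<bar> \<le> B}"

lemma bounded_rvI: "f \<in> borel_measurable P \<Longrightarrow> (\<And>t. t \<in> space P \<Longrightarrow> \<bar>f t\<bar> \<le> B) \<Longrightarrow> f \<in> bounded_rv P"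
  by (auto simp: bounded_rv_def)

lemma bounded_rvE:
  assumes "f \<in> bounded_rv P"
  obtains B where "f \<in> borel_measurable P" "B \<ge> 0" "\<And>t. t \<in> space P \<Longrightarrow> \<bar>f t\<bar> \<le> B"
proof -
  obtain B where B: "f \<in> borel_measurable P" "\<forall>t\<in>space P. \<bar>f t\<bar> \<le> B"
    using assms by (auto simp: bounded_rv_def)
  show thesis by (rule that[of "\<bar>B\<bar>"]) (use B in force)+
qed

lemma bounded_rv_measurable: "f \<in> bounded_rv P \<Longrightarrow> f \<in> borel_measurable P"
  by (auto simp: bounded_rv_def)

lemma bounded_rv_const [simp]: "(\<lambda>_. c) \<in> bounded_rv P"
  by (rule bounded_rvI[of _ _ "\<bar>c\<bar>"]) auto

lemma bounded_rv_add: assumes "f \<in> bounded_rv P" "g \<in> bounded_rv P" shows "(\<lambda>t. f t + g t) \<in> bounded_rv P"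
proof -
  obtain B where "f \<in> borel_measurable P" "\<And>t. t \<in> space P \<Longrightarrow> \<bar>f t\<bar> \<le> B"
    by (rule bounded_rvE[OF assms(1)]) blast
  moreover obtain C where "g \<in> borel_measurable P" "\<And>t. t \<in> space P \<Longrightarrow> \<bar>g t\<bar> \<le> C"
    by (rule bounded_rvE[OF assms(2)]) blast
  ultimately show ?thesis
    by (intro bounded_rvI[of _ _ "B + C"]) (auto intro: order_trans[OF abs_triangle_ineq add_mono])
qed

lemma bounded_rv_mult: assumes "f \<in> bounded_rv P" "g \<in> bounded_rv P" shows "(\<lambda>t. f t * g t) \<in> bounded_rv P"
proof -
  obtain B where "f \<in> borel_measurable P" "\<And>t. t \<in> space P \<Longrightarrow> \<bar>f t\<bar> \<le> B" "B \<ge> 0"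
    by (rule bounded_rvE[OF assms(1)]) blast
  moreover obtain C where "g \<in> borel_measurable P" "\<And>t. t \<in> space P \<Longrightarrow> \<bar>g t\<bar> \<le> C"
    by (rule bounded_rvE[OF assms(2)]) blast
  ultimately show ?thesis
    by (intro bounded_rvI[of _ _ "B * C"]) (auto simp: abs_mult intro!: mult_mono)
qed

lemma bounded_rv_diff: assumes "f \<in> bounded_rv P" "g \<in> bounded_rv P" shows "(\<lambda>t. f t - g t) \<in> bounded_rv P"
  using bounded_rv_add[OF assms(1) bounded_rv_mult[OF bounded_rv_const[of "-1"] assms(2)]] by simp

lemma bounded_rv_sum: "(\<And>i. i \<in> I \<Longrightarrow> f i \<in> bounded_rv P) \<Longrightarrow> (\<lambda>t. \<Sum>i\<in>I. f i t) \<in> bounded_rv P"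
  by (induction I rule: infinite_finite_induct) (auto intro: bounded_rv_add)

lemma bounded_rv_power2: "f \<in> bounded_rv P \<Longrightarrow> (\<lambda>t. (f t)\<^sup>2) \<in> bounded_rv P"
  unfolding power2_eq_square by (rule bounded_rv_mult)

lemmas bounded_rv_intros = bounded_rv_const bounded_rv_add bounded_rv_mult bounded_rv_diff bounded_rv_sum bounded_rv_power2

lemma (in prob_space) bounded_rv_integrable: "f \<in> bounded_rv M \<Longrightarrow> integrable M f"
  by (elim bounded_rvE, rule integrable_const_bound) (auto intro!: AE_I2)

context prob_space
begin

context
  fixes \<phi> :: "nat \<Rightarrow> 'a \<Rightarrow> real"
  assumes \<phi>: "\<And>j. \<phi> j \<in> bounded_rv M"
begin

abbreviation (input) "gs \<equiv> gram_schmidt M \<phi>"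

lemma gram_schmidt_bounded: "gs j \<in> bounded_rv M"
proof (induction j rule: less_induct)
  case (less j)
  have *: "gs j = (\<lambda>t. \<phi> j t - (LINT u|M. \<phi> j u) -
     (\<Sum>i<j. (LINT u|M. \<phi> j u * gs i u) / (LINT u|M. (gs i u)\<^sup>2) * gs i t))"
    by (rule ext) (rule gram_schmidt.simps)
  have "(\<lambda>t. c * gs i t) \<in> bounded_rv M" if "i \<in> {..<j}" for i c
    using that by (intro bounded_rv_mult bounded_rv_const less.IH) simp
  then show ?case unfolding * by (intro bounded_rv_diff bounded_rv_sum bounded_rv_const \<phi>)
qed

lemma gram_schmidt_integrable: "integrable M (gs j)" "integrable M (\<lambda>t. gs i t * gs j t)"
    "integrable M (\<lambda>t. (gs j t)\<^sup>2)" "integrable M (\<lambda>t. \<phi> i t * gs j t)" "integrable M (\<phi> j)"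
  by (intro bounded_rv_integrable bounded_rv_intros gram_schmidt_bounded \<phi>)+

lemma gram_schmidt_mean: "(LINT t|M. gs j t) = 0"
proof (induction j rule: less_induct)
  case (less j)
  have "(LINT t|M. gs j t) = (LINT t|M. \<phi> j t - (LINT u|M. \<phi> j u)) -
     (LINT t|M. (\<Sum>i<j. (LINT u|M. \<phi> j u * gs i u) / (LINT u|M. (gs i u)\<^sup>2) * gs i t))"
    by (subst gram_schmidt.simps, rule Bochner_Integration.integral_diff)
       (intro bounded_rv_integrable bounded_rv_intros gram_schmidt_bounded \<phi>)+
  also have "(LINT t|M. \<phi> j t - (LINT u|M. \<phi> j u)) = 0"
    by (subst Bochner_Integration.integral_diff) (auto simp: gram_schmidt_integrable prob_space)
  also have "(LINT t|M. (\<Sum>i<j. (LINT u|M. \<phi> j u * gs i u) / (LINT u|M. (gs i u)\<^sup>2) * gs i t)) =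
      (\<Sum>i<j. (LINT u|M. \<phi> j u * gs i u) / (LINT u|M. (gs i u)\<^sup>2) * (LINT t|M. gs i t))"
    by (subst Bochner_Integration.integral_sum) (auto simp: gram_schmidt_integrable)
  also have "\<dots> = 0" using less by simp
  finally show ?case by simp
qed

text \<open>A residual with zero second moment vanishes almost everywhere. This settles the
  degenerate case in which the coefficient is a division by zero.\<close>

lemma integral_mult_gs_eq_0:
  assumes "(LINT t|M. (gs l t)\<^sup>2) = 0" and f: "f \<in> bounded_rv M"
  shows "(LINT t|M. f t * gs l t) = 0"
proof -
  have "AE t in M. (gs l t)\<^sup>2 = 0"
    using assms(1) integral_nonneg_eq_0_iff_AE[OF gram_schmidt_integrable(3)] by simp
  then have "AE t in M. f t * gs l t = 0" by eventually_elim simp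
  then show ?thesis
    by (rule integral_eq_zero_AE)
qed

lemma gram_schmidt_orthogonal_less: "l < j \<Longrightarrow> (LINT t|M. gs j t * gs l t) = 0"
proof (induction j arbitrary: l rule: less_induct)
  case (less j)
  let ?c = "\<lambda>i. (LINT u|M. \<phi> j u * gs i u) / (LINT u|M. (gs i u)\<^sup>2)"
  have "gs j t * gs l t = \<phi> j t * gs l t - (LINT u|M. \<phi> j u) * gs l t - (\<Sum>i<j. ?c i * (gs i t * gs l t))" for t
    by (subst gram_schmidt.simps) (simp add: algebra_simps sum_distrib_left)
  then have "(LINT t|M. gs j t * gs l t) =
     (LINT t|M. \<phi> j t * gs l t) - (LINT u|M. \<phi> j u) * (LINT t|M. gs l t) - (\<Sum>i<j. ?c i * (LINT t|M. gs i t * gs l t))"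
    by (simp add: gram_schmidt_integrable)
  \<comment> \<open>By the induction hypothesis only the term with \<open>i = l\<close>
    survives.\<close>
  also have "(\<Sum>i<j. ?c i * (LINT t|M. gs i t * gs l t)) = (\<Sum>i<j. if i = l then ?c l * (LINT t|M. (gs l t)\<^sup>2) else 0)"
  proof (rule sum.cong[OF refl])
    fix i assume i: "i \<in> {..<j}"
    show "?c i * (LINT t|M. gs i t * gs l t) = (if i = l then ?c l * (LINT t|M. (gs l t)\<^sup>2) else 0)"
      using less.IH[of i l] less.IH[of l i] less.prems i
      by (cases i l rule: linorder_cases) (auto simp: power2_eq_square mult.commute)
  qed
  also have "\<dots> = ?c l * (LINT t|M. (gs l t)\<^sup>2)" using less.prems by (simp add: sum.delta)
  also have "\<dots> = (LINT t|M. \<phi> j t * gs l t)"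
    using integral_mult_gs_eq_0[of l "\<phi> j"] \<phi> by (cases "(LINT t|M. (gs l t)\<^sup>2) = 0") auto
  finally show ?case by (simp add: gram_schmidt_mean)
qed

lemma gram_schmidt_orthogonal: "i \<noteq> j \<Longrightarrow> (LINT t|M. gs i t * gs j t) = 0"
  using gram_schmidt_orthogonal_less[of i j] gram_schmidt_orthogonal_less[of j i]
  by (cases i j rule: linorder_cases) (auto simp: mult.commute)

end

text \<open>The matrix \<open>a\<close> is lower triangular with unit diagonal, so the same
  coefficients expand \<open>\<phi> j\<close> for every length \<open>r > j\<close>. Hence finitely
  many functions can share one length.\<close>

lemma orthogonal_decomposition:
  assumes \<phi>: "\<And>j::nat. \<phi> j \<in> bounded_rv M"
  obtains e a where "\<And>i. e i \<in> bounded_rv M" "\<And>i. (LINT t|M. e i t) = 0"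
    "\<And>i j. i \<noteq> j \<Longrightarrow> (LINT t|M. e i t * e j t) = 0"
    "\<And>j r t. j < r \<Longrightarrow> \<phi> j t - (LINT u|M. \<phi> j u) = (\<Sum>i<r. a j i * e i t)"
    "\<And>j i :: nat. j < i \<Longrightarrow> a j i = (0 :: real)"
proof -
  let ?e = "gram_schmidt M \<phi>"
  define a where "a j i = (if i < j then (LINT u|M. \<phi> j u * ?e i u) / (LINT u|M. (?e i u)\<^sup>2)
    else if i = j then 1 else 0)" for j i
  have decomp: "\<phi> j t - (LINT u|M. \<phi> j u) = (\<Sum>i<r. a j i * ?e i t)" if "j < r" for j r t
  proof -
    have "(\<Sum>i<r. a j i * ?e i t) = (\<Sum>i<Suc j. a j i * ?e i t)"
      by (rule sum.mono_neutral_right) (use that in \<open>auto simp: a_def\<close>)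
    also have "\<dots> = (\<Sum>i<j. (LINT u|M. \<phi> j u * ?e i u) / (LINT u|M. (?e i u)\<^sup>2) * ?e i t) + ?e j t"
      by (simp add: a_def)
    also have "\<dots> = \<phi> j t - (LINT u|M. \<phi> j u)"
      by (subst (3) gram_schmidt.simps) simp
    finally show ?thesis by simp
  qed
  show thesis
    by (rule that[of ?e a])
       (simp_all add: gram_schmidt_bounded gram_schmidt_mean gram_schmidt_orthogonal \<phi> decomp, simp add: a_def)
qed

lemma integral_orthogonal_sum_square:
  assumes e: "\<And>i. e i \<in> bounded_rv M" and orth: "\<And>i j. i \<noteq> j \<Longrightarrow> (LINT t|M. e i t * e j t) = 0"
  shows "(LINT t|M. (\<Sum>i<r::nat. b i * e i t)\<^sup>2) = (\<Sum>i<r. (b i)\<^sup>2 * (LINT t|M. (e i t)\<^sup>2))"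
proof (induction r)
  case (Suc r)
  have [simp]: "integrable M (e i)" "integrable M (\<lambda>t. e i t * e j t)" "integrable M (\<lambda>t. (e i t)\<^sup>2)"
    "integrable M (\<lambda>t. (\<Sum>i<r. b i * e i t)\<^sup>2)" for i j
    by (intro bounded_rv_integrable bounded_rv_intros e)+
  have "(\<Sum>i<Suc r. b i * e i t)\<^sup>2 =
     (\<Sum>i<r. b i * e i t)\<^sup>2 + (\<Sum>i<r. 2 * b i * b r * (e i t * e r t)) + (b r)\<^sup>2 * (e r t)\<^sup>2" for t
    by (simp add: power2_sum power_mult_distrib sum_distrib_left sum_distrib_right ac_simps)
  then have "(LINT t|M. (\<Sum>i<Suc r. b i * e i t)\<^sup>2) =
     (LINT t|M. (\<Sum>i<r. b i * e i t)\<^sup>2) + (\<Sum>i<r. 2 * b i * b r * (LINT t|M. e i t * e r t)) + (b r)\<^sup>2 * (LINT t|M. (e r t)\<^sup>2)"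
    by simp
  also have "(\<Sum>i<r. 2 * b i * b r * (LINT t|M. e i t * e r t)) = 0"
    by (intro sum.neutral ballI) (simp add: orth)
  finally show ?case using Suc by simp
qed simp

end

section \<open>Maximal inequalities\<close>

text \<open>The passage from second to exponential moments: a centered variable \<open>y\<close>
  with values in [-1, 1] gets expectation of \<open>exp y\<close> at most 1 plus its second
  moment.\<close>

lemma exp_le_quadratic:
  fixes y :: real
  assumes "\<bar>y\<bar> \<le> 1"
  shows "exp y \<le> 1 + y + y\<^sup>2"
proof (cases "y \<ge> 0")
  case True
  then show ?thesis using exp_bound[of y] assms by simp
next
  case False
  \<comment> \<open>For negative \<open>y\<close> the claim is multiplied by
    \<open>exp (- y)\<close>, which is at least \<open>1 - y\<close>; the product of
    \<open>1 - y\<close> with the quadratic is 1 - y^3, hence at least 1.\<close>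
  have "1 - y \<le> exp (- y)" using exp_ge_add_one_self[of "- y"] by simp
  then have "(1 + y + y\<^sup>2) * exp (- y) \<ge> (1 + y + y\<^sup>2) * (1 - y)"
    using assms False by (intro mult_left_mono) (auto simp: abs_if)
  also have "(1 + y + y\<^sup>2) * (1 - y) = 1 + (- y) ^ 3" by (simp add: algebra_simps power2_eq_square power3_eq_cube)
  finally have "1 \<le> (1 + y + y\<^sup>2) * exp (- y)" using zero_le_power[of "- y" 3] False by linarith
  then show ?thesis by (simp add: exp_minus field_simps)
qed

text \<open>An integrable majorant of a finite maximum, by \<open>x \<le> L + exp (x - L)\<close> for \<open>L = ln (card D)\<close>.\<close>

definition soft_max :: "real \<Rightarrow> 'i set \<Rightarrow> ('i \<Rightarrow> real) \<Rightarrow> real" where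
  "soft_max s D z = s * (ln (card D) + (\<Sum>d\<in>D. exp (\<bar>z d\<bar> / s)) / card D)"

lemma abs_le_soft_max:
  assumes "finite D" "d \<in> D" "s > 0"
  shows "\<bar>z d\<bar> \<le> soft_max s D z"
proof -
  have c: "real (card D) > 0" using assms(1,2) by (auto simp: card_gt_0_iff)
  have "\<bar>z d\<bar> / s - ln (card D) \<le> exp (\<bar>z d\<bar> / s - ln (card D))"
    using exp_ge_add_one_self[of "\<bar>z d\<bar> / s - ln (card D)"] by linarith
  also have "\<dots> = exp (\<bar>z d\<bar> / s) / card D" using c by (simp add: exp_diff)
  also have "\<dots> \<le> (\<Sum>d\<in>D. exp (\<bar>z d\<bar> / s)) / card D"
    using assms by (intro divide_right_mono member_le_sum) auto
  finally have "\<bar>z d\<bar> / s \<le> ln (card D) + (\<Sum>d\<in>D. exp (\<bar>z d\<bar> / s)) / card D" by simp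
  then show ?thesis using assms(3) by (simp add: soft_max_def field_simps)
qed

lemma soft_max_nonneg: "finite D \<Longrightarrow> D \<noteq> {} \<Longrightarrow> s > 0 \<Longrightarrow> 0 \<le> soft_max s D z"
  using abs_le_soft_max[of D _ s z] by (metis abs_ge_zero ex_in_conv order_trans)

text \<open>Here the entropy enters: a maximum over \<open>D\<close> costs only the logarithm of its
  cardinality once the exponential moments are bounded.\<close>

lemma
  assumes "finite D" "D \<noteq> {}" "s > 0"
    and int: "\<And>d. d \<in> D \<Longrightarrow> integrable N (\<lambda>\<omega>. exp (\<bar>z \<omega> d\<bar> / s))"
    and le: "\<And>d. d \<in> D \<Longrightarrow> (LINT \<omega>|N. exp (\<bar>z \<omega> d\<bar> / s)) \<le> b"
    and N: "prob_space N"
  shows integrable_soft_max: "integrable N (\<lambda>\<omega>. soft_max s D (z \<omega>))"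
    and integral_soft_max_le: "(LINT \<omega>|N. soft_max s D (z \<omega>)) \<le> s * (ln (card D) + b)"
proof -
  interpret prob_space N by fact
  show "integrable N (\<lambda>\<omega>. soft_max s D (z \<omega>))"
    unfolding soft_max_def
    by (intro integrable_mult_right Bochner_Integration.integrable_add integrable_divide
        Bochner_Integration.integrable_sum int) auto
  have "(LINT \<omega>|N. soft_max s D (z \<omega>)) = s * (ln (card D) + (\<Sum>d\<in>D. LINT \<omega>|N. exp (\<bar>z \<omega> d\<bar> / s)) / card D)"
    unfolding soft_max_def using int
    by (simp add: Bochner_Integration.integral_add Bochner_Integration.integral_sum prob_space)
  also have "(\<Sum>d\<in>D. LINT \<omega>|N. exp (\<bar>z \<omega> d\<bar> / s)) / card D \<le> b"
    using sum_mono[OF le] assms(1,2) by (simp add: pos_divide_le_eq card_gt_0_iff mult.commute)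
  finally show "(LINT \<omega>|N. soft_max s D (z \<omega>)) \<le> s * (ln (card D) + b)" using assms(3) by simp
qed

lemma exp_abs_le: "exp \<bar>u :: real\<bar> \<le> exp u + exp (- u)"
  by (cases "u \<ge> 0") auto

text \<open>Gaussian counterpart of the exponential bound for the empirical process. Each signed
  exponential moment is at most exp (1/2); rounding up to \<open>exp 1\<close> lets both processes
  share the constant \<open>2 * exp 1\<close>.\<close>

lemma
  assumes s: "s > 0" and b: "(\<Sum>i<r. (b i)\<^sup>2) \<le> s\<^sup>2"
  shows integrable_exp_abs_gauss_seq: "integrable gauss_seq (\<lambda>y. exp (\<bar>\<Sum>i<r. b i * y i\<bar> / s))"
    and integral_exp_abs_gauss_seq_le: "(LINT y|gauss_seq. exp (\<bar>\<Sum>i<r. b i * y i\<bar> / s)) \<le> 2 * exp 1"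
proof -
  have eq: "exp ((\<Sum>i<r. b i * y i) / s) = exp (\<Sum>i<r. (b i / s) * y i)"
    "exp (- ((\<Sum>i<r. b i * y i) / s)) = exp (\<Sum>i<r. (- b i / s) * y i)" for y
    by (simp_all add: sum_divide_distrib sum_negf)
  have le: "exp (\<bar>\<Sum>i<r. b i * y i\<bar> / s) \<le> exp (\<Sum>i<r. (b i / s) * y i) + exp (\<Sum>i<r. (- b i / s) * y i)" for y
    using exp_abs_le[of "(\<Sum>i<r. b i * y i) / s"] s unfolding eq by (simp add: abs_divide)
  have int: "integrable gauss_seq (\<lambda>y. exp (\<Sum>i<r. (b i / s) * y i) + exp (\<Sum>i<r. (- b i / s) * y i))"
    by (intro Bochner_Integration.integrable_add integrable_exp_gauss_seq_sum)
  show *: "integrable gauss_seq (\<lambda>y. exp (\<bar>\<Sum>i<r. b i * y i\<bar> / s))"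
  proof (rule Bochner_Integration.integrable_bound[OF int])
    show "AE y in gauss_seq. norm (exp (\<bar>\<Sum>i<r. b i * y i\<bar> / s)) \<le>
        norm (exp (\<Sum>i<r. (b i / s) * y i) + exp (\<Sum>i<r. (- b i / s) * y i))"
      by (intro AE_I2) (use le in \<open>simp add: abs_of_pos add_pos_pos\<close>)
  qed simp
  have sq: "(\<Sum>i<r. (b i / s)\<^sup>2) / 2 \<le> 1" "(\<Sum>i<r. (- b i / s)\<^sup>2) / 2 \<le> 1"
    using order_trans[OF b, of "s\<^sup>2 * 2"] s
    by (simp_all add: power_divide sum_divide_distrib[symmetric] pos_divide_le_eq)
  have "(LINT y|gauss_seq. exp (\<bar>\<Sum>i<r. b i * y i\<bar> / s)) \<le>
     (LINT y|gauss_seq. exp (\<Sum>i<r. (b i / s) * y i) + exp (\<Sum>i<r. (- b i / s) * y i))"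
    by (rule integral_mono[OF * int le])
  also have "\<dots> = exp ((\<Sum>i<r. (b i / s)\<^sup>2) / 2) + exp ((\<Sum>i<r. (- b i / s)\<^sup>2) / 2)"
    by (subst Bochner_Integration.integral_add)
       (simp_all only: integrable_exp_gauss_seq_sum integral_exp_gauss_seq_sum)
  also have "\<dots> \<le> exp 1 + exp 1" by (intro add_mono) (simp_all only: exp_le_cancel_iff sq)
  also have "\<dots> = 2 * exp (1 :: real)" by simp
  finally show "(LINT y|gauss_seq. exp (\<bar>\<Sum>i<r. b i * y i\<bar> / s)) \<le> 2 * exp 1" .
qed

locale iid_sample = \<Omega>: prob_space \<Omega> + P: prob_space P
  for \<Omega> :: "'w measure" and P :: "'t measure" and \<Theta> :: "nat \<Rightarrow> 'w \<Rightarrow> 't" +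
  assumes indep: "\<Omega>.indep_vars (\<lambda>_. P) \<Theta> UNIV"
    and law: "\<And>m. distr \<Omega> P (\<Theta> m) = P"
begin

abbreviation emp :: "nat \<Rightarrow> 'w \<Rightarrow> ('t \<Rightarrow> real) \<Rightarrow> real" where
  "emp M \<omega> \<equiv> empirical_process P (\<lambda>m. \<Theta> m \<omega>) M"

lemma \<Theta>_measurable [measurable]: "\<Theta> m \<in> measurable \<Omega> P"
  using indep by (auto simp: \<Omega>.indep_vars_def)

lemma \<Theta>_space: "\<omega> \<in> space \<Omega> \<Longrightarrow> \<Theta> m \<omega> \<in> space P"
  by (rule measurable_space[OF \<Theta>_measurable])

lemma integral_sample:
  fixes f :: "'t \<Rightarrow> 'b :: {banach, second_countable_topology}"
  assumes "f \<in> borel_measurable P"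
  shows "(LINT \<omega>|\<Omega>. f (\<Theta> m \<omega>)) = (LINT t|P. f t)"
  using integral_distr[OF \<Theta>_measurable, of f m] assms by (simp add: law)

lemma emp_measurable [measurable]:
  assumes [measurable]: "g \<in> borel_measurable P"
  shows "(\<lambda>\<omega>. emp M \<omega> g) \<in> borel_measurable \<Omega>"
  unfolding empirical_process_def by measurable

lemma emp_eq_sum:
  assumes "M > 0"
  shows "emp M \<omega> g = (\<Sum>m=1..M. (g (\<Theta> m \<omega>) - (LINT t|P. g t)) / sqrt M)"
proof -
  have "sqrt M * sqrt M = M" by simp
  then show ?thesis using assms
    by (simp add: empirical_process_def sum_divide_distrib[symmetric] sum_subtractf field_simps)
qed

text \<open>A Bernstein-type bound. The centered summand, divided by \<open>sqrt M * s\<close>,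
  stays in [-1, 1] and has second moment at most \<open>1 / M\<close>, so its exponential moment is
  at most \<open>1 + 1 / M \<le> exp (1 / M)\<close>. Independence multiplies \<open>M\<close> such
  factors to at most \<open>exp 1\<close>.\<close>

lemma
  assumes h: "h \<in> borel_measurable P" and b: "\<And>t. t \<in> space P \<Longrightarrow> \<bar>h t\<bar> \<le> b"
    and var: "(LINT t|P. (h t)\<^sup>2) \<le> s\<^sup>2" and s: "s > 0" and bM: "2 * b \<le> sqrt M * s" and M: "M > 0"
  shows integrable_exp_emp: "integrable \<Omega> (\<lambda>\<omega>. exp (\<bar>emp M \<omega> h\<bar> / s))"
    and integral_exp_emp_le: "(LINT \<omega>|\<Omega>. exp (\<bar>emp M \<omega> h\<bar> / s)) \<le> 2 * exp 1"
proof -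
  have h_int: "integrable P h" "integrable P (\<lambda>t. (h t)\<^sup>2)"
    using P.bounded_rv_integrable bounded_rvI[OF h b] by (auto intro: bounded_rv_power2)
  have mean: "\<bar>LINT t|P. h t\<bar> \<le> b"
  proof -
    have "\<bar>LINT t|P. h t\<bar> \<le> (LINT t|P. \<bar>h t\<bar>)" by (rule integral_abs_bound)
    also have "\<dots> \<le> (LINT t|P. b)" using b h_int by (intro integral_mono) auto
    finally show ?thesis by (simp add: P.prob_space)
  qed
  have sqM: "sqrt M > 0" using M by simp
  have exp1: "integrable \<Omega> (\<lambda>\<omega>. exp (c * emp M \<omega> h)) \<and> (LINT \<omega>|\<Omega>. exp (c * emp M \<omega> h)) \<le> exp 1"
    if c: "\<bar>c\<bar> = 1 / s" for c
  proof -
    define y where "y t = c * ((h t - (LINT t|P. h t)) / sqrt M)" for t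
    have [measurable]: "y \<in> borel_measurable P" unfolding y_def using h by measurable
    have y1: "\<bar>y t\<bar> \<le> 1" if "t \<in> space P" for t
    proof -
      \<comment> \<open>Centering can double the bound \<open>b\<close>, whence the factor 2 in the
        hypothesis on \<open>sqrt M * s\<close>.\<close>
      have "\<bar>h t - (LINT t|P. h t)\<bar> \<le> sqrt M * s" using b[OF that] mean bM by linarith
      then show ?thesis unfolding y_def abs_mult abs_divide c using s sqM by (simp add: field_simps)
    qed
    have y_bd: "y \<in> bounded_rv P" by (rule bounded_rvI[OF _ y1]) auto
    have int_exp: "integrable P (\<lambda>t. exp (y t))"
      by (rule P.integrable_const_bound[of _ "exp 1"]) (use y1 in \<open>auto intro!: AE_I2 simp: abs_le_iff\<close>)
    have y_mean: "(LINT t|P. y t) = 0"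
      unfolding y_def using h_int by (simp add: P.prob_space)
    have y_sq: "(LINT t|P. (y t)\<^sup>2) \<le> 1 / M"
    proof -
      have "(LINT t|P. (y t)\<^sup>2) = c\<^sup>2 / M * (LINT t|P. (h t - (LINT t|P. h t))\<^sup>2)"
        unfolding y_def by (simp add: power_mult_distrib power_divide)
      also have "(LINT t|P. (h t - (LINT t|P. h t))\<^sup>2) = (LINT t|P. (h t)\<^sup>2) - (LINT t|P. h t)\<^sup>2"
        using h_int by (intro P.variance_eq) auto
      also have "c\<^sup>2 / M * ((LINT t|P. (h t)\<^sup>2) - (LINT t|P. h t)\<^sup>2) \<le> c\<^sup>2 / M * s\<^sup>2"
        using var by (intro mult_left_mono) (auto intro: order_trans[of _ "(LINT t|P. (h t)\<^sup>2)"])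
      also have "c\<^sup>2 = 1 / s\<^sup>2" using c by (metis power2_abs power_one_over)
      finally show ?thesis using s by simp
    qed
    have "(LINT t|P. exp (y t)) \<le> (LINT t|P. 1 + y t + (y t)\<^sup>2)"
      by (rule integral_mono[OF int_exp])
         (auto intro!: P.bounded_rv_integrable bounded_rv_intros y_bd exp_le_quadratic y1)
    also have "\<dots> = 1 + (LINT t|P. (y t)\<^sup>2)"
      using P.bounded_rv_integrable[OF y_bd] P.bounded_rv_integrable[OF bounded_rv_power2[OF y_bd]]
      by (simp add: y_mean P.prob_space)
    also have "\<dots> \<le> exp (1 / M)" using y_sq exp_ge_add_one_self[of "1 / M"] by linarith
    finally have one: "(LINT t|P. exp (y t)) \<le> exp (1 / M)" .
    have eq: "exp (c * emp M \<omega> h) = (\<Prod>m\<in>{1..M}. exp (y (\<Theta> m \<omega>)))" for \<omega>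
      unfolding emp_eq_sum[OF M] sum_distrib_left by (simp add: exp_sum y_def)
    have ind: "\<Omega>.indep_vars (\<lambda>_. borel) (\<lambda>m \<omega>. exp (y (\<Theta> m \<omega>))) {1..M}"
      by (rule \<Omega>.indep_vars_compose2[OF \<Omega>.indep_vars_subset[OF indep]]) auto
    have int: "integrable \<Omega> (\<lambda>\<omega>. exp (y (\<Theta> m \<omega>)))" for m
      using int_exp integrable_distr_eq[OF \<Theta>_measurable, of "\<lambda>t. exp (y t)" m] by (simp add: law)
    have "(LINT \<omega>|\<Omega>. exp (c * emp M \<omega> h)) = (\<Prod>m\<in>{1..M}. LINT \<omega>|\<Omega>. exp (y (\<Theta> m \<omega>)))"
      unfolding eq by (rule \<Omega>.indep_vars_lebesgue_integral[OF _ ind int]) simp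
    also have "\<dots> = (LINT t|P. exp (y t)) ^ M"
      using integral_sample[of "\<lambda>t. exp (y t)"] by simp
    also have "\<dots> \<le> exp (1 / M) ^ M" by (intro power_mono one integral_nonneg) simp
    also have "\<dots> = exp 1" using M by (simp add: exp_of_nat_mult[symmetric])
    finally show ?thesis
      unfolding eq using \<Omega>.indep_vars_integrable[OF _ ind int] by simp
  qed
  have le: "exp (\<bar>emp M \<omega> h\<bar> / s) \<le> exp ((1 / s) * emp M \<omega> h) + exp ((- 1 / s) * emp M \<omega> h)" for \<omega>
    using exp_abs_le[of "emp M \<omega> h / s"] s by (simp add: abs_divide)
  have e: "integrable \<Omega> (\<lambda>\<omega>. exp ((1 / s) * emp M \<omega> h))" "(LINT \<omega>|\<Omega>. exp ((1 / s) * emp M \<omega> h)) \<le> exp 1"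
    "integrable \<Omega> (\<lambda>\<omega>. exp ((- 1 / s) * emp M \<omega> h))" "(LINT \<omega>|\<Omega>. exp ((- 1 / s) * emp M \<omega> h)) \<le> exp 1"
    using exp1[of "1 / s"] exp1[of "- 1 / s"] s by (simp_all only: abs_divide abs_one abs_minus abs_of_pos)
  have int: "integrable \<Omega> (\<lambda>\<omega>. exp ((1 / s) * emp M \<omega> h) + exp ((- 1 / s) * emp M \<omega> h))"
    by (rule Bochner_Integration.integrable_add[OF e(1,3)])
  show *: "integrable \<Omega> (\<lambda>\<omega>. exp (\<bar>emp M \<omega> h\<bar> / s))"
  proof (rule Bochner_Integration.integrable_bound[OF int])
    show "(\<lambda>\<omega>. exp (\<bar>emp M \<omega> h\<bar> / s)) \<in> borel_measurable \<Omega>" using h by measurable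
    show "AE \<omega> in \<Omega>. norm (exp (\<bar>emp M \<omega> h\<bar> / s)) \<le>
        norm (exp ((1 / s) * emp M \<omega> h) + exp ((- 1 / s) * emp M \<omega> h))"
      by (intro AE_I2) (use le in \<open>simp add: abs_of_pos add_pos_pos\<close>)
  qed
  have "(LINT \<omega>|\<Omega>. exp (\<bar>emp M \<omega> h\<bar> / s)) \<le> (LINT \<omega>|\<Omega>. exp ((1 / s) * emp M \<omega> h) + exp ((- 1 / s) * emp M \<omega> h))"
    by (rule integral_mono[OF * int le])
  also have "\<dots> \<le> 2 * exp 1"
    using e(2,4) unfolding Bochner_Integration.integral_add[OF e(1,3)] by linarith
  finally show "(LINT \<omega>|\<Omega>. exp (\<bar>emp M \<omega> h\<bar> / s)) \<le> 2 * exp 1" .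
qed

end

section \<open>The space of bounded functions\<close>

declare mspace_funspace [simp del] mdist_funspace [simp del]

lemma mspace_linf_iff: "z \<in> mspace (linf F) \<longleftrightarrow> z \<in> extensional F \<and> (\<exists>b. \<forall>i\<in>F. \<bar>z i\<bar> \<le> b)"
proof -
  have "Met_TC.mbounded (z ` F) \<longleftrightarrow> (\<exists>b. \<forall>i\<in>F. \<bar>z i\<bar> \<le> b)"
    by (simp add: bounded_iff)
  then show ?thesis by (simp add: mspace_funspace Met_TC.fspace_def)
qed

lemma mdist_linf_le:
  assumes "z \<in> mspace (linf F)" "w \<in> mspace (linf F)" "F \<noteq> {}"
  shows "mdist (linf F) z w \<le> a \<longleftrightarrow> (\<forall>i\<in>F. \<bar>z i - w i\<bar> \<le> a)"
  using funspace_mdist_le[OF assms] by (simp add: dist_real_def)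

lemma abs_diff_le_mdist_linf:
  assumes "z \<in> mspace (linf F)" "w \<in> mspace (linf F)" "i \<in> F"
  shows "\<bar>z i - w i\<bar> \<le> mdist (linf F) z w"
  using mdist_linf_le[OF assms(1,2), of "mdist (linf F) z w"] assms(3) by auto

lemma sets_borel_of_metric:
  "space (borel_of_metric m) = mspace m"
  "openin (mtopology_of m) U \<Longrightarrow> U \<in> sets (borel_of_metric m)"
  "closedin (mtopology_of m) U \<Longrightarrow> U \<in> sets (borel_of_metric m)"
proof -
  have sub: "{U. openin (mtopology_of m) U} \<subseteq> Pow (mspace m)"
    using openin_subset[of "mtopology_of m"] by auto
  show sp: "space (borel_of_metric m) = mspace m"
    using sub by (simp add: borel_of_metric_def space_measure_of)
  show op: "U \<in> sets (borel_of_metric m)" if "openin (mtopology_of m) U" for U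
    using sub that by (auto simp: borel_of_metric_def sets_measure_of)
  show "U \<in> sets (borel_of_metric m)" if "closedin (mtopology_of m) U" for U
    using that sets.compl_sets[OF op, of "mspace m - U"] unfolding sp
    by (auto simp: closedin_def double_diff)
qed

lemma measurable_borel_of_metricI:
  assumes "\<And>\<omega>. \<omega> \<in> space M \<Longrightarrow> f \<omega> \<in> mspace m"
    and "\<And>U. openin (mtopology_of m) U \<Longrightarrow> f -` U \<inter> space M \<in> sets M"
  shows "f \<in> measurable M (borel_of_metric m)"
  unfolding borel_of_metric_def
  by (rule measurable_measure_of) (use assms openin_subset[of "mtopology_of m"] in auto)

lemma continuous_map_borel_of_metric:
  assumes "continuous_map (mtopology_of m) euclideanreal h"
  shows "h \<in> borel_measurable (borel_of_metric m)"
proof (rule borel_measurableI)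
  fix S :: "real set" assume "open S"
  then have "openin (mtopology_of m) {x \<in> topspace (mtopology_of m). h x \<in> S}"
    using assms by (intro openin_continuous_map_preimage[OF assms]) auto
  moreover have "h -` S \<inter> space (borel_of_metric m) = {x \<in> topspace (mtopology_of m). h x \<in> S}"
    by (auto simp: sets_borel_of_metric)
  ultimately show "h -` S \<inter> space (borel_of_metric m) \<in> sets (borel_of_metric m)"
    by (simp add: sets_borel_of_metric)
qed

lemma continuous_map_realI:
  assumes "\<And>x y. x \<in> mspace m \<Longrightarrow> y \<in> mspace m \<Longrightarrow> \<bar>h x - h y\<bar> \<le> K * mdist m x y"
  shows "continuous_map (mtopology_of m) euclideanreal h"
proof -
  have "Lipschitz_continuous_map m euclidean_metric h"
    unfolding Lipschitz_continuous_map_def using assms by (auto simp: dist_real_def)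
  then have "continuous_map (mtopology_of m) (mtopology_of euclidean_metric) h"
    by (rule Lipschitz_continuous_imp_continuous_map)
  then show ?thesis by simp
qed

lemma continuous_map_coordinate_linf:
  assumes "i \<in> F"
  shows "continuous_map (mtopology_of (linf F)) euclideanreal (\<lambda>z. z i)"
  by (rule continuous_map_realI[where K = 1]) (use abs_diff_le_mdist_linf[OF _ _ assms] in simp)

section \<open>Gaussian laws from characteristic functions\<close>

text \<open>Levy uniqueness identifies the law, and the moments are then those of the normal
  density. For \<open>v = 0\<close> there is no density: the law is the point mass at 0.\<close>

lemma
  fixes Z :: "'w \<Rightarrow> real"
  assumes N: "prob_space N" and Z [measurable]: "Z \<in> borel_measurable N"
    and char: "\<And>t. char (distr N borel Z) t = complex_of_real (exp (- (t\<^sup>2 * v) / 2))" and v: "0 \<le> v"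
  shows normal_rv_of_char: "normal_rv N Z"
    and integrable_of_normal_char: "integrable N Z" "integrable N (\<lambda>\<omega>. (Z \<omega>)\<^sup>2)"
    and mean_of_normal_char: "(LINT \<omega>|N. Z \<omega>) = 0"
    and variance_of_normal_char: "(LINT \<omega>|N. (Z \<omega>)\<^sup>2) = v"
proof -
  interpret prob_space N by fact
  have *: "normal_rv N Z \<and> integrable N Z \<and> integrable N (\<lambda>\<omega>. (Z \<omega>)\<^sup>2) \<and>
     (LINT \<omega>|N. Z \<omega>) = 0 \<and> (LINT \<omega>|N. (Z \<omega>)\<^sup>2) = v"
  proof (cases "v = 0")
    case True
    have eq: "distr N borel Z = return borel 0"
    proof (rule Levy_uniqueness)
      show "real_distribution (distr N borel Z)" by (rule real_distribution_distr) simp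
      show "real_distribution (return borel 0)"
        by (intro real_distribution.intro real_distribution_axioms.intro prob_space_return) auto
      show "char (distr N borel Z) = char (return borel 0)"
      proof
        fix t :: real
        have "char (return borel 0) t = 1" unfolding char_def by (subst integral_return) auto
        then show "char (distr N borel Z) t = char (return borel 0) t"
          using char[of t] True by simp
      qed
    qed
    have "AE z in distr N borel Z. z = 0" unfolding eq by (subst AE_return) auto
    then have ae: "AE \<omega> in N. Z \<omega> = 0" by (subst (asm) AE_distr_iff) auto
    have "integrable N Z" "integrable N (\<lambda>\<omega>. (Z \<omega>)\<^sup>2)"
      by (rule integrable_cong_AE_imp[of _ "\<lambda>_. 0"], use ae in auto)+
    moreover have "(LINT \<omega>|N. Z \<omega>) = 0" "(LINT \<omega>|N. (Z \<omega>)\<^sup>2) = 0"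
      by (rule integral_eq_zero_AE, use ae in auto)+
    moreover have "normal_rv N Z" using ae by (auto simp: normal_rv_def)
    ultimately show ?thesis using True by simp
  next
    case False
    define s where "s = sqrt v"
    have s: "s > 0" "s\<^sup>2 = v" using False v by (auto simp: s_def)
    have "distr N borel (\<lambda>\<omega>. Z \<omega> / s) = std_normal_distribution"
    proof (rule Levy_uniqueness)
      show "real_distribution (distr N borel (\<lambda>\<omega>. Z \<omega> / s))" by (rule real_distribution_distr) simp
      show "real_distribution std_normal_distribution" by (rule real_dist_normal_dist)
      show "char (distr N borel (\<lambda>\<omega>. Z \<omega> / s)) = char std_normal_distribution"
      proof
        fix t :: real
        have "char (distr N borel (\<lambda>\<omega>. Z \<omega> / s)) t = char (distr N borel Z) (t / s)"
          unfolding char_def by (subst (1 2) integral_distr) auto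
        also have "\<dots> = complex_of_real (exp (- t\<^sup>2 / 2))"
          using char[of "t / s"] s False by (simp add: power_divide)
        finally show "char (distr N borel (\<lambda>\<omega>. Z \<omega> / s)) t = char std_normal_distribution t"
          by (simp only: char_std_normal_distribution)
      qed
    qed
    moreover have "distr N lborel (\<lambda>\<omega>. Z \<omega> / s) = distr N borel (\<lambda>\<omega>. Z \<omega> / s)"
      by (rule distr_cong) auto
    ultimately have "distributed N lborel (\<lambda>\<omega>. (Z \<omega> - 0) / s) std_normal_density"
      unfolding distributed_def by simp
    then have D: "distributed N lborel Z (normal_density 0 s)"
      using normal_standard_normal_convert[OF s(1), of Z 0] by simp
    have mean: "(LINT \<omega>|N. Z \<omega>) = 0" by (rule normal_distributed_expectation[OF s(1) D])
    have "(LINT \<omega>|N. (Z \<omega>)\<^sup>2) = v"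
      using normal_distributed_variance[OF s(1) D] mean s by simp
    moreover have "integrable N Z"
      using distributed_integrable[OF D, of "\<lambda>x. x"] integrable_normal_moment[OF s(1), of 0 1] by simp
    moreover have "integrable N (\<lambda>\<omega>. (Z \<omega>)\<^sup>2)"
      using distributed_integrable[OF D, of "\<lambda>x. x\<^sup>2"] integrable_normal_moment[OF s(1), of 0 2] by simp
    moreover have "normal_rv N Z" using D s by (auto simp: normal_rv_def)
    ultimately show ?thesis using mean by simp
  qed
  show "normal_rv N Z" "integrable N Z" "integrable N (\<lambda>\<omega>. (Z \<omega>)\<^sup>2)" "(LINT \<omega>|N. Z \<omega>) = 0"
    "(LINT \<omega>|N. (Z \<omega>)\<^sup>2) = v"
    using * by auto
qed

section \<open>Classes of functions with small bracketing entropy\<close>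

text \<open>Brackets are attached to the indices, and what is counted are the distinct pairs. An L1
  size of \<open>1 / 64 ^ k\<close> with a number exponential in \<open>k\<close> amounts to
  bracketing numbers that are polynomial in the inverse size.\<close>

locale bracketed_class = prob_space P
  for P :: "'t measure" and F :: "'i set" and f :: "'i \<Rightarrow> 't \<Rightarrow> real"
    and l u :: "nat \<Rightarrow> 'i \<Rightarrow> 't \<Rightarrow> real" and B c :: real +
  assumes F_ne: "F \<noteq> {}" and B: "1 \<le> B" and c: "0 \<le> c"
    and f_measurable: "i \<in> F \<Longrightarrow> f i \<in> borel_measurable P"
    and l_measurable: "i \<in> F \<Longrightarrow> l k i \<in> borel_measurable P"
    and u_measurable: "i \<in> F \<Longrightarrow> u k i \<in> borel_measurable P"
    and l_bound: "i \<in> F \<Longrightarrow> t \<in> space P \<Longrightarrow> \<bar>l k i t\<bar> \<le> B"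
    and u_bound: "i \<in> F \<Longrightarrow> t \<in> space P \<Longrightarrow> \<bar>u k i t\<bar> \<le> B"
    and l_le_f: "i \<in> F \<Longrightarrow> t \<in> space P \<Longrightarrow> l k i t \<le> f i t"
    and f_le_u: "i \<in> F \<Longrightarrow> t \<in> space P \<Longrightarrow> f i t \<le> u k i t"
    and bracket_size: "i \<in> F \<Longrightarrow> (LINT t|P. u k i t - l k i t) \<le> 1 / 64 ^ k"
    and finite_brackets: "finite ((\<lambda>i. (l k i, u k i)) ` F)"
    and card_brackets: "real (card ((\<lambda>i. (l k i, u k i)) ` F)) \<le> exp (c * (real k + 1))"
begin

abbreviation "brackets k \<equiv> (\<lambda>i. (l k i, u k i)) ` F"
abbreviation "lowers k \<equiv> l k ` F"
abbreviation "links k \<equiv> (\<lambda>i. (l k i, l (Suc k) i)) ` F"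

text \<open>The L2 radius of level \<open>k\<close>. The constant leaves room for links, whose L1
  norm is at most \<open>2 / 64 ^ k\<close> and whose values are at most \<open>2 * B\<close>: their
  second moment is at most \<open>4 * B / 64 ^ k\<close>, which lies below the square of the radius
  because \<open>B \<ge> 1\<close>.\<close>

definition scale :: "nat \<Rightarrow> real" where "scale k = 4 * B / 8 ^ k"

text \<open>\<open>4 * B\<close> is the factor of \<open>scale\<close>, \<open>3 * c\<close> comes
  from the number of links between two levels, and \<open>6\<close> bounds
  \<open>2 * exp 1\<close>.\<close>

definition link_const :: real where "link_const = 4 * B * (3 * c + 6)"

lemma scale_pos: "scale k > 0"
  using B by (simp add: scale_def)

lemma link_const_nonneg: "0 \<le> link_const"
  using B c by (simp add: link_const_def)

lemma f_bound: "i \<in> F \<Longrightarrow> t \<in> space P \<Longrightarrow> \<bar>f i t\<bar> \<le> B"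
  using l_le_f[of i t 0] f_le_u[of i t 0] l_bound[of i t 0] u_bound[of i t 0] by linarith

lemma bounded_rv_f: "i \<in> F \<Longrightarrow> f i \<in> bounded_rv P"
  by (rule bounded_rvI[OF f_measurable f_bound])

lemma bounded_rv_l: "i \<in> F \<Longrightarrow> l k i \<in> bounded_rv P"
  by (rule bounded_rvI[OF l_measurable l_bound])

lemma bounded_rv_u: "i \<in> F \<Longrightarrow> u k i \<in> bounded_rv P"
  by (rule bounded_rvI[OF u_measurable u_bound])

lemmas bounded_rv_brackets = bounded_rv_f bounded_rv_l bounded_rv_u

lemma finite_lowers: "finite (lowers k)"
proof -
  have "lowers k = fst ` brackets k" by (auto simp: image_image)
  then show ?thesis using finite_brackets[of k] by simp
qed

text \<open>The link of \<open>i\<close> can be read off from the brackets of \<open>i\<close> at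
  the two levels, so links are at most as many as pairs of brackets.\<close>

lemma links_sub: "links k \<subseteq> (\<lambda>(p, q). (fst p, fst q)) ` (brackets k \<times> brackets (Suc k))"
  by (force simp: image_iff)

lemma finite_links: "finite (links k)"
  by (rule finite_subset[OF links_sub]) (intro finite_imageI finite_cartesian_product finite_brackets)

lemma card_links_le: "real (card (links k)) \<le> exp (3 * c * (real k + 1))"
proof -
  have fin: "finite (brackets k \<times> brackets (Suc k))" by (intro finite_cartesian_product finite_brackets)
  have "card (links k) \<le> card (brackets k \<times> brackets (Suc k))"
    by (rule order_trans[OF card_mono[OF finite_imageI[OF fin] links_sub] card_image_le[OF fin]])
  then have "real (card (links k)) \<le> real (card (brackets k)) * real (card (brackets (Suc k)))"
    by (simp only: card_cartesian_product of_nat_mult[symmetric] of_nat_le_iff)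
  also have "\<dots> \<le> exp (c * (real k + 1)) * exp (c * (real (Suc k) + 1))"
    by (intro mult_mono card_brackets) auto
  also have "\<dots> = exp (c * (2 * real k + 3))" by (simp add: exp_add[symmetric] algebra_simps)
  also have "\<dots> \<le> exp (3 * c * (real k + 1))"
  proof -
    have "c * (2 * real k + 3) \<le> c * (3 * (real k + 1))" using c by (intro mult_left_mono) auto
    then show ?thesis by (simp add: mult_ac)
  qed
  finally show ?thesis .
qed

text \<open>The logarithm grows linearly in \<open>k\<close>, and \<open>k + 1 \<le> 2 ^ k\<close>
  trades it for part of the decay: a rate of 8^(-k) becomes 4^(-k), which is still summable.\<close>

lemma scale_entropy_bound:
  assumes n: "real n \<le> exp (3 * c * (real k + 1))" "n > 0"
  shows "scale k * (ln n + 2 * exp 1) \<le> link_const / 4 ^ k"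
proof -
  have "ln n \<le> 3 * c * (real k + 1)" using n ln_le_cancel_iff[of "real n" "exp (3 * c * (real k + 1))"] by simp
  moreover have "2 * exp (1 :: real) \<le> 6 * (real k + 1)"
    using mult_left_mono[OF exp_le, of 2] by simp
  ultimately have "ln n + 2 * exp 1 \<le> (3 * c + 6) * (real k + 1)" by (simp add: algebra_simps)
  also have "\<dots> \<le> (3 * c + 6) * 2 ^ k"
  proof -
    have "real k + 1 \<le> 2 ^ k"
      using of_nat_mono[OF Suc_leI[OF less_exp[of k]], where 'a = real] by simp
    then show ?thesis using c by (intro mult_left_mono) auto
  qed
  finally have "scale k * (ln n + 2 * exp 1) \<le> scale k * ((3 * c + 6) * 2 ^ k)"
    using scale_pos[of k] by (intro mult_left_mono) auto
  also have "\<dots> = link_const / 4 ^ k"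
    by (simp add: scale_def link_const_def field_simps power_mult_distrib[symmetric])
  finally show ?thesis .
qed

lemma links_ne: "links k \<noteq> {}" using F_ne by simp

lemma card_links_pos: "card (links k) > 0" using links_ne finite_links by (simp add: card_gt_0_iff)

text \<open>A bounded function has its second moment controlled by its L1 norm, since the square of
  \<open>h\<close> is at most \<open>2 * B * \<bar>h t\<bar>\<close>. Taking roots turns 64 into
  8.\<close>

lemma integral_square_le:
  assumes h: "h \<in> bounded_rv P" and b: "\<And>t. t \<in> space P \<Longrightarrow> \<bar>h t\<bar> \<le> 2 * B"
    and le: "(LINT t|P. \<bar>h t\<bar>) \<le> 2 / 64 ^ k"
  shows "(LINT t|P. (h t)\<^sup>2) \<le> (scale k)\<^sup>2"
proof -
  have "(LINT t|P. (h t)\<^sup>2) \<le> (LINT t|P. 2 * B * \<bar>h t\<bar>)"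
  proof (rule integral_mono)
    show "integrable P (\<lambda>t. 2 * B * \<bar>h t\<bar>)" using bounded_rv_integrable[OF h] by simp
    show "(h t)\<^sup>2 \<le> 2 * B * \<bar>h t\<bar>" if "t \<in> space P" for t
      using mult_right_mono[OF b[OF that], of "\<bar>h t\<bar>"] by (simp add: power2_eq_square)
  qed (intro bounded_rv_integrable bounded_rv_power2 h)
  also have "\<dots> = 2 * B * (LINT t|P. \<bar>h t\<bar>)" by simp
  also have "\<dots> \<le> 2 * B * (2 / 64 ^ k)" using B by (intro mult_left_mono le) auto
  also have "\<dots> \<le> 16 * B * B / 64 ^ k"
    using B by (simp add: divide_right_mono mult_mono)
  also have "\<dots> = (scale k)\<^sup>2"
    by (simp add: scale_def power2_eq_square power_mult_distrib[symmetric])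
  finally show ?thesis .
qed

lemma link_function:
  assumes "(g, g') \<in> links k"
  shows "(\<lambda>t. g' t - g t) \<in> bounded_rv P"
    and "t \<in> space P \<Longrightarrow> \<bar>g' t - g t\<bar> \<le> 2 * B"
    and "(LINT t|P. (g' t - g t)\<^sup>2) \<le> (scale k)\<^sup>2"
proof -
  obtain i where i: "i \<in> F" "g = l k i" "g' = l (Suc k) i" using assms by auto
  show bd: "(\<lambda>t. g' t - g t) \<in> bounded_rv P"
    unfolding i by (intro bounded_rv_diff bounded_rv_l i)
  show b: "\<bar>g' t - g t\<bar> \<le> 2 * B" if "t \<in> space P" for t
    using l_bound[OF i(1) that, of k] l_bound[OF i(1) that, of "Suc k"] unfolding i(2,3) by linarith
  \<comment> \<open>Both lower functions lie below \<open>f i\<close>, each within its own bracket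
    width, so their distance is at most the sum of the widths.\<close>
  have "(LINT t|P. \<bar>g' t - g t\<bar>) \<le> (LINT t|P. (u k i t - l k i t) + (u (Suc k) i t - l (Suc k) i t))"
  proof (rule integral_mono)
    show "integrable P (\<lambda>t. \<bar>g' t - g t\<bar>)" using bounded_rv_integrable[OF bd] by simp
    show "integrable P (\<lambda>t. u k i t - l k i t + (u (Suc k) i t - l (Suc k) i t))"
      by (intro bounded_rv_integrable bounded_rv_intros bounded_rv_brackets i)
    show "\<bar>g' t - g t\<bar> \<le> u k i t - l k i t + (u (Suc k) i t - l (Suc k) i t)" if "t \<in> space P" for t
      using l_le_f[OF i(1) that] f_le_u[OF i(1) that] unfolding i by (smt (verit))
  qed
  also have "\<dots> = (LINT t|P. u k i t - l k i t) + (LINT t|P. u (Suc k) i t - l (Suc k) i t)"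
    by (intro Bochner_Integration.integral_add bounded_rv_integrable bounded_rv_intros bounded_rv_brackets i)
  also have "\<dots> \<le> 1 / 64 ^ k + 1 / 64 ^ Suc k" by (intro add_mono bracket_size i)
  also have "\<dots> \<le> 2 / 64 ^ k" by (simp add: field_simps)
  finally have le: "(LINT t|P. \<bar>g' t - g t\<bar>) \<le> 2 / 64 ^ k" .
  show "(LINT t|P. (g' t - g t)\<^sup>2) \<le> (scale k)\<^sup>2" by (rule integral_square_le[OF bd _ le]) (rule b)
qed

lemma bracket_function:
  assumes "(g, g') \<in> brackets k"
  shows "(\<lambda>t. g' t - g t) \<in> bounded_rv P"
    and "t \<in> space P \<Longrightarrow> \<bar>g' t - g t\<bar> \<le> 2 * B"
    and "(LINT t|P. (g' t - g t)\<^sup>2) \<le> (scale k)\<^sup>2"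
proof -
  obtain i where i: "i \<in> F" "g = l k i" "g' = u k i" using assms by auto
  show bd: "(\<lambda>t. g' t - g t) \<in> bounded_rv P"
    unfolding i by (intro bounded_rv_diff bounded_rv_brackets i)
  show b: "\<bar>g' t - g t\<bar> \<le> 2 * B" if "t \<in> space P" for t
    using l_bound[OF i(1) that, of k] u_bound[OF i(1) that, of k] unfolding i(2,3) by linarith
  have "(LINT t|P. \<bar>g' t - g t\<bar>) = (LINT t|P. u k i t - l k i t)"
    by (rule Bochner_Integration.integral_cong[OF refl])
       (use l_le_f[OF i(1)] f_le_u[OF i(1)] i in \<open>smt (verit)\<close>)
  also have "\<dots> \<le> 2 / 64 ^ k"
    by (rule order_trans[OF bracket_size[OF i(1)]]) (simp add: divide_right_mono)
  finally have le: "(LINT t|P. \<bar>g' t - g t\<bar>) \<le> 2 / 64 ^ k" .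
  show "(LINT t|P. (g' t - g t)\<^sup>2) \<le> (scale k)\<^sup>2" by (rule integral_square_le[OF bd _ le]) (rule b)
qed

end

section \<open>The Gaussian limit process\<close>

text \<open>Fixes the outcome of one orthogonalization for all levels. The length \<open>r k\<close>
  is common to all lower functions of level \<open>k\<close>, while the coefficients belong to the
  function and not to the level.\<close>

locale gaussian_limit = bracketed_class P F f l u B c
  for P :: "'t measure" and F :: "'i set" and f :: "'i \<Rightarrow> 't \<Rightarrow> real"
    and l u :: "nat \<Rightarrow> 'i \<Rightarrow> 't \<Rightarrow> real" and B c :: real +
  fixes e :: "nat \<Rightarrow> 't \<Rightarrow> real" and a :: "('t \<Rightarrow> real) \<Rightarrow> nat \<Rightarrow> real" and r :: "nat \<Rightarrow> nat"
  assumes e_bounded: "e j \<in> bounded_rv P"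
    and e_mean: "(LINT t|P. e j t) = 0"
    and e_orthogonal: "j \<noteq> k \<Longrightarrow> (LINT t|P. e j t * e k t) = 0"
    and e_expansion: "g \<in> lowers k \<Longrightarrow> g t - (LINT u|P. g u) = (\<Sum>j<r k. a g j * e j t)"
    and a_support: "g \<in> lowers k \<Longrightarrow> r k \<le> j \<Longrightarrow> a g j = 0"

context bracketed_class
begin

text \<open>Over all levels only countably many lower functions occur, so a single enumeration
  serves them all, and each level lies in an initial segment of it.\<close>

lemma gaussian_limit_exists: "\<exists>e a r. gaussian_limit P F f l u B c e a r"
proof -
  define U where "U = (\<Union>k. lowers k)"
  have U: "countable U" "U \<noteq> {}"
    unfolding U_def using F_ne countable_finite[OF finite_lowers] by simp_all
  have lowers_U: "g \<in> U" if "g \<in> lowers k" for g k using that unfolding U_def by blast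
  \<comment> \<open>If \<open>U\<close> is finite the enumeration repeats functions. The repetitions
    have residuals that vanish almost everywhere, which the orthogonalization tolerates.\<close>
  have bd: "from_nat_into U j \<in> bounded_rv P" for j
    using from_nat_into[OF U(2), of j] by (auto simp: U_def intro: bounded_rv_l)
  obtain e a where e: "\<And>i. e i \<in> bounded_rv P" "\<And>i. (LINT t|P. e i t) = 0"
    "\<And>i j. i \<noteq> j \<Longrightarrow> (LINT t|P. e i t * e j t) = 0"
    and a: "\<And>j r t. j < r \<Longrightarrow> from_nat_into U j t - (LINT u|P. from_nat_into U j u) = (\<Sum>i<r. a j i * e i t)"
    "\<And>j i :: nat. j < i \<Longrightarrow> a j i = (0 :: real)"
    by (rule orthogonal_decomposition[OF bd]) (rule that, assumption+)
  define r where "r k = Suc (Max (to_nat_on U ` lowers k))" for k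
  have r: "to_nat_on U g < r k" if "g \<in> lowers k" for g k
    unfolding r_def using that finite_lowers[of k] by (intro le_imp_less_Suc Max_ge) auto
  have inv: "from_nat_into U (to_nat_on U g) = g" if "g \<in> lowers k" for g k
    using from_nat_into_to_nat_on[OF U(1) lowers_U[OF that]] .
  have "gaussian_limit P F f l u B c e (\<lambda>g. a (to_nat_on U g)) r"
  proof (intro gaussian_limit.intro gaussian_limit_axioms.intro)
    show "bracketed_class P F f l u B c" by (rule bracketed_class_axioms)
    show "g t - (LINT u|P. g u) = (\<Sum>j<r k. a (to_nat_on U g) j * e j t)" if "g \<in> lowers k" for g k t
      using a(1)[OF r[OF that], of t] by (simp add: inv[OF that])
    show "a (to_nat_on U g) j = 0" if "g \<in> lowers k" "r k \<le> j" for g k j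
      using r[OF that(1)] that(2) by (intro a(2)) simp
  qed (use e in auto)
  then show ?thesis by blast
qed

end

context gaussian_limit
begin

section \<open>Gaussian variables attached to the lower brackets\<close>

definition \<sigma> :: "nat \<Rightarrow> real" where "\<sigma> j = sqrt (LINT t|P. (e j t)\<^sup>2)"

lemma \<sigma>_sq: "(\<sigma> j)\<^sup>2 = (LINT t|P. (e j t)\<^sup>2)"
  by (simp add: \<sigma>_def)

text \<open>The Gaussian variable of a lower bracket; the sum has finitely many nonzero terms.\<close>

definition W :: "(nat \<Rightarrow> real) \<Rightarrow> ('t \<Rightarrow> real) \<Rightarrow> real" where
  "W y g = (\<Sum>j | a g j \<noteq> 0. a g j * \<sigma> j * y j)"

text \<open>The same function may be a lower bracket at several levels. Summing over the support of
  its coefficients makes \<open>W\<close> independent of the level, and this lemma recovers a sum of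
  any sufficient length.\<close>

lemma W_eq:
  assumes "g \<in> lowers k" "r k \<le> n"
  shows "W y g = (\<Sum>j<n. a g j * \<sigma> j * y j)"
proof -
  have "{j. a g j \<noteq> 0} \<subseteq> {..<n}"
    using a_support[OF assms(1)] assms(2) by (metis (mono_tags) lessThan_iff linorder_not_less mem_Collect_eq order_trans subsetI)
  then show ?thesis unfolding W_def by (intro sum.mono_neutral_left) auto
qed

lemma e_expansion':
  assumes "g \<in> lowers k" "r k \<le> n"
  shows "g t - (LINT u|P. g u) = (\<Sum>j<n. a g j * e j t)"
proof -
  have "(\<Sum>j<n. a g j * e j t) = (\<Sum>j<r k. a g j * e j t)"
    using assms(2) by (intro sum.mono_neutral_right ballI) (auto simp: a_support[OF assms(1)])
  then show ?thesis using e_expansion[OF assms(1)] by simp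
qed

lemma lowersI: "i \<in> F \<Longrightarrow> l k i \<in> lowers k" by simp

lemma lowers_bounded: "g \<in> lowers k \<Longrightarrow> g \<in> bounded_rv P"
  by (auto intro: bounded_rv_l)

text \<open>By orthogonality, linear combinations of \<^term>\<open>W\<close> have the variances of the functions they stand for.\<close>

lemma sum_W_eq:
  assumes "finite J" "\<And>j. j \<in> J \<Longrightarrow> \<exists>k. g j \<in> lowers k"
  obtains n b where "\<And>y. (\<Sum>j\<in>J. w j * W y (g j)) = (\<Sum>i<n. b i * y i)"
    and "(\<Sum>i<n. (b i)\<^sup>2) =
      (LINT t|P. ((\<Sum>j\<in>J. w j * g j t) - (LINT u|P. (\<Sum>j\<in>J. w j * g j u)))\<^sup>2)"
proof -
  obtain k where k: "\<And>j. j \<in> J \<Longrightarrow> g j \<in> lowers (k j)" using assms(2) by metis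
  define n where "n = Max (insert 0 ((\<lambda>j. r (k j)) ` J))"
  have n: "r (k j) \<le> n" if "j \<in> J" for j
    unfolding n_def using that assms(1) by (intro Max_ge) auto
  define b where "b i = (\<Sum>j\<in>J. w j * a (g j) i)" for i
  have sum_eq: "(\<Sum>j\<in>J. w j * (\<Sum>i<n. a (g j) i * z i)) = (\<Sum>i<n. b i * z i)" for z :: "nat \<Rightarrow> real"
    unfolding b_def sum_distrib_left sum_distrib_right by (subst sum.swap) (simp add: mult.assoc)
  have "(\<Sum>j\<in>J. w j * W y (g j)) = (\<Sum>i<n. (b i * \<sigma> i) * y i)" for y
  proof -
    have "(\<Sum>j\<in>J. w j * W y (g j)) = (\<Sum>j\<in>J. w j * (\<Sum>i<n. a (g j) i * (\<sigma> i * y i)))"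
      using W_eq[OF k n] by (intro sum.cong) (auto simp: mult.assoc)
    then show ?thesis by (simp add: sum_eq mult.assoc)
  qed
  moreover have "(\<Sum>i<n. (b i * \<sigma> i)\<^sup>2) =
      (LINT t|P. ((\<Sum>j\<in>J. w j * g j t) - (LINT u|P. (\<Sum>j\<in>J. w j * g j u)))\<^sup>2)"
  proof -
    have int: "integrable P (g j)" if "j \<in> J" for j
      by (rule bounded_rv_integrable[OF lowers_bounded[OF k[OF that]]])
    have "(\<Sum>j\<in>J. w j * g j t) - (LINT u|P. (\<Sum>j\<in>J. w j * g j u)) = (\<Sum>i<n. b i * e i t)" for t
    proof -
      have "(LINT u|P. (\<Sum>j\<in>J. w j * g j u)) = (\<Sum>j\<in>J. w j * (LINT u|P. g j u))"
        using int by (subst Bochner_Integration.integral_sum) auto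
      then have "(\<Sum>j\<in>J. w j * g j t) - (LINT u|P. (\<Sum>j\<in>J. w j * g j u)) =
          (\<Sum>j\<in>J. w j * (g j t - (LINT u|P. g j u)))"
        by (simp add: sum_subtractf right_diff_distrib)
      also have "\<dots> = (\<Sum>j\<in>J. w j * (\<Sum>i<n. a (g j) i * e i t))"
        using e_expansion'[OF k n] by (intro sum.cong) auto
      finally show ?thesis by (simp add: sum_eq)
    qed
    then show ?thesis
      using integral_orthogonal_sum_square[of e b n, OF e_bounded e_orthogonal]
      by (simp add: power_mult_distrib \<sigma>_sq)
  qed
  ultimately show thesis by (rule that)
qed

lemma W_continuous: "continuous_on UNIV (\<lambda>y. W y g)"
  unfolding W_def by (intro continuous_intros continuous_on_product_coordinates)

lemma W_measurable [measurable]: "(\<lambda>y. W y g) \<in> borel_measurable gauss_seq"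
  using borel_measurable_continuous_onI[OF W_continuous] by simp

abbreviation W_bound :: "nat \<Rightarrow> (nat \<Rightarrow> real) \<Rightarrow> real" where
  "W_bound k y \<equiv> soft_max (scale k) (links k) (\<lambda>(g, g'). W y g' - W y g)"

text \<open>The increment of \<open>W\<close> along a link has the variance of the difference of the
  two functions, which is at most the squared scale. The Gaussian maximal inequality then gives the
  same bound as for the empirical process.\<close>

lemma
  shows integrable_W_bound: "integrable gauss_seq (W_bound k)"
    and integral_W_bound_le: "(LINT y|gauss_seq. W_bound k y) \<le> link_const / 4 ^ k"
proof -
  have *: "integrable gauss_seq (\<lambda>y. exp (\<bar>case d of (g, g') \<Rightarrow> W y g' - W y g\<bar> / scale k)) \<and>
     (LINT y|gauss_seq. exp (\<bar>case d of (g, g') \<Rightarrow> W y g' - W y g\<bar> / scale k)) \<le> 2 * exp 1"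
    if d: "d \<in> links k" for d
  proof -
    obtain g g' where dg: "d = (g, g')" by (cases d)
    have gl: "g \<in> lowers k" "g' \<in> lowers (Suc k)" using d dg by auto
    \<comment> \<open>The increment is a combination with weights 1 and -1. Indexing it by
      \<open>bool\<close> instead of by the functions keeps the two terms apart when
      \<open>g = g'\<close>.\<close>
    define G where "G j = (if j then g' else g)" for j
    define w where "w j = (if j then 1 else -1 :: real)" for j
    have ex: "\<exists>k. G j \<in> lowers k" for j using gl by (auto simp: G_def)
    have sums: "(\<Sum>j\<in>UNIV. w j * h (G j)) = h g' - h g" for h
      by (simp add: UNIV_bool w_def G_def)
    obtain n b where nb: "\<And>y. (\<Sum>j\<in>UNIV. w j * W y (G j)) = (\<Sum>i<n. b i * y i)"
      "(\<Sum>i<n. (b i)\<^sup>2) = (LINT t|P. ((\<Sum>j\<in>UNIV. w j * G j t) - (LINT u|P. (\<Sum>j\<in>UNIV. w j * G j u)))\<^sup>2)"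
      by (rule sum_W_eq[of UNIV G w, OF _ ex]) (simp, blast)
    have "(\<Sum>i<n. (b i)\<^sup>2) = (LINT t|P. ((g' t - g t) - (LINT u|P. g' u - g u))\<^sup>2)"
      unfolding nb(2) using sums[of "\<lambda>g. g t" for t] by simp
    also have "\<dots> = (LINT t|P. (g' t - g t)\<^sup>2) - (LINT t|P. g' t - g t)\<^sup>2"
      using link_function(1)[of g g' k] d dg
      by (intro variance_eq bounded_rv_integrable bounded_rv_power2) auto
    also have "\<dots> \<le> (scale k)\<^sup>2"
      using link_function(3)[of g g' k] d dg by (auto intro: order_trans[rotated])
    finally have le: "(\<Sum>i<n. (b i)\<^sup>2) \<le> (scale k)\<^sup>2" .
    have eq: "(case d of (g, g') \<Rightarrow> W y g' - W y g) = (\<Sum>i<n. b i * y i)" for y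
      using nb(1)[of y] sums[of "W y"] by (simp add: dg)
    show ?thesis unfolding eq
      using integrable_exp_abs_gauss_seq[OF scale_pos le] integral_exp_abs_gauss_seq_le[OF scale_pos le] by simp
  qed
  show "integrable gauss_seq (W_bound k)"
    by (rule integrable_soft_max[OF finite_links links_ne scale_pos, where b = "2 * exp 1"])
       (use * prob_space_gauss_seq in auto)
  have "(LINT y|gauss_seq. W_bound k y) \<le> scale k * (ln (card (links k)) + 2 * exp 1)"
    by (rule integral_soft_max_le[OF finite_links links_ne scale_pos])
       (use * prob_space_gauss_seq in auto)
  also have "\<dots> \<le> link_const / 4 ^ k"
    by (rule scale_entropy_bound[OF card_links_le card_links_pos])
  finally show "(LINT y|gauss_seq. W_bound k y) \<le> link_const / 4 ^ k" .
qed

lemma W_bound_nonneg: "0 \<le> W_bound k y"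
  by (rule soft_max_nonneg[OF finite_links links_ne scale_pos])

lemma W_bound_continuous: "continuous_on UNIV (W_bound k)"
  unfolding soft_max_def split_beta
  by (intro continuous_intros W_continuous) (use scale_pos[of k] card_links_pos[of k] in auto)

lemma W_increment_le: "i \<in> F \<Longrightarrow> \<bar>W y (l (Suc k) i) - W y (l k i)\<bar> \<le> W_bound k y"
  using abs_le_soft_max[OF finite_links, of "(l k i, l (Suc k) i)" k "scale k" "\<lambda>(g, g'). W y g' - W y g"] scale_pos
  by auto

section \<open>Compact sets that carry almost all Gaussian mass\<close>

text \<open>
  On the compact sets \<open>good R\<close> the approximations converge uniformly at a fixed rate, so the
  limit is continuous there.  Since they exhaust almost everything, this yields at once that
  the limit is Borel measurable and that its law is tight.
\<close>

definition load :: "nat \<Rightarrow> (nat \<Rightarrow> real) \<Rightarrow> real" where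
  "load K y = (\<Sum>k<K. 2 ^ k * W_bound k y + \<bar>y k\<bar> / 2 ^ k)"

text \<open>The weights \<open>2 ^ k\<close> keep the expected load bounded, since the increments
  have expectation of order 4^(-k), and yet force increments of order 2^(-k). The coordinate terms
  confine each \<open>y k\<close> to a compact interval. Bounding all partial sums, each continuous
  in \<open>y\<close>, makes the set closed.\<close>

definition good :: "real \<Rightarrow> (nat \<Rightarrow> real) set" where
  "good R = {y. \<forall>K. load K y \<le> R}"

lemma load_continuous: "continuous_on UNIV (load K)"
  unfolding load_def
  by (intro continuous_intros W_bound_continuous continuous_on_product_coordinates) auto

lemma load_measurable [measurable]: "load K \<in> borel_measurable gauss_seq"
  using borel_measurable_continuous_onI[OF load_continuous] by simp

lemma load_mono: "K \<le> K' \<Longrightarrow> load K y \<le> load K' y"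
  unfolding load_def by (rule sum_mono2) (auto intro!: add_nonneg_nonneg mult_nonneg_nonneg W_bound_nonneg)

lemma closed_good: "closed (good R)"
proof -
  have "good R = (\<Inter>K. {y. load K y \<le> R})" by (auto simp: good_def)
  then show ?thesis by (auto intro!: closed_INT closed_Collect_le load_continuous)
qed

lemma good_bounds:
  assumes "y \<in> good R"
  shows "W_bound k y \<le> R / 2 ^ k" "\<bar>y k\<bar> \<le> R * 2 ^ k"
proof -
  have nn: "0 \<le> 2 ^ k * W_bound k y" "0 \<le> \<bar>y k\<bar> / 2 ^ k" for k
    using W_bound_nonneg[of k y] by auto
  have "2 ^ k * W_bound k y + \<bar>y k\<bar> / 2 ^ k \<le> load (Suc k) y"
    unfolding load_def using nn by (intro member_le_sum) (auto intro!: add_nonneg_nonneg)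
  also have "\<dots> \<le> R" using assms by (auto simp: good_def)
  finally have "2 ^ k * W_bound k y \<le> R" "\<bar>y k\<bar> / 2 ^ k \<le> R" using nn[of k] by linarith+
  then show "W_bound k y \<le> R / 2 ^ k" "\<bar>y k\<bar> \<le> R * 2 ^ k" by (simp_all add: field_simps)
qed

text \<open>A closed subset of a product of compact intervals is compact by Tychonoff.\<close>

lemma compact_good: "compact (good R)"
proof -
  let ?S = "\<lambda>k. {- (R * 2 ^ k)..R * 2 ^ k}"
  have "compactin (product_topology (\<lambda>_. euclidean) UNIV) (PiE UNIV ?S)"
    by (subst compactin_PiE) auto
  then have "compact (PiE UNIV ?S)"
    by (simp add: euclidean_product_topology)
  moreover have "good R \<subseteq> PiE UNIV ?S" using good_bounds(2)[of _ R] by (force simp: abs_le_iff)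
  ultimately show ?thesis using closed_good[of R] by (metis compact_Int_closed inf.absorb_iff2)
qed

lemma good_measurable [measurable]: "good R \<in> sets gauss_seq"
  using closed_good[of R] by (simp add: sets_gauss_seq)

lemma integral_load_le: "(LINT y|gauss_seq. load K y) \<le> 2 * (link_const + 1)"
proof -
  interpret G: prob_space gauss_seq by (rule prob_space_gauss_seq)
  note coord = integrable_abs_coordinate integral_abs_coordinate_le
  have "(LINT y|gauss_seq. load K y) =
      (\<Sum>k<K. 2 ^ k * (LINT y|gauss_seq. W_bound k y) + (LINT y|gauss_seq. \<bar>y k\<bar>) / 2 ^ k)"
    unfolding load_def using coord integrable_W_bound
    by (subst Bochner_Integration.integral_sum) (auto intro!: sum.cong)
  also have "\<dots> \<le> (\<Sum>k<K. (link_const + 1) * (1 / 2) ^ k)"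
  proof (rule sum_mono)
    fix k
    have "2 ^ k * (LINT y|gauss_seq. W_bound k y) \<le> 2 ^ k * (link_const / 4 ^ k)"
      by (intro mult_left_mono integral_W_bound_le) auto
    also have "\<dots> = link_const / 2 ^ k" by (simp add: field_simps power_mult_distrib[symmetric])
    finally have "2 ^ k * (LINT y|gauss_seq. W_bound k y) + (LINT y|gauss_seq. \<bar>y k\<bar>) / 2 ^ k \<le> link_const / 2 ^ k + 1 / 2 ^ k"
      using coord[of k] by (intro add_mono divide_right_mono) auto
    then show "2 ^ k * (LINT y|gauss_seq. W_bound k y) + (LINT y|gauss_seq. \<bar>y k\<bar>) / 2 ^ k \<le> (link_const + 1) * (1 / 2) ^ k"
      by (simp add: power_one_over add_divide_distrib)
  qed
  also have "\<dots> \<le> (link_const + 1) * 2"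
  proof -
    have "(\<Sum>k<K. (1 / 2 :: real) ^ k) \<le> (\<Sum>k. (1 / 2) ^ k)"
      by (rule sum_le_suminf) auto
    also have "\<dots> = 2" by (subst suminf_geometric) auto
    finally show ?thesis unfolding sum_distrib_left[symmetric] using link_const_nonneg by (intro mult_left_mono) auto
  qed
  finally show ?thesis by simp
qed

lemma integrable_load: "integrable gauss_seq (load K)"
  unfolding load_def
  by (intro Bochner_Integration.integrable_sum Bochner_Integration.integrable_add
      integrable_mult_right integrable_W_bound integrable_divide integrable_abs_coordinate)

text \<open>Markov's inequality bounds each partial load uniformly in \<open>K\<close>. The events
  \<open>R < load K y\<close> increase with \<open>K\<close>, so continuity from below covers their
  union, the complement of \<open>good R\<close>.\<close>

lemma measure_good_ge:
  assumes "R > 0"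
  shows "measure gauss_seq (good R) \<ge> 1 - 2 * (link_const + 1) / R"
proof -
  interpret G: prob_space gauss_seq by (rule prob_space_gauss_seq)
  have le: "measure gauss_seq {y \<in> space gauss_seq. R < load K y} \<le> 2 * (link_const + 1) / R" for K
  proof -
    have "measure gauss_seq {y \<in> space gauss_seq. R < load K y} \<le> measure gauss_seq {y \<in> space gauss_seq. R \<le> load K y}"
      by (intro G.finite_measure_mono) auto
    also have "\<dots> \<le> (LINT y|gauss_seq. load K y) / R"
      by (rule integral_Markov_inequality_measure[OF integrable_load, where A = "{}"])
         (use assms in \<open>auto simp: load_def intro!: sum_nonneg add_nonneg_nonneg mult_nonneg_nonneg W_bound_nonneg AE_I2\<close>)
    also have "\<dots> \<le> 2 * (link_const + 1) / R"
      using assms by (intro divide_right_mono integral_load_le) auto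
    finally show ?thesis .
  qed
  have "(\<lambda>K. measure gauss_seq {y \<in> space gauss_seq. R < load K y}) \<longlonglongrightarrow>
      measure gauss_seq (\<Union>K. {y \<in> space gauss_seq. R < load K y})"
    by (rule G.finite_Lim_measure_incseq) (auto simp: incseq_def intro: less_le_trans[OF _ load_mono])
  then have "measure gauss_seq (\<Union>K. {y \<in> space gauss_seq. R < load K y}) \<le> 2 * (link_const + 1) / R"
    by (rule LIMSEQ_le_const2) (use le in auto)
  moreover have "(\<Union>K. {y \<in> space gauss_seq. R < load K y}) = space gauss_seq - good R"
    by (auto simp: good_def not_le) (meson not_le)
  ultimately show ?thesis by (simp only: G.prob_compl[OF good_measurable])
qed

abbreviation full :: "(nat \<Rightarrow> real) set" where "full \<equiv> \<Union>R::nat. good (real R)"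

lemma AE_full: "AE y in gauss_seq. y \<in> full"
proof -
  interpret G: prob_space gauss_seq by (rule prob_space_gauss_seq)
  have meas: "full \<in> sets gauss_seq" by measurable
  have "1 - 2 * (link_const + 1) / real (Suc R) \<le> measure gauss_seq full" for R
    by (rule order_trans[OF measure_good_ge], simp) (intro G.finite_measure_mono meas UN_upper UNIV_I)
  moreover have "(\<lambda>R. 1 - 2 * (link_const + 1) / real (Suc R)) \<longlonglongrightarrow> 1 - 0"
    by (intro tendsto_diff tendsto_const LIMSEQ_Suc lim_const_over_n)
  ultimately have "1 \<le> measure gauss_seq full"
    by (intro LIMSEQ_le_const2[of "\<lambda>R. 1 - 2 * (link_const + 1) / real (Suc R)"]) auto
  then have "G.prob full = 1" using G.prob_le_1[of full] by simp
  then show ?thesis using G.AE_in_set_eq_1[OF meas] by simp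
qed

text \<open>A linear map from coefficients to bounded functions on \<open>F\<close>. At
  \<open>emp M \<omega> (e j)\<close> it gives the empirical process on the lower functions of level
  \<open>k\<close>, at \<open>\<sigma> j * y j\<close> its Gaussian counterpart; so both can be
  compared through finitely many coordinates.\<close>

definition embed :: "nat \<Rightarrow> (nat \<Rightarrow> real) \<Rightarrow> 'i \<Rightarrow> real" where
  "embed k x = (\<lambda>i\<in>F. \<Sum>j<r k. a (l k i) j * x j)"

lemma embed_W: "i \<in> F \<Longrightarrow> embed k (\<lambda>j. \<sigma> j * y j) i = W y (l k i)"
  using W_eq[of "l k i" k "r k" y] by (simp add: embed_def mult.assoc)

text \<open>A crude Lipschitz constant of \<open>embed k\<close>. It is uniform in \<open>i\<close>
  because a level has only finitely many lower functions.\<close>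

definition embed_norm :: "nat \<Rightarrow> real" where
  "embed_norm k = (\<Sum>g\<in>lowers k. \<Sum>j<r k. \<bar>a g j\<bar>)"

lemma embed_norm_nonneg: "0 \<le> embed_norm k"
  unfolding embed_norm_def by (intro sum_nonneg) auto

lemma abs_a_le: "i \<in> F \<Longrightarrow> j < r k \<Longrightarrow> \<bar>a (l k i) j\<bar> \<le> embed_norm k"
proof -
  assume "i \<in> F" "j < r k"
  then have "\<bar>a (l k i) j\<bar> \<le> (\<Sum>j<r k. \<bar>a (l k i) j\<bar>)" by (intro member_le_sum) auto
  also have "\<dots> \<le> embed_norm k"
    unfolding embed_norm_def using \<open>i \<in> F\<close>
    by (intro member_le_sum[where f = "\<lambda>g. \<Sum>j<r k. \<bar>a g j\<bar>"]) (auto intro!: sum_nonneg finite_lowers)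
  finally show ?thesis .
qed

lemma embed_diff_le:
  assumes "i \<in> F"
  shows "\<bar>embed k x i - embed k x' i\<bar> \<le> embed_norm k * (\<Sum>j<r k. \<bar>x j - x' j\<bar>)"
proof -
  have "\<bar>embed k x i - embed k x' i\<bar> = \<bar>\<Sum>j<r k. a (l k i) j * (x j - x' j)\<bar>"
    using assms by (simp add: embed_def sum_subtractf[symmetric] right_diff_distrib)
  also have "\<dots> \<le> (\<Sum>j<r k. \<bar>a (l k i) j\<bar> * \<bar>x j - x' j\<bar>)"
    by (rule order_trans[OF sum_abs]) (simp add: abs_mult)
  also have "\<dots> \<le> (\<Sum>j<r k. embed_norm k * \<bar>x j - x' j\<bar>)"
    by (intro sum_mono mult_right_mono abs_a_le assms) auto
  finally show ?thesis by (simp add: sum_distrib_left)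
qed

lemma embed_mem: "embed k x \<in> mspace (linf F)"
proof -
  have "\<bar>embed k x i\<bar> \<le> embed_norm k * (\<Sum>j<r k. \<bar>x j - 0\<bar>)" if "i \<in> F" for i
    using embed_diff_le[OF that, of k x "\<lambda>_. 0"] that by (simp add: embed_def)
  then show ?thesis by (auto simp: mspace_linf_iff embed_def)
qed

lemma mdist_embed_le: "mdist (linf F) (embed k x) (embed k x') \<le> embed_norm k * (\<Sum>j<r k. \<bar>x j - x' j\<bar>)"
  using embed_diff_le F_ne by (subst mdist_linf_le) (auto intro: embed_mem)

lemma embed_continuous: "continuous_map euclidean (mtopology_of (linf F)) (embed k)"
proof -
  interpret L: Metric_space "mspace (linf F)" "mdist (linf F)" by (rule Metric_space_mspace_mdist)
  show ?thesis
    unfolding mtopology_of_def L.continuous_map_to_metric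
  proof (intro ballI allI impI)
    fix x :: "nat \<Rightarrow> real" and \<epsilon> :: real assume "\<epsilon> > 0"
    let ?U = "{x'. embed_norm k * (\<Sum>j<r k. \<bar>x j - x' j\<bar>) < \<epsilon>}"
    have "open ?U"
      by (intro open_Collect_less continuous_intros continuous_on_product_coordinates)
    moreover have "embed k x' \<in> L.mball (embed k x) \<epsilon>" if "x' \<in> ?U" for x'
      using that mdist_embed_le[of k x x'] embed_mem by (auto simp: L.in_mball)
    ultimately show "\<exists>U. openin euclidean U \<and> x \<in> U \<and> (\<forall>y\<in>U. embed k y \<in> L.mball (embed k x) \<epsilon>)"
      using \<open>\<epsilon> > 0\<close> by (intro exI[of _ ?U]) auto
  qed
qed

section \<open>The limit process\<close>

definition limit_process :: "(nat \<Rightarrow> real) \<Rightarrow> 'i \<Rightarrow> real" where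
  "limit_process y = (\<lambda>i\<in>F. if y \<in> full then lim (\<lambda>k. W y (l k i)) else 0)"

lemma
  fixes w :: "nat \<Rightarrow> real"
  assumes "\<And>k. \<bar>w (Suc k) - w k\<bar> \<le> R / 2 ^ k"
  shows convergent_of_geometric: "convergent w"
    and lim_of_geometric: "\<bar>lim w - w k\<bar> \<le> 2 * R / 2 ^ k"
proof -
  have R: "0 \<le> R" using assms[of 0] by simp
  have "summable (\<lambda>k. w (Suc k) - w k)"
  proof (rule summable_comparison_test')
    show "summable (\<lambda>k. R * (1 / 2) ^ k)" by (intro summable_mult summable_geometric) simp
    show "norm (w (Suc k) - w k) \<le> R * (1 / 2) ^ k" if "k \<ge> 0" for k
      using assms[of k] by (simp add: power_one_over)
  qed
  then have "convergent (\<lambda>n. w 0 + (\<Sum>k<n. w (Suc k) - w k))"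
    by (intro convergent_add convergent_const) (simp add: summable_iff_convergent)
  then show conv: "convergent w" by (simp add: sum_lessThan_telescope)
  \<comment> \<open>The subtracted term is what lets the induction on \<open>m\<close> close; it is
    dropped afterwards.\<close>
  have step: "\<bar>w (m + k) - w k\<bar> \<le> 2 * R / 2 ^ k - 2 * R / 2 ^ (m + k)" for m
  proof (induction m)
    case (Suc m)
    have "2 * R / 2 ^ (Suc m + k) = R / 2 ^ (m + k)" by simp
    moreover have "2 * R / 2 ^ (m + k) = 2 * (R / 2 ^ (m + k))" by simp
    ultimately show ?case using Suc.IH assms[of "m + k"] unfolding add_Suc by linarith
  qed simp
  have le: "\<bar>w (m + k) - w k\<bar> \<le> 2 * R / 2 ^ k" for m
    by (rule order_trans[OF step]) (use R in simp)
  have "(\<lambda>m. \<bar>w (m + k) - w k\<bar>) \<longlonglongrightarrow> \<bar>lim w - w k\<bar>"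
    using conv by (intro tendsto_intros LIMSEQ_ignore_initial_segment) (simp add: convergent_LIMSEQ_iff)
  then show "\<bar>lim w - w k\<bar> \<le> 2 * R / 2 ^ k"
    by (rule LIMSEQ_le_const2) (use le in auto)
qed

lemma W_increment_good:
  assumes "y \<in> good R" "i \<in> F"
  shows "\<bar>W y (l (Suc k) i) - W y (l k i)\<bar> \<le> R / 2 ^ k"
  using W_increment_le[OF assms(2), of y k] good_bounds(1)[OF assms(1), of k] by linarith

lemma limit_process_tendsto:
  assumes "y \<in> full" "i \<in> F"
  shows "(\<lambda>k. W y (l k i)) \<longlonglongrightarrow> limit_process y i"
proof -
  obtain R :: nat where "y \<in> good R" using assms by auto
  from convergent_of_geometric[of "\<lambda>k. W y (l k i)", OF W_increment_good[OF this assms(2)]]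
  show ?thesis using assms by (simp add: limit_process_def convergent_LIMSEQ_iff)
qed

lemma limit_process_close:
  assumes "y \<in> good (real R)" "i \<in> F"
  shows "\<bar>limit_process y i - W y (l k i)\<bar> \<le> 2 * real R / 2 ^ k"
  using lim_of_geometric[of "\<lambda>k. W y (l k i)", OF W_increment_good[OF assms]] assms
  by (auto simp: limit_process_def)

lemma limit_process_mem: "limit_process y \<in> mspace (linf F)"
proof (cases "y \<in> full")
  case True
  then obtain R :: nat where R: "y \<in> good R" by auto
  have mem: "embed 0 (\<lambda>j. \<sigma> j * y j) \<in> mspace (linf F)" by (rule embed_mem)
  then obtain b where b: "\<And>i. i \<in> F \<Longrightarrow> \<bar>embed 0 (\<lambda>j. \<sigma> j * y j) i\<bar> \<le> b"
    by (auto simp: mspace_linf_iff)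
  have "\<bar>limit_process y i\<bar> \<le> b + 2 * R" if "i \<in> F" for i
    using b[OF that] limit_process_close[OF R that, of 0] unfolding embed_W[OF that] by simp
  then have "\<exists>b. \<forall>i\<in>F. \<bar>limit_process y i\<bar> \<le> b" by blast
  then show ?thesis unfolding mspace_linf_iff by (simp add: limit_process_def)
qed (auto simp: mspace_linf_iff limit_process_def)

lemma mdist_limit_process_embed:
  assumes "y \<in> good (real R)"
  shows "mdist (linf F) (limit_process y) (embed k (\<lambda>j. \<sigma> j * y j)) \<le> 2 * real R / 2 ^ k"
  using limit_process_close[OF assms] F_ne
  by (subst mdist_linf_le) (auto intro: embed_mem limit_process_mem simp: embed_W)

lemma limit_process_continuous_on_good:
  "continuous_map (top_of_set (good (real R))) (mtopology_of (linf F)) limit_process"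
proof -
  interpret L: Metric_space "mspace (linf F)" "mdist (linf F)" by (rule Metric_space_mspace_mdist)
  show ?thesis
    unfolding mtopology_of_def
  proof (rule L.continuous_map_uniform_limit_alt[where F = sequentially and f = "\<lambda>k y. embed k (\<lambda>j. \<sigma> j * y j)"])
    have "continuous_map euclidean (mtopology_of (linf F)) (embed k \<circ> (\<lambda>y j. \<sigma> j * y j))" for k
    proof (rule continuous_map_compose[OF _ embed_continuous])
      show "continuous_map euclidean euclidean (\<lambda>(y :: nat \<Rightarrow> real) j. \<sigma> j * y j)"
        unfolding continuous_map_iff_continuous2
        by (intro continuous_on_coordinatewise_then_product continuous_intros continuous_on_product_coordinates)
    qed
    then show "\<forall>\<^sub>F k in sequentially. continuous_map (top_of_set (good (real R))) L.mtopology (\<lambda>y. embed k (\<lambda>j. \<sigma> j * y j))"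
      by (intro always_eventually allI) (auto simp: o_def mtopology_of_def intro: continuous_map_from_subtopology)
    show "limit_process \<in> topspace (top_of_set (good (real R))) \<rightarrow> mspace (linf F)"
      by (auto intro: limit_process_mem)
    fix \<epsilon> :: real assume "\<epsilon> > 0"
    have "(\<lambda>k. 2 * real R * (1 / 2) ^ k) \<longlonglongrightarrow> 2 * real R * 0"
      by (intro tendsto_mult tendsto_const LIMSEQ_power_zero) simp
    then have "\<forall>\<^sub>F k in sequentially. 2 * real R * (1 / 2) ^ k < \<epsilon>"
      using \<open>\<epsilon> > 0\<close> by (intro order_tendstoD(2)[of _ "2 * real R * 0"]) auto
    then show "\<forall>\<^sub>F k in sequentially. \<forall>y\<in>topspace (top_of_set (good (real R))).
        mdist (linf F) (embed k (\<lambda>j. \<sigma> j * y j)) (limit_process y) < \<epsilon>"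
    proof eventually_elim
      case (elim k)
      then show ?case
        using mdist_limit_process_embed[of _ R k]
        by (auto simp: L.commute power_one_over intro: le_less_trans)
    qed
  qed simp
qed

text \<open>In a space of bounded functions, measurability of every coordinate does not in general
  give Borel measurability. Continuity on each \<open>good R\<close> does: preimages of open sets
  are relatively open there, and countably many such pieces are glued.\<close>

lemma limit_process_measurable: "limit_process \<in> measurable gauss_seq (borel_of_metric (linf F))"
proof (rule measurable_borel_of_metricI[OF limit_process_mem])
  fix U assume U: "openin (mtopology_of (linf F)) U"
  have 1: "good (real R) \<inter> limit_process -` U \<in> sets gauss_seq" for R :: nat
  proof -
    have "openin (top_of_set (good (real R))) {y \<in> good (real R). limit_process y \<in> U}"
      using openin_continuous_map_preimage[OF limit_process_continuous_on_good U] by simp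
    then obtain V where "open V" "{y \<in> good (real R). limit_process y \<in> U} = good (real R) \<inter> V"
      by (auto simp: openin_open)
    then have "good (real R) \<inter> limit_process -` U = good (real R) \<inter> V" by auto
    also have "\<dots> \<in> sets gauss_seq"
      using \<open>open V\<close> by (intro sets.Int good_measurable) (simp add: sets_gauss_seq)
    finally show ?thesis .
  qed
  \<comment> \<open>Off \<open>full\<close> the process is the constant zero function by definition,
    so the preimage is there everything or nothing.\<close>
  have 2: "- full \<inter> limit_process -` U \<in> sets gauss_seq"
  proof -
    have "limit_process y = (\<lambda>i\<in>F. 0)" if "y \<notin> full" for y
      using that by (simp add: limit_process_def)
    then have "- full \<inter> limit_process -` U = (if (\<lambda>i\<in>F. 0) \<in> U then space gauss_seq - full else {})"
      by auto
    then show ?thesis by simp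
  qed
  have "limit_process -` U \<inter> space gauss_seq =
      (\<Union>R::nat. good (real R) \<inter> limit_process -` U) \<union> (- full \<inter> limit_process -` U)"
    by auto
  also have "\<dots> \<in> sets gauss_seq" using 1 2 by (intro sets.Un sets.countable_UN) auto
  finally show "limit_process -` U \<inter> space gauss_seq \<in> sets gauss_seq" .
qed

section \<open>The law of the limit process\<close>

definition limit_law :: "('i \<Rightarrow> real) measure" where
  "limit_law = distr gauss_seq (borel_of_metric (linf F)) limit_process"

lemma prob_space_limit_law: "prob_space limit_law"
  unfolding limit_law_def by (rule prob_space.prob_space_distr[OF prob_space_gauss_seq limit_process_measurable])

lemma sets_limit_law: "sets limit_law = sets (borel_of_metric (linf F))"
  by (simp add: limit_law_def)

lemma tight_limit_law: "tight_law (linf F) limit_law"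
  unfolding tight_law_def
proof (intro allI impI)
  fix \<epsilon> :: real assume "\<epsilon> > 0"
  interpret L: Metric_space "mspace (linf F)" "mdist (linf F)" by (rule Metric_space_mspace_mdist)
  interpret G: prob_space gauss_seq by (rule prob_space_gauss_seq)
  obtain R :: nat where R: "2 * (link_const + 1) / \<epsilon> < real R" using reals_Archimedean2 by blast
  have R0: "real R > 0"
    using R \<open>\<epsilon> > 0\<close> link_const_nonneg by (smt (verit) divide_nonneg_pos)
  define K where "K = limit_process ` good (real R)"
  have "compactin (top_of_set (good (real R))) (good (real R))"
    using compact_good by (simp add: compactin_subtopology)
  then have K: "compactin (mtopology_of (linf F)) K"
    unfolding K_def by (rule image_compactin[OF _ limit_process_continuous_on_good])
  then have "closedin (mtopology_of (linf F)) K"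
    using L.Hausdorff_space_mtopology unfolding mtopology_of_def by (metis compactin_imp_closedin)
  then have "measure limit_law K = measure gauss_seq (limit_process -` K \<inter> space gauss_seq)"
    unfolding limit_law_def by (intro measure_distr limit_process_measurable sets_borel_of_metric)
  also have "\<dots> \<ge> measure gauss_seq (good (real R))"
    using measurable_sets[OF limit_process_measurable sets_borel_of_metric(3)[OF \<open>closedin _ K\<close>]]
    by (intro G.finite_measure_mono) (auto simp: K_def)
  moreover have "measure gauss_seq (good (real R)) \<ge> 1 - 2 * (link_const + 1) / R"
    by (rule measure_good_ge[OF R0])
  moreover have "2 * (link_const + 1) / R \<le> \<epsilon>"
    using R R0 \<open>\<epsilon> > 0\<close> by (simp add: field_simps)
  ultimately show "\<exists>K. compactin (mtopology_of (linf F)) K \<and> 1 - \<epsilon> \<le> measure limit_law K"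
    using K by (intro exI[of _ K]) simp
qed

text \<open>For uniformly bounded functions L1 convergence implies convergence of second moments, so
  the bracket sizes suffice. This identifies the variances of the limit.\<close>

lemma integral_combination_tendsto:
  assumes J: "finite J" "J \<subseteq> F"
  shows "(\<lambda>k. LINT t|P. ((\<Sum>j\<in>J. w j * l k j t) - (LINT u|P. (\<Sum>j\<in>J. w j * l k j u)))\<^sup>2) \<longlonglongrightarrow>
    (LINT t|P. ((\<Sum>j\<in>J. w j * f j t) - (LINT u|P. (\<Sum>j\<in>J. w j * f j u)))\<^sup>2)"
proof -
  define X where "X k t = (\<Sum>j\<in>J. w j * l k j t)" for k t
  define Y where "Y t = (\<Sum>j\<in>J. w j * f j t)" for t
  define A where "A = (\<Sum>j\<in>J. \<bar>w j\<bar>)"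
  have A: "0 \<le> A" by (auto simp: A_def intro: sum_nonneg)
  have X: "X k \<in> bounded_rv P" for k
    unfolding X_def using J by (intro bounded_rv_sum bounded_rv_mult bounded_rv_const bounded_rv_l) auto
  have Y: "Y \<in> bounded_rv P"
    unfolding Y_def using J by (intro bounded_rv_sum bounded_rv_mult bounded_rv_const bounded_rv_f) auto
  note ints = X[THEN bounded_rv_integrable] Y[THEN bounded_rv_integrable]
    X[THEN bounded_rv_power2, THEN bounded_rv_integrable] Y[THEN bounded_rv_power2, THEN bounded_rv_integrable]
  have Xb: "\<bar>X k t\<bar> \<le> A * B" if "t \<in> space P" for k t
    unfolding X_def A_def sum_distrib_right
    by (rule order_trans[OF sum_abs]) (use J that in \<open>auto simp: abs_mult intro!: sum_mono mult_left_mono l_bound\<close>)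
  have Yb: "\<bar>Y t\<bar> \<le> A * B" if "t \<in> space P" for t
    unfolding Y_def A_def sum_distrib_right
    by (rule order_trans[OF sum_abs]) (use J that in \<open>auto simp: abs_mult intro!: sum_mono mult_left_mono f_bound\<close>)
  have diff: "(LINT t|P. \<bar>X k t - Y t\<bar>) \<le> A * (1 / 64) ^ k" for k
  proof -
    have bd: "(\<lambda>t. \<Sum>j\<in>J. \<bar>w j\<bar> * (u k j t - l k j t)) \<in> bounded_rv P"
      using J by (intro bounded_rv_sum bounded_rv_mult bounded_rv_const bounded_rv_diff bounded_rv_brackets) auto
    have "(LINT t|P. \<bar>X k t - Y t\<bar>) \<le> (LINT t|P. (\<Sum>j\<in>J. \<bar>w j\<bar> * (u k j t - l k j t)))"
    proof (rule integral_mono)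
      show "integrable P (\<lambda>t. \<bar>X k t - Y t\<bar>)" using ints by simp
      show "integrable P (\<lambda>t. \<Sum>j\<in>J. \<bar>w j\<bar> * (u k j t - l k j t))" by (rule bounded_rv_integrable[OF bd])
      fix t assume t: "t \<in> space P"
      have "\<bar>X k t - Y t\<bar> = \<bar>\<Sum>j\<in>J. w j * (l k j t - f j t)\<bar>"
        by (simp add: X_def Y_def sum_subtractf right_diff_distrib)
      also have "\<dots> \<le> (\<Sum>j\<in>J. \<bar>w j\<bar> * \<bar>l k j t - f j t\<bar>)"
        by (rule order_trans[OF sum_abs]) (simp add: abs_mult)
      also have "\<dots> \<le> (\<Sum>j\<in>J. \<bar>w j\<bar> * (u k j t - l k j t))"
      proof (intro sum_mono mult_left_mono)
        fix j assume "j \<in> J"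
        then have j: "j \<in> F" using J by auto
        show "\<bar>l k j t - f j t\<bar> \<le> u k j t - l k j t"
          using l_le_f[OF j t, of k] f_le_u[OF j t, of k] by linarith
      qed simp
      finally show "\<bar>X k t - Y t\<bar> \<le> (\<Sum>j\<in>J. \<bar>w j\<bar> * (u k j t - l k j t))" .
    qed
    also have "\<dots> = (\<Sum>j\<in>J. \<bar>w j\<bar> * (LINT t|P. u k j t - l k j t))"
      using J by (subst Bochner_Integration.integral_sum)
        (auto intro!: bounded_rv_integrable bounded_rv_mult bounded_rv_diff bounded_rv_brackets integrable_mult_right)
    also have "\<dots> \<le> (\<Sum>j\<in>J. \<bar>w j\<bar> * (1 / 64) ^ k)"
      using J bracket_size by (intro sum_mono mult_left_mono) (auto simp: power_one_over)
    finally show ?thesis by (simp add: A_def sum_distrib_right)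
  qed
  have pow: "(\<lambda>k. C * (1 / 64 :: real) ^ k) \<longlonglongrightarrow> 0" for C
    by (intro tendsto_mult_right_zero LIMSEQ_power_zero) simp
  have mean: "(\<lambda>k. LINT t|P. X k t) \<longlonglongrightarrow> (LINT t|P. Y t)"
  proof (rule LIM_zero_cancel, rule Lim_null_comparison[OF always_eventually[OF allI] pow[of A]])
    fix k
    have "norm ((LINT t|P. X k t) - (LINT t|P. Y t)) = \<bar>LINT t|P. X k t - Y t\<bar>" using ints by simp
    also have "\<dots> \<le> (LINT t|P. \<bar>X k t - Y t\<bar>)" by (rule integral_abs_bound)
    finally show "norm ((LINT t|P. X k t) - (LINT t|P. Y t)) \<le> A * (1 / 64) ^ k" using diff[of k] by simp
  qed
  have square: "(\<lambda>k. LINT t|P. (X k t)\<^sup>2) \<longlonglongrightarrow> (LINT t|P. (Y t)\<^sup>2)"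
  proof (rule LIM_zero_cancel, rule Lim_null_comparison[OF always_eventually[OF allI] pow[of "2 * A * B * A"]])
    fix k
    have "norm ((LINT t|P. (X k t)\<^sup>2) - (LINT t|P. (Y t)\<^sup>2)) = \<bar>LINT t|P. (X k t)\<^sup>2 - (Y t)\<^sup>2\<bar>"
      using ints by simp
    also have "\<dots> \<le> (LINT t|P. \<bar>(X k t)\<^sup>2 - (Y t)\<^sup>2\<bar>)" by (rule integral_abs_bound)
    also have "\<dots> \<le> (LINT t|P. 2 * A * B * \<bar>X k t - Y t\<bar>)"
    proof (rule integral_mono)
      fix t assume t: "t \<in> space P"
      have "\<bar>(X k t)\<^sup>2 - (Y t)\<^sup>2\<bar> = \<bar>X k t + Y t\<bar> * \<bar>X k t - Y t\<bar>"
        by (simp add: abs_mult[symmetric] power2_eq_square algebra_simps)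
      also have "\<dots> \<le> 2 * A * B * \<bar>X k t - Y t\<bar>"
        using Xb[OF t, of k] Yb[OF t] by (intro mult_right_mono) auto
      finally show "\<bar>(X k t)\<^sup>2 - (Y t)\<^sup>2\<bar> \<le> 2 * A * B * \<bar>X k t - Y t\<bar>" .
    qed (use ints in auto)
    also have "\<dots> = 2 * A * B * (LINT t|P. \<bar>X k t - Y t\<bar>)" by simp
    also have "\<dots> \<le> 2 * A * B * (A * (1 / 64) ^ k)" using A B by (intro mult_left_mono diff) auto
    finally show "norm ((LINT t|P. (X k t)\<^sup>2) - (LINT t|P. (Y t)\<^sup>2)) \<le> 2 * A * B * A * (1 / 64) ^ k"
      by (simp add: mult.assoc)
  qed
  have "(\<lambda>k. (LINT t|P. (X k t)\<^sup>2) - (LINT t|P. X k t)\<^sup>2) \<longlonglongrightarrow> (LINT t|P. (Y t)\<^sup>2) - (LINT t|P. Y t)\<^sup>2"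
    by (intro tendsto_intros mean square)
  moreover have "(LINT t|P. (X k t)\<^sup>2) - (LINT t|P. X k t)\<^sup>2 = (LINT t|P. (X k t - (LINT u|P. X k u))\<^sup>2)" for k
    using variance_eq[of "X k"] ints by simp
  moreover have "(LINT t|P. (Y t)\<^sup>2) - (LINT t|P. Y t)\<^sup>2 = (LINT t|P. (Y t - (LINT u|P. Y u))\<^sup>2)"
    using variance_eq[of Y] ints by simp
  ultimately show ?thesis unfolding X_def Y_def by simp
qed

lemma sets_limit_law_measurable: "g \<in> borel_measurable (borel_of_metric (linf F)) \<Longrightarrow> g \<in> borel_measurable limit_law"
  by (simp add: limit_law_def)

lemma combination_measurable:
  assumes "J \<subseteq> F"
  shows "(\<lambda>z. \<Sum>j\<in>J. w j * z j) \<in> borel_measurable (borel_of_metric (linf F))"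
  using assms
  by (intro borel_measurable_sum borel_measurable_times borel_measurable_const
      continuous_map_borel_of_metric continuous_map_coordinate_linf) auto

text \<open>At every level the combination of the \<open>W\<close> is exactly normal with the
  variance of the corresponding functions. Dominated convergence on the left and convergence of the
  variances on the right carry this to the limit.\<close>

lemma char_limit_law:
  assumes J: "finite J" "J \<subseteq> F"
  shows "char (distr limit_law borel (\<lambda>z. \<Sum>j\<in>J. w j * z j)) t = complex_of_real (exp (- (t\<^sup>2 *
    (LINT t|P. ((\<Sum>j\<in>J. w j * f j t) - (LINT u|P. (\<Sum>j\<in>J. w j * f j u)))\<^sup>2)) / 2))"
    (is "_ = complex_of_real (exp (- (t\<^sup>2 * ?v) / 2))")
proof -
  interpret G: prob_space gauss_seq by (rule prob_space_gauss_seq)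
  let ?vk = "\<lambda>k. LINT t|P. ((\<Sum>j\<in>J. w j * l k j t) - (LINT u|P. (\<Sum>j\<in>J. w j * l k j u)))\<^sup>2"
  have meas: "(\<lambda>y. \<Sum>j\<in>J. w j * limit_process y j) \<in> borel_measurable gauss_seq"
    using measurable_compose[OF limit_process_measurable combination_measurable[OF J(2), of w]] .
  have "char (distr limit_law borel (\<lambda>z. \<Sum>j\<in>J. w j * z j)) t =
      (CLINT y|gauss_seq. iexp (t * (\<Sum>j\<in>J. w j * limit_process y j)))"
    unfolding limit_law_def char_def using combination_measurable[OF J(2), of w] limit_process_measurable meas
    by (simp add: distr_distr comp_def integral_distr)
  moreover have "(\<lambda>k. CLINT y|gauss_seq. iexp (t * (\<Sum>j\<in>J. w j * W y (l k j)))) \<longlonglongrightarrow>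
      (CLINT y|gauss_seq. iexp (t * (\<Sum>j\<in>J. w j * limit_process y j)))"
  proof (rule integral_dominated_convergence[where w = "\<lambda>_. 1"])
    show "AE y in gauss_seq. (\<lambda>k. iexp (t * (\<Sum>j\<in>J. w j * W y (l k j)))) \<longlonglongrightarrow>
        iexp (t * (\<Sum>j\<in>J. w j * limit_process y j))"
      using AE_full
    proof eventually_elim
      case (elim y)
      have "(\<lambda>k. t * (\<Sum>j\<in>J. w j * W y (l k j))) \<longlonglongrightarrow> t * (\<Sum>j\<in>J. w j * limit_process y j)"
        using J elim by (intro tendsto_intros limit_process_tendsto) auto
      then show ?case by (rule isCont_tendsto_compose[OF isCont_iexp])
    qed
    show "(\<lambda>y. iexp (t * (\<Sum>j\<in>J. w j * limit_process y j))) \<in> borel_measurable gauss_seq"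
      using meas by measurable
  qed (simp_all del: of_real_mult)
  moreover have "(CLINT y|gauss_seq. iexp (t * (\<Sum>j\<in>J. w j * W y (l k j)))) = complex_of_real (exp (- (t\<^sup>2 * ?vk k) / 2))" for k
  proof -
    have ex: "\<exists>k'. l k j \<in> lowers k'" if "j \<in> J" for j using that J by blast
    obtain n b where nb: "\<And>y. (\<Sum>j\<in>J. w j * W y (l k j)) = (\<Sum>i<n. b i * y i)" "(\<Sum>i<n. (b i)\<^sup>2) = ?vk k"
      by (rule sum_W_eq[of J "l k" w, OF J(1) ex]) blast+
    show ?thesis using char_gauss_seq_sum[of b n t] unfolding nb char_def
      by (simp add: integral_distr)
  qed
  moreover have "(\<lambda>k. complex_of_real (exp (- (t\<^sup>2 * ?vk k) / 2))) \<longlonglongrightarrow> complex_of_real (exp (- (t\<^sup>2 * ?v) / 2))"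
    by (intro tendsto_intros integral_combination_tendsto J) auto
  ultimately show ?thesis by (simp only:) (rule LIMSEQ_unique)
qed

lemma
  assumes J: "finite J" "J \<subseteq> F"
  shows normal_combination: "normal_rv limit_law (\<lambda>z. \<Sum>j\<in>J. w j * z j)"
    and integrable_combination: "integrable limit_law (\<lambda>z. \<Sum>j\<in>J. w j * z j)"
      "integrable limit_law (\<lambda>z. (\<Sum>j\<in>J. w j * z j)\<^sup>2)"
    and mean_combination: "(LINT z|limit_law. (\<Sum>j\<in>J. w j * z j)) = 0"
    and variance_combination: "(LINT z|limit_law. (\<Sum>j\<in>J. w j * z j)\<^sup>2) =
      (LINT t|P. ((\<Sum>j\<in>J. w j * f j t) - (LINT u|P. (\<Sum>j\<in>J. w j * f j u)))\<^sup>2)"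
proof -
  note meas = sets_limit_law_measurable[OF combination_measurable[OF J(2), of w]]
  have nn: "0 \<le> (LINT t|P. ((\<Sum>j\<in>J. w j * f j t) - (LINT u|P. (\<Sum>j\<in>J. w j * f j u)))\<^sup>2)" by simp
  note * = prob_space_limit_law meas char_limit_law[OF J] nn
  show "normal_rv limit_law (\<lambda>z. \<Sum>j\<in>J. w j * z j)" by (rule normal_rv_of_char[OF *])
  show "integrable limit_law (\<lambda>z. \<Sum>j\<in>J. w j * z j)" "integrable limit_law (\<lambda>z. (\<Sum>j\<in>J. w j * z j)\<^sup>2)"
    by (rule integrable_of_normal_char[OF *])+
  show "(LINT z|limit_law. (\<Sum>j\<in>J. w j * z j)) = 0" by (rule mean_of_normal_char[OF *])
  show "(LINT z|limit_law. (\<Sum>j\<in>J. w j * z j)\<^sup>2) =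
      (LINT t|P. ((\<Sum>j\<in>J. w j * f j t) - (LINT u|P. (\<Sum>j\<in>J. w j * f j u)))\<^sup>2)"
    by (rule variance_of_normal_char[OF *])
qed

lemma gaussian_limit_law: "gaussian_process limit_law F (\<lambda>i z. z i)"
  unfolding gaussian_process_def by (auto intro: normal_combination)

lemma mean_limit_law: "i \<in> F \<Longrightarrow> (LINT z|limit_law. z i) = 0"
  using mean_combination[of "{i}" "\<lambda>_. 1"] by simp

lemma covariance_limit_law:
  assumes i: "i \<in> F" and j: "j \<in> F"
  shows "covariance limit_law (\<lambda>z. z i) (\<lambda>z. z j) = covariance P (f i) (f j)"
proof -
  define F0 where "F0 i t = f i t - (LINT t|P. f i t)" for i t
  have F0: "F0 i \<in> bounded_rv P" if "i \<in> F" for i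
    unfolding F0_def using that by (intro bounded_rv_diff bounded_rv_const bounded_rv_f)
  have cov: "covariance P (f i) (f j) = (LINT t|P. F0 i t * F0 j t)"
    by (simp add: covariance_def F0_def)
  have covL: "covariance limit_law (\<lambda>z. z i) (\<lambda>z. z j) = (LINT z|limit_law. z i * z j)"
    by (simp add: covariance_def mean_limit_law i j)
  have one: "(LINT z|limit_law. (z i)\<^sup>2) = (LINT t|P. (F0 i t)\<^sup>2)" "integrable limit_law (\<lambda>z. (z i)\<^sup>2)" if "i \<in> F" for i
    using variance_combination[of "{i}" "\<lambda>_. 1"] integrable_combination(2)[of "{i}" "\<lambda>_. 1"] that
    by (simp_all add: F0_def)
  show ?thesis
  \<comment> \<open>For \<open>i = j\<close> the set \<open>{i, j}\<close> collapses and a sum over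
    it would count the variable only once.\<close>
  proof (cases "i = j")
    case True
    then show ?thesis using one[OF i] unfolding cov covL by (simp add: power2_eq_square)
  next
    case False
    have int: "integrable P (f i)" "integrable P (f j)" using bounded_rv_f i j bounded_rv_integrable by auto
    have two: "(LINT z|limit_law. (z i + z j)\<^sup>2) = (LINT t|P. (F0 i t + F0 j t)\<^sup>2)"
      "integrable limit_law (\<lambda>z. (z i + z j)\<^sup>2)"
      using variance_combination[of "{i, j}" "\<lambda>_. 1"] integrable_combination(2)[of "{i, j}" "\<lambda>_. 1"] i j False int
      by (simp_all add: F0_def algebra_simps)
    \<comment> \<open>Polarization expresses the covariance by the variances of the two variables
      and of their sum.\<close>
    have eq: "x * y = ((x + y)\<^sup>2 - x\<^sup>2 - y\<^sup>2) / 2" for x y :: real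
      by (simp add: power2_sum)
    have "(LINT z|limit_law. z i * z j) = ((LINT z|limit_law. (z i + z j)\<^sup>2) - (LINT z|limit_law. (z i)\<^sup>2) - (LINT z|limit_law. (z j)\<^sup>2)) / 2"
      unfolding eq[of "z i" "z j" for z] using two(2) one(2) i j by simp
    also have "\<dots> = ((LINT t|P. (F0 i t + F0 j t)\<^sup>2) - (LINT t|P. (F0 i t)\<^sup>2) - (LINT t|P. (F0 j t)\<^sup>2)) / 2"
      using two(1) one(1) i j by simp
    also have "\<dots> = (LINT t|P. F0 i t * F0 j t)"
    proof -
      have "integrable P (\<lambda>t. (F0 i t + F0 j t)\<^sup>2)" "integrable P (\<lambda>t. (F0 i t)\<^sup>2)" "integrable P (\<lambda>t. (F0 j t)\<^sup>2)"
        using F0 i j by (intro bounded_rv_integrable bounded_rv_power2 bounded_rv_add; simp)+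
      then show ?thesis unfolding eq[of "F0 i t" "F0 j t" for t] by simp
    qed
    finally show ?thesis by (simp add: cov covL)
  qed
qed

end

section \<open>Outer expectations and Lipschitz test functions\<close>

context prob_space
begin

text \<open>Boundedness of \<open>f\<close> keeps the integrals of its majorants bounded below, so
  that the real infimum is a genuine one.\<close>

lemma outer_expectation_le:
  assumes f: "\<And>\<omega>. \<omega> \<in> space M \<Longrightarrow> \<bar>f \<omega>\<bar> \<le> H"
    and U: "integrable M U" "\<And>\<omega>. \<omega> \<in> space M \<Longrightarrow> f \<omega> \<le> U \<omega>"
  shows "outer_expectation M f \<le> integral\<^sup>L M U"
  unfolding outer_expectation_def
proof (rule cInf_lower)
  show "bdd_below {integral\<^sup>L M U | U. integrable M U \<and> (\<forall>\<omega>\<in>space M. f \<omega> \<le> U \<omega>)}"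
  proof (rule bdd_belowI)
    fix x assume "x \<in> {integral\<^sup>L M U | U. integrable M U \<and> (\<forall>\<omega>\<in>space M. f \<omega> \<le> U \<omega>)}"
    then obtain U where U: "x = integral\<^sup>L M U" "integrable M U" "\<And>\<omega>. \<omega> \<in> space M \<Longrightarrow> f \<omega> \<le> U \<omega>" by auto
    have "(LINT \<omega>|M. - H) \<le> integral\<^sup>L M U"
      using U f by (intro integral_mono) (force simp: abs_le_iff)+
    then show "- H \<le> x" by (simp add: U prob_space)
  qed
qed (use U in auto)

lemma outer_expectation_ge:
  assumes f: "\<And>\<omega>. \<omega> \<in> space M \<Longrightarrow> \<bar>f \<omega>\<bar> \<le> H"
    and V: "integrable M V" "\<And>\<omega>. \<omega> \<in> space M \<Longrightarrow> V \<omega> \<le> f \<omega>"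
  shows "integral\<^sup>L M V \<le> outer_expectation M f"
  unfolding outer_expectation_def
proof (rule cInf_greatest)
  have "integrable M (\<lambda>_. H)" "\<forall>\<omega>\<in>space M. f \<omega> \<le> H" using f by (auto simp: abs_le_iff)
  then show "{integral\<^sup>L M U | U. integrable M U \<and> (\<forall>\<omega>\<in>space M. f \<omega> \<le> U \<omega>)} \<noteq> {}" by blast
  fix x assume "x \<in> {integral\<^sup>L M U | U. integrable M U \<and> (\<forall>\<omega>\<in>space M. f \<omega> \<le> U \<omega>)}"
  then show "integral\<^sup>L M V \<le> x" using V by (auto intro!: integral_mono intro: order_trans)
qed

lemma outer_expectation_mono:
  assumes f: "\<And>\<omega>. \<omega> \<in> space M \<Longrightarrow> \<bar>f \<omega>\<bar> \<le> H" and g: "\<And>\<omega>. \<omega> \<in> space M \<Longrightarrow> \<bar>g \<omega>\<bar> \<le> H'"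
    and le: "\<And>\<omega>. \<omega> \<in> space M \<Longrightarrow> f \<omega> \<le> g \<omega>"
  shows "outer_expectation M f \<le> outer_expectation M g"
  unfolding outer_expectation_def[of M g]
proof (rule cInf_greatest)
  have "integrable M (\<lambda>_. H')" "\<forall>\<omega>\<in>space M. g \<omega> \<le> H'" using g by (auto simp: abs_le_iff)
  then show "{integral\<^sup>L M U | U. integrable M U \<and> (\<forall>\<omega>\<in>space M. g \<omega> \<le> U \<omega>)} \<noteq> {}" by blast
  fix x assume "x \<in> {integral\<^sup>L M U | U. integrable M U \<and> (\<forall>\<omega>\<in>space M. g \<omega> \<le> U \<omega>)}"
  then show "outer_expectation M f \<le> x"
    using le by (auto intro!: outer_expectation_le[OF f] intro: order_trans)
qed

end

text \<open>The infimal convolution of \<open>h\<close> with \<open>k d\<close> is \<open>k\<close>-Lipschitz and increases to \<open>h\<close> as \<open>k\<close> grows.\<close>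

lemma lipschitz_approximation_below:
  fixes h :: "'a \<Rightarrow> real"
  assumes h: "continuous_map (mtopology_of m) euclideanreal h" and H: "\<And>x. x \<in> mspace m \<Longrightarrow> \<bar>h x\<bar> \<le> H"
  obtains g :: "nat \<Rightarrow> 'a \<Rightarrow> real" where
    "\<And>k x y. x \<in> mspace m \<Longrightarrow> y \<in> mspace m \<Longrightarrow> \<bar>g k x - g k y\<bar> \<le> real k * mdist m x y"
    "\<And>k x. x \<in> mspace m \<Longrightarrow> \<bar>g k x\<bar> \<le> H" "\<And>k x. x \<in> mspace m \<Longrightarrow> g k x \<le> h x"
    "\<And>x. x \<in> mspace m \<Longrightarrow> (\<lambda>k. g k x) \<longlonglongrightarrow> h x"
proof -
  interpret m: Metric_space "mspace m" "mdist m" by (rule Metric_space_mspace_mdist)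
  define g where "g k x = (INF y\<in>mspace m. h y + real k * mdist m x y)" for k :: nat and x
  have lower: "- H \<le> h y + real k * mdist m x y" if "y \<in> mspace m" for k x y
  proof -
    have "0 \<le> real k * mdist m x y" by simp
    then show ?thesis using H[OF that] by linarith
  qed
  have bdd: "bdd_below ((\<lambda>y. h y + real k * mdist m x y) ` mspace m)" for k x
    by (rule bdd_belowI2[of _ "- H"]) (rule lower)
  have g_le: "g k x \<le> h y + real k * mdist m x y" if "y \<in> mspace m" for k x y
    unfolding g_def by (rule cINF_lower[OF bdd that])
  have g_ge: "c \<le> g k x" if "x \<in> mspace m" "\<And>y. y \<in> mspace m \<Longrightarrow> c \<le> h y + real k * mdist m x y" for c k x
    unfolding g_def using that by (intro cINF_greatest) auto
  have g_h: "g k x \<le> h x" if "x \<in> mspace m" for k x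
    using g_le[OF that, of k x] that by simp
  have lip1: "g k x \<le> g k y + real k * mdist m x y" if xy: "x \<in> mspace m" "y \<in> mspace m" for k x y
  proof -
    have "g k x - real k * mdist m x y \<le> g k y"
    proof (rule g_ge[OF xy(2)])
      fix z assume z: "z \<in> mspace m"
      have "g k x \<le> h z + real k * mdist m x z" by (rule g_le[OF z])
      also have "real k * mdist m x z \<le> real k * (mdist m x y + mdist m y z)"
        using xy z by (intro mult_left_mono m.triangle) auto
      finally show "g k x - real k * mdist m x y \<le> h z + real k * mdist m y z"
        by (simp add: algebra_simps)
    qed
    then show ?thesis by simp
  qed
  show thesis
  proof (rule that[of g])
    show "\<bar>g k x - g k y\<bar> \<le> real k * mdist m x y" if "x \<in> mspace m" "y \<in> mspace m" for k x y
      using lip1[OF that, of k] lip1[OF that(2,1), of k] m.commute[of x y] by (simp add: abs_le_iff)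
    show "\<bar>g k x\<bar> \<le> H" if "x \<in> mspace m" for k x
      using g_h[OF that, of k] g_ge[OF that, of "- H" k] lower H[OF that] by (auto simp: abs_le_iff)
    show "g k x \<le> h x" if "x \<in> mspace m" for k x by (rule g_h[OF that])
    show "(\<lambda>k. g k x) \<longlonglongrightarrow> h x" if x: "x \<in> mspace m" for x
    proof (rule LIMSEQ_I)
      fix e :: real assume e: "e > 0"
      have "continuous_map m.mtopology (mtopology_of euclidean_metric) h"
        using h by (simp add: mtopology_of_def)
      then have "continuous_map m.mtopology Met_TC.mtopology h" by (simp add: mtopology_of_def)
      then obtain d where d: "d > 0" "\<And>y. y \<in> mspace m \<Longrightarrow> mdist m x y < d \<Longrightarrow> dist (h x) (h y) < e / 2"
        using x e unfolding m.metric_continuous_map[OF Met_TC.Metric_space_axioms]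
        by (meson half_gt_zero)
      \<comment> \<open>From slope \<open>2 * H / d\<close> on, points at distance at least
        \<open>d\<close> pay a penalty no smaller than the oscillation of \<open>h\<close> and
        cannot push the infimum below \<open>h x\<close>.\<close>
      obtain N :: nat where N: "2 * H / d < real N" using reals_Archimedean2 by blast
      have "norm (g k x - h x) < e" if k: "k \<ge> N" for k
      proof -
        have "h x - e / 2 \<le> g k x"
        proof (rule g_ge[OF x])
          fix y assume y: "y \<in> mspace m"
          have nn: "0 \<le> real k * mdist m x y" by simp
          show "h x - e / 2 \<le> h y + real k * mdist m x y"
          proof (cases "mdist m x y < d")
            case True
            then show ?thesis using d(2)[OF y True] nn unfolding dist_real_def by linarith
          next
            case False
            have "2 * H \<le> real N * d" using N d(1) by (simp add: field_simps)
            also have "\<dots> \<le> real k * mdist m x y" using k False d(1) by (intro mult_mono) auto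
            finally show ?thesis using H[OF x] H[OF y] e by linarith
          qed
        qed
        then show ?thesis using g_h[OF x, of k] e by simp
      qed
      then show "\<exists>N. \<forall>k\<ge>N. norm (g k x - h x) < e" by blast
    qed
  qed
qed

text \<open>A bounded continuous \<open>h\<close> is enclosed by Lipschitz functions: from below
  directly, from above by treating \<open>- h\<close>. Their integrals under \<open>L\<close>
  converge by dominated convergence, and outer expectation is monotone, so the maps
  \<open>Z k\<close> may be nonmeasurable.\<close>

lemma converges_in_law_lipschitzI:
  fixes m :: "'a metric"
  assumes M: "prob_space M" and L: "prob_space L" "sets L = sets (borel_of_metric m)"
    and Z: "\<And>k \<omega>. \<omega> \<in> space M \<Longrightarrow> Z k \<omega> \<in> mspace m"
    and lip: "\<And>h K H. 0 \<le> K \<Longrightarrow>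
      (\<And>x y. x \<in> mspace m \<Longrightarrow> y \<in> mspace m \<Longrightarrow> \<bar>h x - h y\<bar> \<le> K * mdist m x y) \<Longrightarrow>
      (\<And>x. x \<in> mspace m \<Longrightarrow> \<bar>h x\<bar> \<le> H) \<Longrightarrow>
      (\<lambda>k. outer_expectation M (\<lambda>\<omega>. h (Z k \<omega>))) \<longlonglongrightarrow> (LINT z|L. h z)"
  shows "converges_in_law m M Z L"
  unfolding converges_in_law_def
proof (intro conjI allI impI ballI)
  interpret M: prob_space M by fact
  interpret L: prob_space L by fact
  fix h :: "'a \<Rightarrow> real"
  assume asm: "continuous_map (mtopology_of m) euclideanreal h \<and> bounded (h ` mspace m)"
  have spL: "space L = mspace m" using sets_eq_imp_space_eq[OF L(2)] by (simp add: sets_borel_of_metric)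
  obtain H where H: "\<And>x. x \<in> mspace m \<Longrightarrow> \<bar>h x\<bar> \<le> H" using asm by (auto simp: bounded_iff)
  have cont: "continuous_map (mtopology_of m) euclideanreal h"
    and cont': "continuous_map (mtopology_of m) euclideanreal (\<lambda>x. - h x)"
    using asm by (auto intro: continuous_map_minus)
  have H': "\<bar>- h x\<bar> \<le> H" if "x \<in> mspace m" for x using H[OF that] by simp
  obtain g where g: "\<And>k x y. x \<in> mspace m \<Longrightarrow> y \<in> mspace m \<Longrightarrow> \<bar>g k x - g k y\<bar> \<le> real k * mdist m x y"
    "\<And>k x. x \<in> mspace m \<Longrightarrow> \<bar>g k x\<bar> \<le> H" "\<And>k x. x \<in> mspace m \<Longrightarrow> g k x \<le> h x"
    "\<And>x. x \<in> mspace m \<Longrightarrow> (\<lambda>k. g k x) \<longlonglongrightarrow> h x"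
    by (rule lipschitz_approximation_below[OF cont H]) (assumption, rule that, assumption+)
  obtain g' where g': "\<And>k x y. x \<in> mspace m \<Longrightarrow> y \<in> mspace m \<Longrightarrow> \<bar>g' k x - g' k y\<bar> \<le> real k * mdist m x y"
    "\<And>k x. x \<in> mspace m \<Longrightarrow> \<bar>g' k x\<bar> \<le> H" "\<And>k x. x \<in> mspace m \<Longrightarrow> g' k x \<le> - h x"
    "\<And>x. x \<in> mspace m \<Longrightarrow> (\<lambda>k. g' k x) \<longlonglongrightarrow> - h x"
    by (rule lipschitz_approximation_below[OF cont' H']) (assumption, rule that, assumption+)
  have meas: "q \<in> borel_measurable L" if "continuous_map (mtopology_of m) euclideanreal q" for q
    using continuous_map_borel_of_metric[OF that] by (simp add: measurable_cong_sets[OF L(2) refl])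
  have g_meas: "g k \<in> borel_measurable L" "g' k \<in> borel_measurable L" for k
    by (rule meas, rule continuous_map_realI, erule (1) g(1) g'(1))+
  have conv: "(\<lambda>k. LINT z|L. g k z) \<longlonglongrightarrow> (LINT z|L. h z)" "(\<lambda>k. LINT z|L. - g' k z) \<longlonglongrightarrow> (LINT z|L. h z)"
  proof -
    show "(\<lambda>k. LINT z|L. g k z) \<longlonglongrightarrow> (LINT z|L. h z)"
      by (rule integral_dominated_convergence[where w = "\<lambda>_. H"]) (use g g_meas meas[OF cont] in \<open>auto simp: spL\<close>)
    have "(\<lambda>k. - g' k x) \<longlonglongrightarrow> h x" if "x \<in> mspace m" for x
      using tendsto_minus[OF g'(4)[OF that]] by simp
    then show "(\<lambda>k. LINT z|L. - g' k z) \<longlonglongrightarrow> (LINT z|L. h z)"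
      by (intro integral_dominated_convergence[where w = "\<lambda>_. H"]) (use g' g_meas meas[OF cont] in \<open>auto simp: spL\<close>)
  qed
  show "(\<lambda>k. outer_expectation M (\<lambda>\<omega>. h (Z k \<omega>))) \<longlonglongrightarrow> (LINT z|L. h z)"
  proof (rule LIMSEQ_I)
    fix e :: real assume "e > 0"
    then have e2: "e / 2 > 0" by simp
    obtain j where j: "\<bar>(LINT z|L. g j z) - (LINT z|L. h z)\<bar> < e / 2" using LIMSEQ_D[OF conv(1) e2] by auto
    obtain j' where j': "\<bar>(LINT z|L. - g' j' z) - (LINT z|L. h z)\<bar> < e / 2" using LIMSEQ_D[OF conv(2) e2] by auto
    have lo: "(\<lambda>k. outer_expectation M (\<lambda>\<omega>. g j (Z k \<omega>))) \<longlonglongrightarrow> (LINT z|L. g j z)"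
      by (rule lip[of "real j" _ H]) (use g in auto)
    have up: "(\<lambda>k. outer_expectation M (\<lambda>\<omega>. - g' j' (Z k \<omega>))) \<longlonglongrightarrow> (LINT z|L. - g' j' z)"
      by (rule lip[of "real j'" _ H]) (use g' in \<open>auto simp: abs_minus_commute\<close>)
    obtain N1 where N1: "\<And>k. k \<ge> N1 \<Longrightarrow> \<bar>outer_expectation M (\<lambda>\<omega>. g j (Z k \<omega>)) - (LINT z|L. g j z)\<bar> < e / 2"
      using LIMSEQ_D[OF lo e2] by auto
    obtain N2 where N2: "\<And>k. k \<ge> N2 \<Longrightarrow> \<bar>outer_expectation M (\<lambda>\<omega>. - g' j' (Z k \<omega>)) - (LINT z|L. - g' j' z)\<bar> < e / 2"
      using LIMSEQ_D[OF up e2] by auto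
    show "\<exists>N. \<forall>k\<ge>N. norm (outer_expectation M (\<lambda>\<omega>. h (Z k \<omega>)) - (LINT z|L. h z)) < e"
    proof (intro exI[of _ "max N1 N2"] allI impI)
      fix k assume k: "k \<ge> max N1 N2"
      have "outer_expectation M (\<lambda>\<omega>. g j (Z k \<omega>)) \<le> outer_expectation M (\<lambda>\<omega>. h (Z k \<omega>))"
        by (rule M.outer_expectation_mono[of _ H _ H]) (use g H Z in auto)
      moreover have "outer_expectation M (\<lambda>\<omega>. h (Z k \<omega>)) \<le> outer_expectation M (\<lambda>\<omega>. - g' j' (Z k \<omega>))"
      proof (rule M.outer_expectation_mono[of _ H _ H])
        show "h (Z k \<omega>) \<le> - g' j' (Z k \<omega>)" if "\<omega> \<in> space M" for \<omega>
          using g'(3)[OF Z[OF that], of j' k] by simp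
      qed (use g'(2) H Z in auto)
      ultimately show "norm (outer_expectation M (\<lambda>\<omega>. h (Z k \<omega>)) - (LINT z|L. h z)) < e"
        using N1[of k] N2[of k] k j j' unfolding real_norm_def by linarith
    qed
  qed
qed (use L Z in auto)

section \<open>The uniform central limit theorem under bracketing entropy\<close>

text \<open>The empirical process numbers the sample from 1, whereas the central limit theorem sums
  over \<open>i < n\<close>.\<close>

lemma (in prob_space) indep_vars_Suc:
  assumes "indep_vars (\<lambda>_. N) X (UNIV :: nat set)"
  shows "indep_vars (\<lambda>_. N) (\<lambda>i. X (Suc i)) UNIV"
  unfolding indep_vars_def2 indep_sets_def
proof (intro conjI ballI allI impI)
  let ?E = "\<lambda>i. {X i -` A \<inter> space M | A. A \<in> sets N}"
  have rv: "\<And>i. random_variable N (X i)" and ind: "indep_sets ?E UNIV"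
    using assms by (auto simp: indep_vars_def2)
  show "random_variable N (X (Suc i))" for i by (rule rv)
  show "{X (Suc i) -` A \<inter> space M | A. A \<in> sets N} \<subseteq> events" for i
    using measurable_sets[OF rv] by auto
  fix J :: "nat set" and A assume J: "J \<noteq> {}" "finite J" and A: "A \<in> (\<Pi> j\<in>J. {X (Suc j) -` A \<inter> space M | A. A \<in> sets N})"
  have "(\<lambda>n. A (n - 1)) n \<in> ?E n" if "n \<in> Suc ` J" for n
    using A that by (auto simp: Pi_iff)
  then have "prob (\<Inter>n\<in>Suc ` J. A (n - 1)) = (\<Prod>n\<in>Suc ` J. prob (A (n - 1)))"
    using J by (intro indep_setsD[OF ind]) auto
  then show "prob (\<Inter>j\<in>J. A j) = (\<Prod>j\<in>J. prob (A j))"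
    by (simp add: prod.reindex)
qed

context iid_sample
begin

text \<open>The one-dimensional central limit theorem read through Levy continuity. It presupposes a
  positive variance; for variance zero the process vanishes almost surely.\<close>

lemma iexp_emp_tendsto:
  assumes g: "g \<in> bounded_rv P" and mean: "(LINT t|P. g t) = 0"
  shows "(\<lambda>M. CLINT \<omega>|\<Omega>. iexp (emp M \<omega> g)) \<longlonglongrightarrow> complex_of_real (exp (- (LINT t|P. (g t)\<^sup>2) / 2))"
proof -
  have [measurable]: "g \<in> borel_measurable P" by (rule bounded_rv_measurable[OF g])
  define v where "v = (LINT t|P. (g t)\<^sup>2)"
  have "v \<ge> 0" by (simp add: v_def)
  have emp_eq: "emp M \<omega> g = (\<Sum>i<M. g (\<Theta> (Suc i) \<omega>)) / sqrt M" for M \<omega>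
  proof -
    have "(\<Sum>m=1..M. g (\<Theta> m \<omega>)) = (\<Sum>i<M. g (\<Theta> (Suc i) \<omega>))"
      using sum.atLeast_Suc_atMost_Suc_shift[of "\<lambda>m. g (\<Theta> m \<omega>)" 0 M]
      by (simp add: sum.atLeast1_atMost_eq)
    then show ?thesis using mean
      by (cases "M = 0") (simp_all add: empirical_process_def field_simps real_sqrt_mult_self)
  qed
  have int: "integrable \<Omega> (\<lambda>\<omega>. h (\<Theta> i \<omega>))" if "h \<in> bounded_rv P" for h i
    using P.bounded_rv_integrable[OF that] integrable_distr_eq[OF \<Theta>_measurable bounded_rv_measurable, of h i] that
    by (simp add: law)
  show ?thesis
  proof (cases "v = 0")
    case True
    have "AE t in P. (g t)\<^sup>2 = 0"
      using True integral_nonneg_eq_0_iff_AE[of P "\<lambda>t. (g t)\<^sup>2"] P.bounded_rv_integrable[OF bounded_rv_power2[OF g]]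
      by (simp add: v_def)
    then have "AE t in distr \<Omega> P (\<Theta> i). g t = 0" for i by (subst law) simp
    then have ae: "AE \<omega> in \<Omega>. g (\<Theta> i \<omega>) = 0" for i by (subst (asm) AE_distr_iff) auto
    have "AE \<omega> in \<Omega>. \<forall>i. g (\<Theta> i \<omega>) = 0" using ae by (subst AE_all_countable) auto
    then have "AE \<omega> in \<Omega>. iexp (emp M \<omega> g) = 1" for M by eventually_elim (simp add: emp_eq)
    then have "(CLINT \<omega>|\<Omega>. iexp (emp M \<omega> g)) = (CLINT \<omega>|\<Omega>. 1)" for M
      by (intro integral_cong_AE) auto
    then show ?thesis using True by (simp add: v_def \<Omega>.prob_space)
  next
    case False
    define s where "s = sqrt v"
    have s: "s > 0" "s\<^sup>2 = v" using False \<open>v \<ge> 0\<close> by (auto simp: s_def)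
    let ?X = "\<lambda>i \<omega>. g (\<Theta> (Suc i) \<omega>)"
    have "weak_conv_m (\<lambda>n. distr \<Omega> borel (\<lambda>\<omega>. (\<Sum>i<n. ?X i \<omega>) / sqrt (n * s\<^sup>2))) std_normal_distribution"
    proof (rule \<Omega>.central_limit_theorem_zero_mean)
      have "\<Omega>.indep_vars (\<lambda>_. P) (\<lambda>i. \<Theta> (Suc i)) UNIV"
        by (rule \<Omega>.indep_vars_Suc[OF indep])
      then show "\<Omega>.indep_vars (\<lambda>_. borel) ?X UNIV" by (rule \<Omega>.indep_vars_compose2) auto
      show "\<Omega>.expectation (?X i) = 0" for i using integral_sample[of g "Suc i"] mean by simp
      show "0 < s" by (rule s)
      show "integrable \<Omega> (\<lambda>\<omega>. (?X i \<omega>)\<^sup>2)" for i by (rule int[OF bounded_rv_power2[OF g]])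
      show "\<Omega>.variance (?X i) = s\<^sup>2" for i
        using integral_sample[of g "Suc i"] integral_sample[of "\<lambda>t. (g t)\<^sup>2" "Suc i"] mean by (simp add: s v_def)
      show "distr \<Omega> borel (?X i) = distr P borel g" for i
      proof -
        have "distr \<Omega> borel (?X i) = distr (distr \<Omega> P (\<Theta> (Suc i))) borel g"
          by (subst distr_distr) (auto simp: comp_def)
        then show ?thesis by (simp only: law)
      qed
    qed
    \<comment> \<open>Evaluation at the standard deviation \<open>s\<close> instead of at 1 undoes
      the normalization of the sums.\<close>
    then have "(\<lambda>n. char (distr \<Omega> borel (\<lambda>\<omega>. (\<Sum>i<n. ?X i \<omega>) / sqrt (n * s\<^sup>2))) s) \<longlonglongrightarrow> char std_normal_distribution s"
      by (intro levy_continuity1 \<Omega>.real_distribution_distr real_dist_normal_dist) auto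
    moreover have "char (distr \<Omega> borel (\<lambda>\<omega>. (\<Sum>i<n. ?X i \<omega>) / sqrt (n * s\<^sup>2))) s = (CLINT \<omega>|\<Omega>. iexp (emp n \<omega> g))" for n
    proof -
      have "s * ((\<Sum>i<n. ?X i \<omega>) / sqrt (n * s\<^sup>2)) = emp n \<omega> g" for \<omega>
        using s(1) by (simp add: emp_eq real_sqrt_mult)
      then show ?thesis unfolding char_def by (subst integral_distr) auto
    qed
    moreover have "char std_normal_distribution s = complex_of_real (exp (- v / 2))"
      unfolding s(2)[symmetric] by (simp only: char_std_normal_distribution)
    ultimately show ?thesis by (simp add: v_def)
  qed
qed

lemma emp_diff: "integrable P g \<Longrightarrow> integrable P g' \<Longrightarrow> emp M \<omega> (\<lambda>t. g' t - g t) = emp M \<omega> g' - emp M \<omega> g"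
  by (simp add: empirical_process_def sum_subtractf algebra_simps diff_divide_distrib)

lemma emp_sum:
  assumes "\<And>j. j \<in> J \<Longrightarrow> integrable P (e j)"
  shows "emp M \<omega> (\<lambda>t. \<Sum>j\<in>J. w j * e j t) = (\<Sum>j\<in>J. w j * emp M \<omega> (e j))"
proof -
  have "(\<Sum>m=1..M. \<Sum>j\<in>J. w j * e j (\<Theta> m \<omega>)) = (\<Sum>j\<in>J. w j * (\<Sum>m=1..M. e j (\<Theta> m \<omega>)))"
    by (subst sum.swap) (simp add: sum_distrib_left)
  moreover have "(LINT t|P. (\<Sum>j\<in>J. w j * e j t)) = (\<Sum>j\<in>J. w j * (LINT t|P. e j t))"
    using assms by (subst Bochner_Integration.integral_sum) auto
  ultimately show ?thesis
    unfolding empirical_process_def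
    by (simp add: sum_subtractf right_diff_distrib sum_distrib_left mult_ac)
qed

text \<open>Sample mean and expectation are both monotone, so their deviation at
  \<open>h - g\<close> is at most the larger of the two at \<open>g' - g\<close>. Replacing the
  sample mean there by its fluctuation leaves the deterministic term.\<close>

lemma emp_bracket_le:
  assumes \<omega>: "\<omega> \<in> space \<Omega>" and int: "integrable P g" "integrable P h" "integrable P g'"
    and le: "\<And>t. t \<in> space P \<Longrightarrow> g t \<le> h t" "\<And>t. t \<in> space P \<Longrightarrow> h t \<le> g' t"
  shows "\<bar>emp M \<omega> h - emp M \<omega> g\<bar> \<le> \<bar>emp M \<omega> (\<lambda>t. g' t - g t)\<bar> + sqrt M * (LINT t|P. g' t - g t)"
proof -
  define S where "S q = 1 / M * (\<Sum>m=1..M. q (\<Theta> m \<omega>))" for q :: "'t \<Rightarrow> real"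
  have S: "S g \<le> S h" "S h \<le> S g'"
    unfolding S_def using le \<Theta>_space[OF \<omega>] by (intro mult_left_mono sum_mono; simp)+
  have I: "(LINT t|P. g t) \<le> (LINT t|P. h t)" "(LINT t|P. h t) \<le> (LINT t|P. g' t)"
    using int le by (auto intro!: integral_mono)
  have emp: "emp M \<omega> q = sqrt M * (S q - (LINT t|P. q t))" for q
    by (simp add: empirical_process_def S_def)
  have eq: "emp M \<omega> (\<lambda>t. g' t - g t) = sqrt M * ((S g' - S g) - ((LINT t|P. g' t) - (LINT t|P. g t)))"
    using int by (simp add: emp_diff) (simp add: emp algebra_simps)
  have eq2: "emp M \<omega> h - emp M \<omega> g = sqrt M * ((S h - S g) - ((LINT t|P. h t) - (LINT t|P. g t)))"
    by (simp add: emp algebra_simps)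
  have eq3: "sqrt M * (LINT t|P. g' t - g t) = sqrt M * ((LINT t|P. g' t) - (LINT t|P. g t))"
    using int by simp
  have "\<bar>(S h - S g) - ((LINT t|P. h t) - (LINT t|P. g t))\<bar> \<le>
     \<bar>(S g' - S g) - ((LINT t|P. g' t) - (LINT t|P. g t))\<bar> + ((LINT t|P. g' t) - (LINT t|P. g t))"
    using S I by linarith
  then have "sqrt M * \<bar>(S h - S g) - ((LINT t|P. h t) - (LINT t|P. g t))\<bar> \<le>
     sqrt M * (\<bar>(S g' - S g) - ((LINT t|P. g' t) - (LINT t|P. g t))\<bar> + ((LINT t|P. g' t) - (LINT t|P. g t)))"
    by (rule mult_left_mono) simp
  then show ?thesis unfolding eq eq2 eq3 abs_mult by (simp add: distrib_left)
qed

end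

locale empirical_limit = gaussian_limit P F f l u B c e a r + iid_sample \<Omega> P \<Theta>
  for P :: "'t measure" and F :: "'i set" and f :: "'i \<Rightarrow> 't \<Rightarrow> real"
    and l u :: "nat \<Rightarrow> 'i \<Rightarrow> 't \<Rightarrow> real" and B c :: real
    and e :: "nat \<Rightarrow> 't \<Rightarrow> real" and a :: "('t \<Rightarrow> real) \<Rightarrow> nat \<Rightarrow> real" and r :: "nat \<Rightarrow> nat"
    and \<Omega> :: "'w measure" and \<Theta> :: "nat \<Rightarrow> 'w \<Rightarrow> 't"
begin

definition emp_fun :: "nat \<Rightarrow> 'w \<Rightarrow> 'i \<Rightarrow> real" where
  "emp_fun M \<omega> = (\<lambda>i\<in>F. emp M \<omega> (f i))"

lemma emp_fun_mem:
  assumes "\<omega> \<in> space \<Omega>"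
  shows "emp_fun M \<omega> \<in> mspace (linf F)"
proof -
  have "\<bar>emp M \<omega> (f i)\<bar> \<le> sqrt M * (B + B)" if i: "i \<in> F" for i
  proof -
    have B0: "0 \<le> B" using B by simp
    have "\<bar>\<Sum>m=1..M. f i (\<Theta> m \<omega>)\<bar> \<le> (\<Sum>m=1..M. B)"
      by (rule order_trans[OF sum_abs sum_mono]) (rule f_bound[OF i \<Theta>_space[OF assms]])
    then have "\<bar>1 / M * (\<Sum>m=1..M. f i (\<Theta> m \<omega>))\<bar> \<le> B"
      using B0 by (cases "M = 0") (simp_all add: abs_mult field_simps)
    moreover have "\<bar>LINT t|P. f i t\<bar> \<le> B"
    proof -
      have "\<bar>LINT t|P. f i t\<bar> \<le> (LINT t|P. \<bar>f i t\<bar>)" by (rule integral_abs_bound)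
      also have "\<dots> \<le> (LINT t|P. B)"
        using bounded_rv_integrable[OF bounded_rv_f[OF i]] f_bound[OF i] by (intro integral_mono) auto
      finally show ?thesis by (simp add: prob_space)
    qed
    ultimately have "\<bar>1 / M * (\<Sum>m=1..M. f i (\<Theta> m \<omega>)) - (LINT t|P. f i t)\<bar> \<le> B + B" by linarith
    then show ?thesis unfolding empirical_process_def abs_mult by (intro mult_mono) auto
  qed
  then have "\<exists>b. \<forall>i\<in>F. \<bar>emp_fun M \<omega> i\<bar> \<le> b" by (auto simp: emp_fun_def)
  then show ?thesis unfolding mspace_linf_iff by (simp add: emp_fun_def)
qed

text \<open>The empirical process is linear and vanishes on constants, so the expansion of the
  centered lower function passes to it.\<close>

lemma embed_emp: "i \<in> F \<Longrightarrow> embed k (\<lambda>j. emp M \<omega> (e j)) i = emp M \<omega> (l k i)"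
proof -
  assume i: "i \<in> F"
  have eq: "(\<lambda>t. l k i t - (LINT u|P. l k i u)) = (\<lambda>t. \<Sum>j<r k. a (l k i) j * e j t)"
    by (rule ext) (rule e_expansion[OF lowersI[OF i]])
  have "emp M \<omega> (\<lambda>t. l k i t - (LINT u|P. l k i u)) = emp M \<omega> (l k i) - emp M \<omega> (\<lambda>_. LINT u|P. l k i u)"
    by (intro emp_diff bounded_rv_integrable bounded_rv_l bounded_rv_const i)
  also have "emp M \<omega> (\<lambda>_. LINT u|P. l k i u) = 0"
    by (cases "M = 0") (simp_all add: empirical_process_def prob_space)
  finally have "emp M \<omega> (l k i) = (\<Sum>j<r k. a (l k i) j * emp M \<omega> (e j))"
    unfolding eq by (subst (asm) emp_sum) (auto intro: bounded_rv_integrable e_bounded)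
  then show ?thesis using i by (simp add: embed_def)
qed

text \<open>The terms account for the links between levels \<open>k\<close> and \<open>K\<close>,
  the fluctuation of the last bracket, and its mean. The sum is free of the index \<open>i\<close>
  and integrable for suitable \<open>M\<close>, although the supremum it bounds may fail to be
  measurable.\<close>

definition remainder :: "nat \<Rightarrow> nat \<Rightarrow> nat \<Rightarrow> 'w \<Rightarrow> real" where
  "remainder M K k \<omega> = (\<Sum>j=k..<K. soft_max (scale j) (links j) (\<lambda>(g, g'). emp M \<omega> (\<lambda>t. g' t - g t))) +
     soft_max (scale K) (brackets K) (\<lambda>(g, g'). emp M \<omega> (\<lambda>t. g' t - g t)) + sqrt M / 64 ^ K"

text \<open>
  Chaining: the links are followed as long as the sample size \<open>M\<close> is large enough for the
  exponential inequality, and the last approximation error is controlled by its bracket.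
\<close>

lemma chaining:
  assumes \<omega>: "\<omega> \<in> space \<Omega>" and i: "i \<in> F" and k: "k \<le> K"
  shows "\<bar>emp M \<omega> (f i) - emp M \<omega> (l k i)\<bar> \<le> remainder M K k \<omega>"
proof -
  have int: "integrable P (l k i)" "integrable P (u k i)" "integrable P (f i)" for k
    by (intro bounded_rv_integrable bounded_rv_brackets i)+
  have "emp M \<omega> (l K i) - emp M \<omega> (l k i) = (\<Sum>j=k..<K. emp M \<omega> (l (Suc j) i) - emp M \<omega> (l j i))"
    using sum_Suc_diff'[OF k, of "\<lambda>j. emp M \<omega> (l j i)"] by simp
  also have "\<bar>\<dots>\<bar> \<le> (\<Sum>j=k..<K. soft_max (scale j) (links j) (\<lambda>(g, g'). emp M \<omega> (\<lambda>t. g' t - g t)))"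
  proof (rule order_trans[OF sum_abs sum_mono])
    fix j
    show "\<bar>emp M \<omega> (l (Suc j) i) - emp M \<omega> (l j i)\<bar> \<le>
        soft_max (scale j) (links j) (\<lambda>(g, g'). emp M \<omega> (\<lambda>t. g' t - g t))"
      using abs_le_soft_max[OF finite_links, of "(l j i, l (Suc j) i)" j "scale j" "\<lambda>(g, g'). emp M \<omega> (\<lambda>t. g' t - g t)"]
        scale_pos i by (simp add: emp_diff int)
  qed
  finally have 1: "\<bar>emp M \<omega> (l K i) - emp M \<omega> (l k i)\<bar> \<le>
      (\<Sum>j=k..<K. soft_max (scale j) (links j) (\<lambda>(g, g'). emp M \<omega> (\<lambda>t. g' t - g t)))" .
  have "\<bar>emp M \<omega> (f i) - emp M \<omega> (l K i)\<bar> \<le>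
      \<bar>emp M \<omega> (\<lambda>t. u K i t - l K i t)\<bar> + sqrt M * (LINT t|P. u K i t - l K i t)"
    by (rule emp_bracket_le[OF \<omega>]) (use int l_le_f[OF i] f_le_u[OF i] in auto)
  also have "\<bar>emp M \<omega> (\<lambda>t. u K i t - l K i t)\<bar> \<le>
      soft_max (scale K) (brackets K) (\<lambda>(g, g'). emp M \<omega> (\<lambda>t. g' t - g t))"
    using abs_le_soft_max[OF finite_brackets, of "(l K i, u K i)" K "scale K" "\<lambda>(g, g'). emp M \<omega> (\<lambda>t. g' t - g t)"]
      scale_pos i by simp
  also have "sqrt M * (LINT t|P. u K i t - l K i t) \<le> sqrt M * (1 / 64 ^ K)"
    by (intro mult_left_mono bracket_size i) simp
  finally show ?thesis using 1 unfolding remainder_def by (simp add: abs_le_iff)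
qed

text \<open>The exponential inequality asks for \<open>2 * (2 * B) \<le> sqrt M * scale j\<close>,
  which by the choice of \<open>scale\<close> is the condition
  \<open>64 ^ j \<le> M\<close>.\<close>

lemma exp_emp_pair:
  assumes M: "64 ^ j \<le> M" "M > 0"
    and bd: "(\<lambda>t. g' t - g t) \<in> bounded_rv P" "\<And>t. t \<in> space P \<Longrightarrow> \<bar>g' t - g t\<bar> \<le> 2 * B"
    and var: "(LINT t|P. (g' t - g t)\<^sup>2) \<le> (scale j)\<^sup>2"
  shows "integrable \<Omega> (\<lambda>\<omega>. exp (\<bar>emp M \<omega> (\<lambda>t. g' t - g t)\<bar> / scale j)) \<and>
    (LINT \<omega>|\<Omega>. exp (\<bar>emp M \<omega> (\<lambda>t. g' t - g t)\<bar> / scale j)) \<le> 2 * exp 1"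
proof -
  have "(8 :: real) ^ j = sqrt (64 ^ j)"
    by (rule real_sqrt_unique[symmetric]) (simp_all add: power2_eq_square power_mult_distrib[symmetric])
  also have "\<dots> \<le> sqrt M"
    using of_nat_mono[OF M(1), where 'a = real] by simp
  finally have "2 * (2 * B) * 8 ^ j \<le> 4 * B * sqrt M" using B by simp
  then have "2 * (2 * B) \<le> sqrt M * scale j" by (simp add: scale_def field_simps)
  from integrable_exp_emp[OF bounded_rv_measurable[OF bd(1)] bd(2) var scale_pos this M(2)]
    integral_exp_emp_le[OF bounded_rv_measurable[OF bd(1)] bd(2) var scale_pos this M(2)]
  show ?thesis by simp
qed

lemma
  assumes D: "finite D" "D \<noteq> {}" "real (card D) \<le> exp (3 * c * (real j + 1))"
    and bd: "\<And>g g'. (g, g') \<in> D \<Longrightarrow> (\<lambda>t. g' t - g t) \<in> bounded_rv P"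
    and b: "\<And>g g' t. (g, g') \<in> D \<Longrightarrow> t \<in> space P \<Longrightarrow> \<bar>g' t - g t\<bar> \<le> 2 * B"
    and var: "\<And>g g'. (g, g') \<in> D \<Longrightarrow> (LINT t|P. (g' t - g t)\<^sup>2) \<le> (scale j)\<^sup>2"
    and M: "64 ^ j \<le> M" "M > 0"
  shows integrable_soft_max_emp:
      "integrable \<Omega> (\<lambda>\<omega>. soft_max (scale j) D (\<lambda>(g, g'). emp M \<omega> (\<lambda>t. g' t - g t)))"
    and integral_soft_max_emp_le:
      "(LINT \<omega>|\<Omega>. soft_max (scale j) D (\<lambda>(g, g'). emp M \<omega> (\<lambda>t. g' t - g t))) \<le> link_const / 4 ^ j"
proof -
  have *: "integrable \<Omega> (\<lambda>\<omega>. exp (\<bar>(\<lambda>(g, g'). emp M \<omega> (\<lambda>t. g' t - g t)) d\<bar> / scale j)) \<and>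
    (LINT \<omega>|\<Omega>. exp (\<bar>(\<lambda>(g, g'). emp M \<omega> (\<lambda>t. g' t - g t)) d\<bar> / scale j)) \<le> 2 * exp 1"
    if d: "d \<in> D" for d
  proof -
    obtain g g' where gg: "d = (g, g')" by (cases d)
    then have d': "(g, g') \<in> D" using d by simp
    show ?thesis unfolding gg prod.case
      by (rule exp_emp_pair[OF M bd[OF d'] b[OF d'] var[OF d']])
  qed
  show "integrable \<Omega> (\<lambda>\<omega>. soft_max (scale j) D (\<lambda>(g, g'). emp M \<omega> (\<lambda>t. g' t - g t)))"
    by (rule integrable_soft_max[OF D(1,2) scale_pos _ _ \<Omega>.prob_space_axioms, where b = "2 * exp 1"]) (use * in blast)+
  have "(LINT \<omega>|\<Omega>. soft_max (scale j) D (\<lambda>(g, g'). emp M \<omega> (\<lambda>t. g' t - g t))) \<le>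
      scale j * (ln (card D) + 2 * exp 1)"
    by (rule integral_soft_max_le[OF D(1,2) scale_pos _ _ \<Omega>.prob_space_axioms]) (use * in blast)+
  also have "\<dots> \<le> link_const / 4 ^ j"
    by (rule scale_entropy_bound[OF D(3)]) (use D in \<open>simp add: card_gt_0_iff\<close>)
  finally show "(LINT \<omega>|\<Omega>. soft_max (scale j) D (\<lambda>(g, g'). emp M \<omega> (\<lambda>t. g' t - g t))) \<le> link_const / 4 ^ j" .
qed

text \<open>\<open>K\<close> is the finest level at which the exponential inequality is available.
  The links then sum geometrically, and maximality of \<open>K\<close> bounds
  \<open>sqrt M / 64 ^ K\<close> by \<open>64 / sqrt M\<close>, which tends to 0.\<close>

lemma
  assumes M: "64 ^ K \<le> M" "M < 64 ^ Suc K" and k: "k \<le> K"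
  shows integrable_remainder: "integrable \<Omega> (remainder M K k)"
    and integral_remainder_le: "(LINT \<omega>|\<Omega>. remainder M K k \<omega>) \<le> 3 * link_const / 4 ^ k + 64 / sqrt M"
proof -
  have M0: "M > 0" using M(1) by (rule less_le_trans[rotated]) simp
  have M': "64 ^ j \<le> M" if "j \<le> K" for j
    by (rule order_trans[OF power_increasing M(1)]) (use that in auto)
  have "c * (real K + 1) \<le> 3 * c * (real K + 1)" using c by (simp add: mult_right_mono)
  then have card: "real (card (brackets K)) \<le> exp (3 * c * (real K + 1))"
    using card_brackets[of K] by (meson exp_le_cancel_iff order_trans)
  have ne: "brackets K \<noteq> {}" using F_ne by simp
  define V where "V j \<omega> = soft_max (scale j) (links j) (\<lambda>(g, g'). emp M \<omega> (\<lambda>t. g' t - g t))" for j \<omega>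
  define V' where "V' \<omega> = soft_max (scale K) (brackets K) (\<lambda>(g, g'). emp M \<omega> (\<lambda>t. g' t - g t))" for \<omega>
  have V: "integrable \<Omega> (V j)" "(LINT \<omega>|\<Omega>. V j \<omega>) \<le> link_const / 4 ^ j" if "j \<le> K" for j
    unfolding V_def
    by (rule integrable_soft_max_emp[OF finite_links links_ne card_links_le _ _ _ M'[OF that] M0],
        erule link_function(1), erule (1) link_function(2), erule link_function(3))
       (rule integral_soft_max_emp_le[OF finite_links links_ne card_links_le _ _ _ M'[OF that] M0],
        erule link_function(1), erule (1) link_function(2), erule link_function(3))
  have V': "integrable \<Omega> V'" "(LINT \<omega>|\<Omega>. V' \<omega>) \<le> link_const / 4 ^ K"
    unfolding V'_def
    by (rule integrable_soft_max_emp[OF finite_brackets ne card _ _ _ M(1) M0],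
        erule bracket_function(1), erule (1) bracket_function(2), erule bracket_function(3))
       (rule integral_soft_max_emp_le[OF finite_brackets ne card _ _ _ M(1) M0],
        erule bracket_function(1), erule (1) bracket_function(2), erule bracket_function(3))
  have sumV: "integrable \<Omega> (\<lambda>\<omega>. \<Sum>j=k..<K. V j \<omega>)"
    by (rule Bochner_Integration.integrable_sum) (simp add: V)
  have rem: "remainder M K k = (\<lambda>\<omega>. (\<Sum>j=k..<K. V j \<omega>) + V' \<omega> + sqrt M / 64 ^ K)"
    by (simp add: fun_eq_iff remainder_def V_def V'_def)
  show "integrable \<Omega> (remainder M K k)"
    unfolding rem using sumV V' by simp
  have "(LINT \<omega>|\<Omega>. remainder M K k \<omega>) = (LINT \<omega>|\<Omega>. (\<Sum>j=k..<K. V j \<omega>)) + (LINT \<omega>|\<Omega>. V' \<omega>) + sqrt M / 64 ^ K"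
    unfolding rem using sumV V' by (simp add: \<Omega>.prob_space)
  also have "(LINT \<omega>|\<Omega>. (\<Sum>j=k..<K. V j \<omega>)) = (\<Sum>j=k..<K. LINT \<omega>|\<Omega>. V j \<omega>)"
    by (rule Bochner_Integration.integral_sum) (simp add: V)
  also have "(\<Sum>j=k..<K. LINT \<omega>|\<Omega>. V j \<omega>) + (LINT \<omega>|\<Omega>. V' \<omega>) + sqrt M / 64 ^ K \<le>
      (\<Sum>j=k..<K. link_const / 4 ^ j) + link_const / 4 ^ K + sqrt M / 64 ^ K"
    using V V' by (intro add_mono sum_mono) auto
  \<comment> \<open>The subtracted tail makes the induction close: each step needs only
    \<open>q \<le> 2 * q - q / 2\<close>.\<close>
  also have "(\<Sum>j=k..<K. link_const / 4 ^ j) \<le> 2 * link_const / 4 ^ k - 2 * link_const / 4 ^ K"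
    using k
  proof (induction K rule: dec_induct)
    case (step n)
    define q where "q = link_const / 4 ^ n"
    have "2 * link_const / 4 ^ Suc n = q / 2" "2 * link_const / 4 ^ n = 2 * q" by (simp_all add: q_def)
    moreover have "0 \<le> q" using link_const_nonneg by (simp add: q_def)
    moreover have "(\<Sum>j=k..<Suc n. link_const / 4 ^ j) = (\<Sum>j=k..<n. link_const / 4 ^ j) + q"
      using step(1) by (simp add: q_def)
    ultimately show ?case using step(3) by linarith
  qed simp
  also have "sqrt M / 64 ^ K \<le> 64 / sqrt M"
  proof -
    have "real M \<le> 64 * 64 ^ K" using of_nat_mono[OF less_imp_le[OF M(2)], where 'a = real] by simp
    then have "sqrt M * sqrt M \<le> 64 * 64 ^ K" by simp
    then show ?thesis using M0 by (simp add: field_simps)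
  qed
  finally have "(LINT \<omega>|\<Omega>. remainder M K k \<omega>) \<le>
      2 * link_const / 4 ^ k - 2 * link_const / 4 ^ K + link_const / 4 ^ K + 64 / sqrt M" by simp
  also have "\<dots> \<le> 3 * link_const / 4 ^ k + 64 / sqrt M"
  proof -
    have "3 * link_const / 4 ^ k = 2 * link_const / 4 ^ k + link_const / 4 ^ k" by (simp add: add_divide_distrib[symmetric])
    moreover have "2 * link_const / 4 ^ K = 2 * (link_const / 4 ^ K)" by simp
    moreover have "0 \<le> link_const / 4 ^ k" "0 \<le> link_const / 4 ^ K" using link_const_nonneg by simp_all
    ultimately show ?thesis by linarith
  qed
  finally show "(LINT \<omega>|\<Omega>. remainder M K k \<omega>) \<le> 3 * link_const / 4 ^ k + 64 / sqrt M" .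
qed

section \<open>Convergence in law of the empirical process\<close>

lemma measurable_comp_embed:
  assumes h: "\<And>x y. x \<in> mspace (linf F) \<Longrightarrow> y \<in> mspace (linf F) \<Longrightarrow> \<bar>h x - h y\<bar> \<le> K * mdist (linf F) x y"
    and X: "\<And>j. (\<lambda>\<omega>. X \<omega> j) \<in> borel_measurable N"
  shows "(\<lambda>\<omega>. h (embed k (X \<omega>))) \<in> borel_measurable N"
proof -
  have "continuous_map euclidean euclideanreal (h \<circ> embed k)"
    by (rule continuous_map_compose[OF embed_continuous continuous_map_realI]) (rule h)
  then have 1: "(\<lambda>x. h (embed k x)) \<in> borel_measurable borel"
    by (intro borel_measurable_continuous_onI) (simp add: o_def)
  have "X \<in> borel_measurable N" by (rule measurable_coordinatewise_then_product) (rule X)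
  from measurable_compose[OF this 1] show ?thesis .
qed

text \<open>The Cramer-Wold idea: a combination of the values at the \<open>e j\<close> is the
  empirical process at one bounded centered function. By orthogonality its variance is that of the
  combination of independent normal variables.\<close>

lemma emp_limit_finite_dim:
  assumes h: "\<And>x y. x \<in> mspace (linf F) \<Longrightarrow> y \<in> mspace (linf F) \<Longrightarrow> \<bar>h x - h y\<bar> \<le> K * mdist (linf F) x y"
    and K: "0 \<le> K" and H: "\<And>x. x \<in> mspace (linf F) \<Longrightarrow> \<bar>h x\<bar> \<le> H"
  shows "(\<lambda>M. LINT \<omega>|\<Omega>. h (embed k (\<lambda>j. emp M \<omega> (e j)))) \<longlonglongrightarrow> (LINT y|gauss_seq. h (embed k (\<lambda>j. \<sigma> j * y j)))"
proof (rule tendsto_expectation_lipschitz[where r = "r k" and \<phi> = "\<lambda>x. h (embed k x)"])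
  show "prob_space \<Omega>" by (rule \<Omega>.prob_space_axioms)
  show "prob_space gauss_seq" by (rule prob_space_gauss_seq)
  show "(\<lambda>\<omega>. emp M \<omega> (e j)) \<in> borel_measurable \<Omega>" for M j
    by (rule emp_measurable[OF bounded_rv_measurable[OF e_bounded]])
  show "(\<lambda>y. \<sigma> j * y j) \<in> borel_measurable gauss_seq" for j by measurable
  show "(\<lambda>x. h (embed k x)) \<in> borel_measurable borel"
    by (rule measurable_comp_embed[OF h measurable_coordinate])
  show "\<bar>h (embed k x)\<bar> \<le> H" for x by (rule H[OF embed_mem])
  show "0 \<le> K * embed_norm k" using K embed_norm_nonneg by simp
  show "\<bar>h (embed k x) - h (embed k y)\<bar> \<le> K * embed_norm k * (\<Sum>i<r k. \<bar>x i - y i\<bar>)" for x y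
    using order_trans[OF h[OF embed_mem embed_mem] mult_left_mono[OF mdist_embed_le K]] by (simp add: mult.assoc)
  fix w :: "nat \<Rightarrow> real"
  define g where "g t = (\<Sum>j<r k. w j * e j t)" for t
  have g: "g \<in> bounded_rv P"
    unfolding g_def by (intro bounded_rv_sum bounded_rv_mult bounded_rv_const e_bounded)
  have int: "integrable P (e j)" for j by (rule bounded_rv_integrable[OF e_bounded])
  have mean: "(LINT t|P. g t) = 0"
    unfolding g_def by (subst Bochner_Integration.integral_sum) (simp_all add: int e_mean)
  have var: "(LINT t|P. (g t)\<^sup>2) = (\<Sum>j<r k. (w j * \<sigma> j)\<^sup>2)"
    using integral_orthogonal_sum_square[of e w "r k"] e_bounded e_orthogonal
    by (simp add: g_def power_mult_distrib \<sigma>_sq)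
  have emp: "emp M \<omega> g = (\<Sum>j<r k. w j * emp M \<omega> (e j))" for M \<omega>
    unfolding g_def by (rule emp_sum) (rule int)
  have "(CLINT y|gauss_seq. iexp (\<Sum>j<r k. w j * (\<sigma> j * y j))) = complex_of_real (exp (- (LINT t|P. (g t)\<^sup>2) / 2))"
    using char_gauss_seq_sum[of "\<lambda>j. w j * \<sigma> j" "r k" 1] unfolding char_def var
    by (simp add: integral_distr mult.assoc)
  then show "(\<lambda>M. CLINT \<omega>|\<Omega>. iexp (\<Sum>j<r k. w j * emp M \<omega> (e j))) \<longlonglongrightarrow>
      (CLINT y|gauss_seq. iexp (\<Sum>j<r k. w j * (\<sigma> j * y j)))"
    using iexp_emp_tendsto[OF g mean] by (simp only: emp)
qed

lemma embed_limit_tendsto: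
  assumes h: "\<And>x y. x \<in> mspace (linf F) \<Longrightarrow> y \<in> mspace (linf F) \<Longrightarrow> \<bar>h x - h y\<bar> \<le> K * mdist (linf F) x y"
    and K: "0 \<le> K" and H: "\<And>x. x \<in> mspace (linf F) \<Longrightarrow> \<bar>h x\<bar> \<le> H"
  shows "(\<lambda>k. LINT y|gauss_seq. h (embed k (\<lambda>j. \<sigma> j * y j))) \<longlonglongrightarrow> (LINT z|limit_law. h z)"
proof -
  interpret G: prob_space gauss_seq by (rule prob_space_gauss_seq)
  interpret L: Metric_space "mspace (linf F)" "mdist (linf F)" by (rule Metric_space_mspace_mdist)
  have cont: "continuous_map (mtopology_of (linf F)) euclideanreal h" by (rule continuous_map_realI) (rule h)
  have h_meas: "h \<in> borel_measurable (borel_of_metric (linf F))" by (rule continuous_map_borel_of_metric[OF cont])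
  have "(LINT z|limit_law. h z) = (LINT y|gauss_seq. h (limit_process y))"
    unfolding limit_law_def by (rule integral_distr[OF limit_process_measurable h_meas])
  moreover have "(\<lambda>k. LINT y|gauss_seq. h (embed k (\<lambda>j. \<sigma> j * y j))) \<longlonglongrightarrow> (LINT y|gauss_seq. h (limit_process y))"
  proof (rule integral_dominated_convergence[where w = "\<lambda>_. H"])
    show "(\<lambda>y. h (limit_process y)) \<in> borel_measurable gauss_seq"
      by (rule measurable_compose[OF limit_process_measurable h_meas])
    show "(\<lambda>y. h (embed k (\<lambda>j. \<sigma> j * y j))) \<in> borel_measurable gauss_seq" for k
      by (rule measurable_comp_embed[OF h]) measurable
    show "AE y in gauss_seq. (\<lambda>k. h (embed k (\<lambda>j. \<sigma> j * y j))) \<longlonglongrightarrow> h (limit_process y)"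
      using AE_full
    proof eventually_elim
      case (elim y)
      then obtain R :: nat where R: "y \<in> good (real R)" by auto
      have "(\<lambda>k. K * (2 * real R) * (1 / 2) ^ k) \<longlonglongrightarrow> 0"
        by (intro tendsto_mult_right_zero LIMSEQ_power_zero) simp
      then have "(\<lambda>k. h (embed k (\<lambda>j. \<sigma> j * y j)) - h (limit_process y)) \<longlonglongrightarrow> 0"
      proof (rule Lim_null_comparison[OF always_eventually[OF allI], rotated])
        fix k
        have "\<bar>h (embed k (\<lambda>j. \<sigma> j * y j)) - h (limit_process y)\<bar> \<le>
            K * mdist (linf F) (embed k (\<lambda>j. \<sigma> j * y j)) (limit_process y)"
          by (rule h[OF embed_mem limit_process_mem])
        also have "\<dots> \<le> K * (2 * real R / 2 ^ k)"
          using mdist_limit_process_embed[OF R, of k] by (intro mult_left_mono K) (simp add: L.commute)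
        finally show "norm (h (embed k (\<lambda>j. \<sigma> j * y j)) - h (limit_process y)) \<le> K * (2 * real R) * (1 / 2) ^ k"
          by (simp add: power_one_over)
      qed
      then show ?case by (rule LIM_zero_cancel)
    qed
    show "AE y in gauss_seq. norm (h (embed k (\<lambda>j. \<sigma> j * y j))) \<le> H" for k
      using H[OF embed_mem] by simp
  qed simp
  ultimately show ?thesis by simp
qed

text \<open>The remainder is an integrable majorant of the distance to the finite-dimensional
  approximation. It encloses \<open>h (emp_fun M \<omega>)\<close> between two integrable functions,
  which bounds the outer expectation from both sides.\<close>

lemma outer_expectation_emp_close:
  assumes h: "\<And>x y. x \<in> mspace (linf F) \<Longrightarrow> y \<in> mspace (linf F) \<Longrightarrow> \<bar>h x - h y\<bar> \<le> C * mdist (linf F) x y"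
    and C: "0 \<le> C" and H: "\<And>x. x \<in> mspace (linf F) \<Longrightarrow> \<bar>h x\<bar> \<le> H"
    and M: "64 ^ k \<le> M"
  shows "\<bar>outer_expectation \<Omega> (\<lambda>\<omega>. h (emp_fun M \<omega>)) - (LINT \<omega>|\<Omega>. h (embed k (\<lambda>j. emp M \<omega> (e j))))\<bar>
    \<le> C * (3 * link_const / 4 ^ k + 64 / sqrt M)"
proof -
  have M1: "1 \<le> M" using M by (rule order_trans[rotated]) simp
  obtain K where K: "64 ^ K \<le> M" "M < 64 ^ (K + 1)" using ex_power_ivl1[of 64 M] M1 by auto
  have kK: "k \<le> K"
  proof (rule ccontr)
    assume "\<not> k \<le> K"
    then have "(64 :: nat) ^ (K + 1) \<le> 64 ^ k" by (intro power_increasing) auto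
    then show False using K M by linarith
  qed
  have K': "64 ^ K \<le> M" "M < 64 ^ Suc K" using K by simp_all
  let ?h = "\<lambda>\<omega>. h (embed k (\<lambda>j. emp M \<omega> (e j)))"
  have "?h \<in> borel_measurable \<Omega>"
    by (rule measurable_comp_embed[OF h emp_measurable[OF bounded_rv_measurable[OF e_bounded]]])
  then have int_h: "integrable \<Omega> ?h"
    by (rule \<Omega>.integrable_const_bound[rotated]) (use H[OF embed_mem] in auto)
  note int_r = integrable_remainder[OF K' kK]
  have close: "\<bar>h (emp_fun M \<omega>) - ?h \<omega>\<bar> \<le> C * remainder M K k \<omega>" if \<omega>: "\<omega> \<in> space \<Omega>" for \<omega>
  proof -
    have "\<bar>h (emp_fun M \<omega>) - ?h \<omega>\<bar> \<le> C * mdist (linf F) (emp_fun M \<omega>) (embed k (\<lambda>j. emp M \<omega> (e j)))"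
      by (rule h[OF emp_fun_mem[OF \<omega>] embed_mem])
    also have "\<dots> \<le> C * remainder M K k \<omega>"
    proof (rule mult_left_mono[OF _ C])
      show "mdist (linf F) (emp_fun M \<omega>) (embed k (\<lambda>j. emp M \<omega> (e j))) \<le> remainder M K k \<omega>"
        unfolding mdist_linf_le[OF emp_fun_mem[OF \<omega>] embed_mem F_ne]
        using chaining[OF \<omega> _ kK] by (simp add: embed_emp) (simp add: emp_fun_def)
    qed
    finally show ?thesis .
  qed
  have bd: "\<And>\<omega>. \<omega> \<in> space \<Omega> \<Longrightarrow> \<bar>h (emp_fun M \<omega>)\<bar> \<le> H" by (rule H[OF emp_fun_mem])
  have "outer_expectation \<Omega> (\<lambda>\<omega>. h (emp_fun M \<omega>)) \<le> (LINT \<omega>|\<Omega>. ?h \<omega> + C * remainder M K k \<omega>)"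
    by (rule \<Omega>.outer_expectation_le[OF bd]) (use close int_h int_r in \<open>force simp: abs_le_iff\<close>)+
  moreover have "(LINT \<omega>|\<Omega>. ?h \<omega> - C * remainder M K k \<omega>) \<le> outer_expectation \<Omega> (\<lambda>\<omega>. h (emp_fun M \<omega>))"
    by (rule \<Omega>.outer_expectation_ge[OF bd]) (use close int_h int_r in \<open>force simp: abs_le_iff\<close>)+
  moreover have "C * (LINT \<omega>|\<Omega>. remainder M K k \<omega>) \<le> C * (3 * link_const / 4 ^ k + 64 / sqrt M)"
    by (rule mult_left_mono[OF integral_remainder_le[OF K' kK] C])
  ultimately show ?thesis using int_h int_r by (simp add: abs_le_iff)
qed

text \<open>The level \<open>k\<close> is fixed first; it makes the Gaussian error small, and the
  chaining error up to \<open>64 / sqrt M\<close>, uniformly in large \<open>M\<close>. Only then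
  does \<open>M\<close> grow, at that fixed level.\<close>

theorem donsker: "converges_in_law (linf F) \<Omega> emp_fun limit_law"
proof (rule converges_in_law_lipschitzI[OF \<Omega>.prob_space_axioms prob_space_limit_law sets_limit_law emp_fun_mem])
  fix h :: "('i \<Rightarrow> real) \<Rightarrow> real" and C H :: real
  assume C: "0 \<le> C"
    and h: "\<And>x y. x \<in> mspace (linf F) \<Longrightarrow> y \<in> mspace (linf F) \<Longrightarrow> \<bar>h x - h y\<bar> \<le> C * mdist (linf F) x y"
    and H: "\<And>x. x \<in> mspace (linf F) \<Longrightarrow> \<bar>h x\<bar> \<le> H"
  let ?E = "\<lambda>k M. LINT \<omega>|\<Omega>. h (embed k (\<lambda>j. emp M \<omega> (e j)))"
  let ?G = "\<lambda>k. LINT y|gauss_seq. h (embed k (\<lambda>j. \<sigma> j * y j))"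
  show "(\<lambda>M. outer_expectation \<Omega> (\<lambda>\<omega>. h (emp_fun M \<omega>))) \<longlonglongrightarrow> (LINT z|limit_law. h z)"
  proof (rule LIMSEQ_I)
    fix \<epsilon> :: real assume "\<epsilon> > 0"
    then have \<epsilon>4: "\<epsilon> / 4 > 0" by simp
    have "(\<lambda>k. C * (3 * link_const) * (1 / 4) ^ k) \<longlonglongrightarrow> 0"
      by (intro tendsto_mult_right_zero LIMSEQ_power_zero) simp
    then have "\<forall>\<^sub>F k in sequentially. C * (3 * link_const) * (1 / 4) ^ k < \<epsilon> / 4"
      using \<epsilon>4 by (rule order_tendstoD(2))
    moreover have "\<forall>\<^sub>F k in sequentially. \<bar>?G k - (LINT z|limit_law. h z)\<bar> < \<epsilon> / 4"
      using tendstoD[OF embed_limit_tendsto[OF h C H] \<epsilon>4] by (simp add: dist_real_def)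
    ultimately have "\<forall>\<^sub>F k in sequentially. C * (3 * link_const) * (1 / 4) ^ k < \<epsilon> / 4 \<and> \<bar>?G k - (LINT z|limit_law. h z)\<bar> < \<epsilon> / 4"
      by (rule eventually_conj)
    then obtain k where k: "C * (3 * link_const) * (1 / 4) ^ k < \<epsilon> / 4" "\<bar>?G k - (LINT z|limit_law. h z)\<bar> < \<epsilon> / 4"
      unfolding eventually_sequentially by blast
    have "\<forall>\<^sub>F M in sequentially. \<bar>?E k M - ?G k\<bar> < \<epsilon> / 4"
      using tendstoD[OF emp_limit_finite_dim[OF h C H] \<epsilon>4] by (simp add: dist_real_def)
    moreover have "\<forall>\<^sub>F M in sequentially. C * 64 * inverse (sqrt (real M)) < \<epsilon> / 4"
    proof -
      have "(\<lambda>M. C * 64 * inverse (sqrt (real M))) \<longlonglongrightarrow> 0"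
        by (intro tendsto_mult_right_zero tendsto_inverse_0_at_top filterlim_compose[OF sqrt_at_top filterlim_real_sequentially])
      then show ?thesis using \<epsilon>4 by (rule order_tendstoD(2))
    qed
    moreover have "\<forall>\<^sub>F M in sequentially. 64 ^ k \<le> M" by (rule eventually_ge_at_top)
    ultimately have "\<forall>\<^sub>F M in sequentially. norm (outer_expectation \<Omega> (\<lambda>\<omega>. h (emp_fun M \<omega>)) - (LINT z|limit_law. h z)) < \<epsilon>"
    proof eventually_elim
      case (elim M)
      have "C * (3 * link_const / 4 ^ k + 64 / sqrt M) = C * (3 * link_const) * (1 / 4) ^ k + C * 64 * inverse (sqrt M)"
        by (simp add: power_one_over field_simps)
      then show ?case
        using elim k outer_expectation_emp_close[OF h C H elim(3)] unfolding real_norm_def by linarith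
    qed
    then show "\<exists>N. \<forall>M\<ge>N. norm (outer_expectation \<Omega> (\<lambda>\<omega>. h (emp_fun M \<omega>)) - (LINT z|limit_law. h z)) < \<epsilon>"
      by (simp add: eventually_sequentially)
  qed
qed

end

section \<open>Brackets for monotone families of events\<close>

text \<open>If \<open>J\<close> has no largest element, a countable dense subset is cofinal: between
  a point and a larger one, density places a point above the first. Running maxima of an enumeration
  make the sequence increasing.\<close>

lemma ex_cofinal_sequence:
  fixes J :: "real set"
  assumes "J \<noteq> {}"
  obtains s :: "nat \<Rightarrow> real" where "incseq s" "range s \<subseteq> J" "\<And>t. t \<in> J \<Longrightarrow> \<exists>n. t \<le> s n"
proof (cases "\<exists>M\<in>J. \<forall>t\<in>J. t \<le> M")
  case True
  then obtain M where "M \<in> J" "\<And>t. t \<in> J \<Longrightarrow> t \<le> M" by blast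
  then show thesis by (intro that[of "\<lambda>_. M"]) auto
next
  case False
  obtain D where D: "countable D" "D \<subseteq> J" "J \<subseteq> closure D" by (rule separable)
  have "D \<noteq> {}" using D(3) assms by auto
  define s where "s n = Max (from_nat_into D ` {..n})" for n
  have in_D: "from_nat_into D n \<in> D" for n by (rule from_nat_into[OF \<open>D \<noteq> {}\<close>])
  show thesis
  proof (rule that[of s])
    show "incseq s" unfolding s_def incseq_def by (intro allI impI Max_mono) auto
    have "s n \<in> J" for n
    proof -
      have "s n \<in> from_nat_into D ` {..n}" unfolding s_def by (rule Max_in) auto
      then obtain i where "s n = from_nat_into D i" by (elim imageE)
      then show ?thesis using in_D[of i] D(2) by auto
    qed
    then show "range s \<subseteq> J" by auto
    show "\<exists>n. t \<le> s n" if t: "t \<in> J" for t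
    proof -
      obtain t' where t': "t' \<in> J" "t < t'" using False t by (meson linorder_not_le)
      then have "t' \<in> closure D" using D(3) by blast
      then obtain d where d: "d \<in> D" "dist d t' < t' - t"
        using t'(2) unfolding closure_approachable by (meson diff_gt_0_iff_gt)
      then have "t \<le> d" by (auto simp: dist_real_def)
      also have "d = from_nat_into D (to_nat_on D d)" using D(1) d(1) by simp
      also have "\<dots> \<le> s (to_nat_on D d)" unfolding s_def by (rule Max_ge) auto
      finally show ?thesis by blast
    qed
  qed
qed

context prob_space
begin

text \<open>A union over uncountably many members of a chain equals the union along a cofinal
  sequence. Countability gives measurability, continuity from below the bound.\<close>

lemma monotone_union:
  fixes A :: "real \<Rightarrow> 'a set"
  assumes J: "J \<noteq> {}" and A: "\<And>t. t \<in> J \<Longrightarrow> A t \<in> events"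
    and mono: "\<And>s t. s \<in> J \<Longrightarrow> t \<in> J \<Longrightarrow> s \<le> t \<Longrightarrow> A s \<subseteq> A t"
  shows "(\<Union>t\<in>J. A t) \<in> events"
    and "(\<And>t. t \<in> J \<Longrightarrow> prob (A t) \<le> c) \<Longrightarrow> prob (\<Union>t\<in>J. A t) \<le> c"
proof -
  obtain s where s: "incseq s" "range s \<subseteq> J" "\<And>t. t \<in> J \<Longrightarrow> \<exists>n. t \<le> s n"
    by (rule ex_cofinal_sequence[OF J]) blast
  have sJ: "s n \<in> J" for n using s(2) by auto
  have eq: "(\<Union>t\<in>J. A t) = (\<Union>n. A (s n))"
  proof (intro equalityI UN_least)
    fix t assume t: "t \<in> J"
    then obtain n where "t \<le> s n" using s(3) by blast
    then show "A t \<subseteq> (\<Union>n. A (s n))" using mono[OF t sJ] by blast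
  qed (use sJ in blast)
  show "(\<Union>t\<in>J. A t) \<in> events" unfolding eq using A sJ by (intro sets.countable_UN) auto
  have "(\<lambda>n. prob (A (s n))) \<longlonglongrightarrow> prob (\<Union>n. A (s n))"
    by (rule finite_Lim_measure_incseq) (use A sJ mono s(1) in \<open>auto simp: incseq_def\<close>)
  then show "prob (\<Union>t\<in>J. A t) \<le> c" if "\<And>t. t \<in> J \<Longrightarrow> prob (A t) \<le> c"
    unfolding eq by (rule LIMSEQ_le_const2) (use that sJ in auto)
qed

definition event_brackets :: "nat \<Rightarrow> nat \<Rightarrow> real set \<Rightarrow> (real \<Rightarrow> 'a set) \<Rightarrow> (real \<Rightarrow> 'a set) \<Rightarrow> (real \<Rightarrow> 'a set) \<Rightarrow> bool" where
  "event_brackets m N S A Lo Up \<longleftrightarrow>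
     (\<forall>t\<in>S. Lo t \<in> events \<and> Up t \<in> events \<and> Lo t \<subseteq> A t \<and> A t \<subseteq> Up t \<and> prob (Up t - Lo t) \<le> 1 / m) \<and>
     finite ((\<lambda>t. (Lo t, Up t)) ` S) \<and> card ((\<lambda>t. (Lo t, Up t)) ` S) \<le> N"

text \<open>Members of a monotone family are grouped by the integer part of \<open>m\<close> times their probability.\<close>

lemma monotone_event_brackets:
  assumes m: "m > 0" and A: "\<And>t. t \<in> S \<Longrightarrow> A t \<in> events"
    and mono: "\<And>s t. s \<in> S \<Longrightarrow> t \<in> S \<Longrightarrow> s \<le> t \<Longrightarrow> A s \<subseteq> A t"
  shows "\<exists>Lo Up. event_brackets m (m + 1) S A Lo Up"
proof -
  define key where "key t = nat \<lfloor>m * prob (A t)\<rfloor>" for t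
  define J where "J k = {s \<in> S. key s = k}" for k
  \<comment> \<open>The intersection of the group, written as the complement of a union that
    increases in the reversed parameter, so that \<open>monotone_union\<close> applies to it as
    well.\<close>
  define lo where "lo k = space M - (\<Union>t\<in>uminus ` J k. space M - A (- t))" for k
  define up where "up k = (\<Union>t\<in>J k. A t)" for k
  have key: "real (key t) \<le> m * prob (A t)" "m * prob (A t) \<le> real (key t) + 1" "key t \<le> m" for t
  proof -
    have nn: "0 \<le> m * prob (A t)" by simp
    then show "real (key t) \<le> m * prob (A t)" "m * prob (A t) \<le> real (key t) + 1"
      unfolding key_def by linarith+
    have "real m * prob (A t) \<le> real m * 1" by (intro mult_left_mono) auto
    with \<open>real (key t) \<le> m * prob (A t)\<close> show "key t \<le> m" by simp
  qed
  have *: "lo (key t) \<in> events \<and> up (key t) \<in> events \<and> lo (key t) \<subseteq> A t \<and> A t \<subseteq> up (key t) \<and>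
      prob (up (key t) - lo (key t)) \<le> 1 / m" if t: "t \<in> S" for t
  proof -
    let ?k = "key t"
    have ne: "J ?k \<noteq> {}" and tJ: "t \<in> J ?k" using t by (auto simp: J_def)
    have JS: "s \<in> S" "key s = ?k" if "s \<in> J ?k" for s using that by (auto simp: J_def)
    have A_ev: "A s \<in> events" if "s \<in> J ?k" for s using A[OF JS(1)[OF that]] .
    have A_mono: "A s \<subseteq> A s'" if "s \<in> J ?k" "s' \<in> J ?k" "s \<le> s'" for s s'
      using mono[OF JS(1)[OF that(1)] JS(1)[OF that(2)] that(3)] .
    have up_le: "prob (A s) \<le> (real ?k + 1) / m" if s: "s \<in> J ?k" for s
      using key(2)[of s] JS(2)[OF s] m by (simp add: pos_le_divide_eq mult.commute)
    have up: "up ?k \<in> events" "prob (up ?k) \<le> (real ?k + 1) / m"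
      unfolding up_def
      by (rule monotone_union(1)[OF ne A_ev A_mono]; assumption)
         (rule monotone_union(2)[OF ne A_ev A_mono up_le]; assumption)
    have ne': "uminus ` J ?k \<noteq> {}" using ne by simp
    have neg: "- s \<in> J ?k" if "s \<in> uminus ` J ?k" for s using that by auto
    have C_ev: "space M - A (- s) \<in> events" if "s \<in> uminus ` J ?k" for s
      using A_ev[OF neg[OF that]] by simp
    have C_mono: "space M - A (- s) \<subseteq> space M - A (- s')"
      if "s \<in> uminus ` J ?k" "s' \<in> uminus ` J ?k" "s \<le> s'" for s s'
      using A_mono[OF neg[OF that(2)] neg[OF that(1)]] that(3) by auto
    have C_le: "prob (space M - A (- s)) \<le> 1 - real ?k / m" if "s \<in> uminus ` J ?k" for s
    proof -
      have "real ?k / m \<le> prob (A (- s))"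
        using key(1)[of "- s"] JS(2)[OF neg[OF that]] m by (simp add: pos_divide_le_eq mult.commute)
      then show ?thesis using A_ev[OF neg[OF that]] by (simp add: prob_compl)
    qed
    have "(\<Union>t\<in>uminus ` J ?k. space M - A (- t)) \<in> events"
      by (rule monotone_union(1)[OF ne' C_ev C_mono]; assumption)
    moreover have "prob (\<Union>t\<in>uminus ` J ?k. space M - A (- t)) \<le> 1 - real ?k / m"
      by (rule monotone_union(2)[OF ne' C_ev C_mono C_le]; assumption)
    ultimately have lo: "lo ?k \<in> events" "real ?k / m \<le> prob (lo ?k)"
      unfolding lo_def by (auto simp: prob_compl)
    have sub: "lo ?k \<subseteq> A t" "A t \<subseteq> up ?k"
    proof -
      show "A t \<subseteq> up ?k" using tJ unfolding up_def by blast
      have "- t \<in> uminus ` J ?k" using tJ by simp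
      then have "space M - A (- (- t)) \<subseteq> (\<Union>t\<in>uminus ` J ?k. space M - A (- t))" by blast
      then show "lo ?k \<subseteq> A t" unfolding lo_def by auto
    qed
    \<comment> \<open>In a group all probabilities lie between \<open>k / m\<close> and
      \<open>(k + 1) / m\<close>, and the chain property carries both bounds over to the union and
      the intersection.\<close>
    then have "prob (up ?k - lo ?k) = prob (up ?k) - prob (lo ?k)"
      using lo up by (intro finite_measure_Diff) auto
    also have "\<dots> \<le> (real ?k + 1) / m - real ?k / m"
      using lo up by (intro diff_mono) auto
    also have "\<dots> = 1 / m" by (simp add: diff_divide_distrib[symmetric])
    finally show ?thesis using lo up sub by blast
  qed
  \<comment> \<open>The keys run from 0 to \<open>m\<close>, which gives the \<open>m + 1\<close>
    brackets.\<close>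
  have sub: "(\<lambda>t. (lo (key t), up (key t))) ` S \<subseteq> (\<lambda>k. (lo k, up k)) ` {..m}"
    using key(3) by auto
  have "card ((\<lambda>t. (lo (key t), up (key t))) ` S) \<le> card {..m}"
    by (rule order_trans[OF card_mono[OF _ sub] card_image_le]) auto
  then have "event_brackets m (m + 1) S A (\<lambda>t. lo (key t)) (\<lambda>t. up (key t))"
    unfolding event_brackets_def using * finite_subset[OF sub] by auto
  then show ?thesis by blast
qed

text \<open>To the left of \<open>p\<close> the family increases; to the right it increases in the
  reversed parameter. Each half contributes \<open>m + 1\<close> brackets.\<close>

lemma unimodal_event_brackets:
  fixes p :: real
  assumes m: "m > 0" and A: "\<And>t. t \<in> S \<Longrightarrow> A t \<in> events"
    and mono: "\<And>s t. s \<in> S \<Longrightarrow> t \<in> S \<Longrightarrow> s \<le> t \<Longrightarrow> t \<le> p \<Longrightarrow> A s \<subseteq> A t"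
    and antimono: "\<And>s t. s \<in> S \<Longrightarrow> t \<in> S \<Longrightarrow> s \<le> t \<Longrightarrow> p \<le> s \<Longrightarrow> A t \<subseteq> A s"
  shows "\<exists>Lo Up. event_brackets m (2 * (m + 1)) S A Lo Up"
proof -
  define S1 where "S1 = S \<inter> {..p}"
  define S2 where "S2 = S \<inter> {p<..}"
  have "\<exists>Lo Up. event_brackets m (m + 1) S1 A Lo Up"
    by (rule monotone_event_brackets[OF m]) (use A mono in \<open>auto simp: S1_def\<close>)
  then obtain L1 U1 where 1: "event_brackets m (m + 1) S1 A L1 U1" by blast
  have "\<exists>Lo Up. event_brackets m (m + 1) (uminus ` S2) (\<lambda>t. A (- t)) Lo Up"
  proof (rule monotone_event_brackets[OF m])
    show "A (- t) \<in> events" if "t \<in> uminus ` S2" for t using that A by (auto simp: S2_def)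
    show "A (- s) \<subseteq> A (- t)" if "s \<in> uminus ` S2" "t \<in> uminus ` S2" "s \<le> t" for s t
      using that by (intro antimono) (auto simp: S2_def)
  qed
  then obtain L2 U2 where 2: "event_brackets m (m + 1) (uminus ` S2) (\<lambda>t. A (- t)) L2 U2" by blast
  define Lo where "Lo t = (if t \<le> p then L1 t else L2 (- t))" for t
  define Up where "Up t = (if t \<le> p then U1 t else U2 (- t))" for t
  have S: "S = S1 \<union> S2" by (auto simp: S1_def S2_def)
  have img: "(\<lambda>t. (Lo t, Up t)) ` S = (\<lambda>t. (L1 t, U1 t)) ` S1 \<union> (\<lambda>t. (L2 t, U2 t)) ` uminus ` S2"
    unfolding S image_Un image_image
    by (intro arg_cong2[where f = "(\<union>)"] image_cong) (auto simp: Lo_def Up_def S1_def S2_def)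
  have "card ((\<lambda>t. (Lo t, Up t)) ` S) \<le> (m + 1) + (m + 1)"
    unfolding img using 1 2 by (intro order_trans[OF card_Un_le] add_mono) (auto simp: event_brackets_def)
  moreover have "finite ((\<lambda>t. (Lo t, Up t)) ` S)"
    unfolding img using 1 2 by (simp add: event_brackets_def)
  moreover have "Lo t \<in> events \<and> Up t \<in> events \<and> Lo t \<subseteq> A t \<and> A t \<subseteq> Up t \<and> prob (Up t - Lo t) \<le> 1 / m"
    if t: "t \<in> S" for t
  proof (cases "t \<le> p")
    case True
    then show ?thesis using 1 t by (simp add: event_brackets_def Lo_def Up_def S1_def)
  next
    case False
    then have "- t \<in> uminus ` S2" using t by (simp add: S2_def)
    with 2 have "L2 (- t) \<in> events \<and> U2 (- t) \<in> events \<and> L2 (- t) \<subseteq> A (- (- t)) \<and> A (- (- t)) \<subseteq> U2 (- t) \<and>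
        prob (U2 (- t) - L2 (- t)) \<le> 1 / m"
      unfolding event_brackets_def by blast
    then show ?thesis using False by (simp add: Lo_def Up_def)
  qed
  ultimately have "event_brackets m (2 * (m + 1)) S A Lo Up"
    unfolding event_brackets_def by simp
  then show ?thesis by blast
qed

end

section \<open>Cells are boxes\<close>

text \<open>The sides are intervals in the sense of order convexity, because a cut may leave its
  hyperplane on either side and so produces open, closed and half-open intervals.\<close>

definition is_box :: "(real ^ 'd) set \<Rightarrow> bool" where
  "is_box A \<longleftrightarrow> (\<exists>I. (\<forall>j. \<forall>a\<in>I j. \<forall>b\<in>I j. {a..b} \<subseteq> I j) \<and> A = {x. \<forall>j. x $ j \<in> I j})"

lemma is_box_cut:
  assumes "is_box A" and K: "\<forall>a\<in>K. \<forall>b\<in>K. {a..b} \<subseteq> K"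
  shows "is_box {x \<in> A. x $ j \<in> K}"
proof -
  obtain I where I: "\<forall>j. \<forall>a\<in>I j. \<forall>b\<in>I j. {a..b} \<subseteq> I j" "A = {x. \<forall>j. x $ j \<in> I j}"
    using assms(1) by (auto simp: is_box_def)
  define I' where "I' = I(j := I j \<inter> K)"
  have "\<forall>a\<in>I' i. \<forall>b\<in>I' i. {a..b} \<subseteq> I' i" for i
  proof (cases "i = j")
    case True
    have "\<forall>a\<in>I j \<inter> K. \<forall>b\<in>I j \<inter> K. {a..b} \<subseteq> I j \<inter> K" using I(1) K by blast
    then show ?thesis by (simp add: I'_def True)
  qed (use I(1) in \<open>simp add: I'_def\<close>)
  moreover have "{x \<in> A. x $ j \<in> K} = {x. \<forall>i. x $ i \<in> I' i}"
    unfolding I(2) I'_def by auto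
  ultimately show ?thesis unfolding is_box_def by blast
qed

lemma cut_partition_box: "cut_partition T \<Longrightarrow> A \<in> T \<Longrightarrow> is_box A"
proof (induction arbitrary: A rule: cut_partition.induct)
  case root
  then show ?case
    unfolding is_box_def by (intro exI[of _ "\<lambda>_. {0..1}"]) (auto simp: mem_box_cart)
next
  case (cut_le T A' j s)
  have "is_box {x \<in> A'. x $ j \<in> {..s}}" "is_box {x \<in> A'. x $ j \<in> {s<..}}"
    by (rule is_box_cut[OF cut_le.IH[OF cut_le.hyps(2)]]; auto)+
  then show ?case using cut_le.prems cut_le.IH by auto
next
  case (cut_less T A' j s)
  have "is_box {x \<in> A'. x $ j \<in> {..<s}}" "is_box {x \<in> A'. x $ j \<in> {s..}}"
    by (rule is_box_cut[OF cut_less.IH[OF cut_less.hyps(2)]]; auto)+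
  then show ?case using cut_less.prems cut_less.IH by auto
qed

definition set_coord :: "real ^ 'd \<Rightarrow> 'd \<Rightarrow> real \<Rightarrow> real ^ 'd" where
  "set_coord p j t = (\<chi> k. if k = j then t else p $ k)"

lemma set_coord_unit_cube:
  "p \<in> unit_cube \<Longrightarrow> t \<in> {0..1} \<Longrightarrow> set_coord p j t \<in> unit_cube"
  by (auto simp: mem_box_cart set_coord_def)

text \<open>The point \<open>p\<close> satisfies all side conditions of its own cell, so replacing
  its coordinate \<open>j\<close> tests the side \<open>I j\<close> alone.\<close>

lemma same_cell_box:
  fixes T :: "(real ^ 'd) set set"
  assumes T: "cut_partition T" and p: "p \<in> unit_cube"
  obtains I where "\<And>j a b. a \<in> I j \<Longrightarrow> b \<in> I j \<Longrightarrow> {a..b} \<subseteq> I j" "\<And>j. p $ j \<in> I j"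
    "\<And>x. same_cell T x p \<longleftrightarrow> (\<forall>j. x $ j \<in> I j)"
    "\<And>j t. same_cell T (set_coord p j t) p \<longleftrightarrow> t \<in> I j"
proof -
  have part: "partition_on unit_cube T" using cut_partition_finite_partition[OF T] by simp
  then obtain A where A: "A \<in> T" "p \<in> A" using p by (auto simp: partition_on_def)
  have uniq: "A' = A" if "A' \<in> T" "p \<in> A'" for A'
    using part that A by (auto simp: partition_on_def disjoint_def)
  obtain I where I: "\<forall>j. \<forall>a\<in>I j. \<forall>b\<in>I j. {a..b} \<subseteq> I j" "A = {x. \<forall>j. x $ j \<in> I j}"
    using cut_partition_box[OF T A(1)] unfolding is_box_def by blast
  have in_A: "x \<in> A \<longleftrightarrow> (\<forall>j. x $ j \<in> I j)" for x by (simp add: I(2))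
  have "same_cell T x p \<longleftrightarrow> x \<in> A" for x
  proof
    assume "same_cell T x p"
    then obtain A' where "A' \<in> T" "x \<in> A'" "p \<in> A'" by (auto simp: same_cell_def)
    then show "x \<in> A" using uniq[of A'] by simp
  next
    assume "x \<in> A"
    then show "same_cell T x p" unfolding same_cell_def using A by (intro bexI[of _ A]) simp_all
  qed
  then have cell: "same_cell T x p \<longleftrightarrow> (\<forall>j. x $ j \<in> I j)" for x by (simp only: in_A)
  have pI: "p $ j \<in> I j" for j using A(2) in_A by simp
  have coord: "same_cell T (set_coord p j t) p \<longleftrightarrow> t \<in> I j" for j t
  proof
    assume "same_cell T (set_coord p j t) p"
    then have "set_coord p j t $ j \<in> I j" unfolding cell by simp
    then show "t \<in> I j" by (simp add: set_coord_def)
  next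
    assume "t \<in> I j"
    then have "set_coord p j t $ i \<in> I i" for i using pI[of i] by (simp add: set_coord_def)
    then show "same_cell T (set_coord p j t) p" unfolding cell by simp
  qed
  show thesis
  proof (rule that[of I])
    show "{a..b} \<subseteq> I j" if "a \<in> I j" "b \<in> I j" for j a b using I(1) that by simp
  qed (rule pI, rule cell, rule coord)
qed

section \<open>Random forests have small bracketing entropy\<close>

text \<open>The estimate depends on the tree only through \<open>n\<close> membership bits, so these
  can be replaced by bracketing events.\<close>

definition cell_mean :: "nat \<Rightarrow> (nat \<Rightarrow> real) \<Rightarrow> (nat \<Rightarrow> bool) \<Rightarrow> real" where
  "cell_mean n Y b = (\<Sum>i<n. Y i * of_bool (b i)) / (\<Sum>i<n. of_bool (b i))"

lemma tree_estimate_eq: "tree_estimate n X Y T x = cell_mean n Y (\<lambda>i. same_cell T x (X i))"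
proof -
  have "real (cell_count n X T x) = (\<Sum>i<n. of_bool (same_cell T x (X i)))"
    by (simp add: cell_count_def sum_of_bool_eq Int_def conj_commute)
  then show ?thesis unfolding tree_estimate_def cell_mean_def by (simp only: sum_divide_distrib)
qed

lemma abs_cell_mean_le: "\<bar>cell_mean n Y b\<bar> \<le> (\<Sum>i<n. \<bar>Y i\<bar>)"
proof -
  let ?N = "\<Sum>i<n. of_bool (b i) :: real"
  have N: "?N = real (card {i. i < n \<and> b i})"
    by (simp add: sum_of_bool_eq Int_def conj_commute)
  have nn: "0 \<le> (\<Sum>i<n. \<bar>Y i\<bar>)" by (rule sum_nonneg) simp
  have num: "\<bar>\<Sum>i<n. Y i * of_bool (b i)\<bar> \<le> (\<Sum>i<n. \<bar>Y i\<bar>)"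
    by (rule order_trans[OF sum_abs sum_mono]) (simp add: abs_mult)
  show ?thesis
  \<comment> \<open>The denominator is a count: either it is 0 and the quotient is 0 by convention,
    or it is at least 1.\<close>
  proof (cases "?N = 0")
    case True
    then show ?thesis using nn by (simp only: cell_mean_def division_ring_divide_zero abs_zero)
  next
    case False
    then have "1 \<le> ?N" unfolding N by (cases "card {i. i < n \<and> b i}") auto
    then have "\<bar>\<Sum>i<n. Y i * of_bool (b i)\<bar> / \<bar>?N\<bar> \<le> \<bar>\<Sum>i<n. Y i * of_bool (b i)\<bar> / 1"
      by (intro divide_left_mono) auto
    then have "\<bar>cell_mean n Y b\<bar> \<le> \<bar>\<Sum>i<n. Y i * of_bool (b i)\<bar>"
      unfolding cell_mean_def abs_divide by (simp only: div_by_1)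
    then show ?thesis using num by linarith
  qed
qed

text \<open>
  A cell is a box, so \<open>x\<close> shares the cell of a data point iff each of its coordinates,
  substituted into that data point, does.  Each coordinate gives a family of events that is
  monotone on either side of the data point.
\<close>

lemma forest_brackets:
  fixes X :: "nat \<Rightarrow> real ^ 'd" and T :: "'t \<Rightarrow> (real ^ 'd) set set"
  assumes data: "\<And>i. i < n \<Longrightarrow> X i \<in> unit_cube" and forest: "random_forest P T"
    and B: "(\<Sum>i<n. \<bar>Y i\<bar>) \<le> B" and m: "m > 0"
  shows "\<exists>l u :: real ^ 'd \<Rightarrow> 't \<Rightarrow> real.
    (\<forall>x\<in>unit_cube. l x \<in> borel_measurable P \<and> u x \<in> borel_measurable P \<and>
      (\<forall>\<theta>\<in>space P. \<bar>l x \<theta>\<bar> \<le> B \<and> \<bar>u x \<theta>\<bar> \<le> B \<and>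
         l x \<theta> \<le> tree_estimate n X Y (T \<theta>) x \<and> tree_estimate n X Y (T \<theta>) x \<le> u x \<theta>) \<and>
      (LINT \<theta>|P. u x \<theta> - l x \<theta>) \<le> 2 * B * real (n * CARD('d)) / m) \<and>
    finite ((\<lambda>x. (l x, u x)) ` unit_cube) \<and>
    card ((\<lambda>x. (l x, u x)) ` unit_cube) \<le> (2 * (m + 1)) ^ (n * CARD('d))"
proof -
  interpret prob_space P using forest by (simp add: random_forest_def)
  have cut: "cut_partition (T \<theta>)" if "\<theta> \<in> space P" for \<theta> using forest that by (simp add: random_forest_def)
  have B0: "0 \<le> B" using B order_trans[OF sum_nonneg] by (metis abs_ge_zero)
  define E where "E i j t = {\<theta> \<in> space P. same_cell (T \<theta>) (set_coord (X i) j t) (X i)}" for i j t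
  have E_ev: "E i j t \<in> events" if "i < n" "t \<in> {0..1}" for i j t
    unfolding E_def using forest set_coord_unit_cube[OF data[OF that(1)] that(2)] data[OF that(1)]
    by (simp add: random_forest_def)
  \<comment> \<open>A convex side that contains \<open>s\<close> and the coordinate of
    \<open>X i\<close> contains everything in between.\<close>
  have E_between: "E i j s \<subseteq> E i j t" if "i < n" "s \<le> t \<and> t \<le> X i $ j \<or> X i $ j \<le> t \<and> t \<le> s" for i j s t
  proof
    note i = that(1)
    fix \<theta> assume \<theta>: "\<theta> \<in> E i j s"
    then have sp: "\<theta> \<in> space P" by (simp add: E_def)
    obtain I where I: "\<And>j a b. a \<in> I j \<Longrightarrow> b \<in> I j \<Longrightarrow> {a..b} \<subseteq> I j" "\<And>j. X i $ j \<in> I j"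
      "\<And>x. same_cell (T \<theta>) x (X i) \<longleftrightarrow> (\<forall>j. x $ j \<in> I j)"
      "\<And>j t. same_cell (T \<theta>) (set_coord (X i) j t) (X i) \<longleftrightarrow> t \<in> I j"
      by (rule same_cell_box[OF cut[OF sp] data[OF i]]) (rule that, assumption+)
    have s: "s \<in> I j" using \<theta> I(4) by (simp add: E_def)
    have "t \<in> {s..X i $ j} \<or> t \<in> {X i $ j..s}" using that(2) by auto
    then have "t \<in> I j" using I(1)[OF s I(2)[of j]] I(1)[OF I(2)[of j] s] by blast
    then show "\<theta> \<in> E i j t" using sp I(4) by (simp add: E_def)
  qed
  have "\<exists>Lo Up. event_brackets m (2 * (m + 1)) {0..1} (E i j) Lo Up" if "i < n" for i j
    by (rule unimodal_event_brackets[OF m, where p = "X i $ j"]) (use that E_ev E_between in auto)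
  then have "\<forall>i j. \<exists>Lo Up. i < n \<longrightarrow> event_brackets m (2 * (m + 1)) {0..1} (E i j) Lo Up" by blast
  then obtain Lo Up where LU: "\<And>i j. i < n \<Longrightarrow> event_brackets m (2 * (m + 1)) {0..1} (E i j) (Lo i j) (Up i j)"
    by metis
  have coord: "x $ j \<in> {0..1}" if "x \<in> unit_cube" for x :: "real ^ 'd" and j using that by (auto simp: mem_box_cart)
  have br: "Lo i j (x $ j) \<in> events" "Up i j (x $ j) \<in> events" "Lo i j (x $ j) \<subseteq> E i j (x $ j)"
    "E i j (x $ j) \<subseteq> Up i j (x $ j)" "prob (Up i j (x $ j) - Lo i j (x $ j)) \<le> 1 / m"
    if "i < n" "x \<in> unit_cube" for i j x
    using LU[OF that(1), of j] coord[OF that(2), of j] by (auto simp: event_brackets_def)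
  \<comment> \<open>\<open>D x\<close> is the event that some bracket leaves a membership undecided.
    The estimate is a quotient with signed data and not monotone in the memberships, so brackets for
    these are not simply inserted: off \<open>D x\<close> the estimate is known exactly, on
    \<open>D x\<close> the trivial bounds \<open>- B\<close> and \<open>B\<close> are taken.\<close>
  define D where "D x = (\<Union>(i, j)\<in>{..<n} \<times> UNIV. Up i j (x $ j) - Lo i j (x $ j))" for x :: "real ^ 'd"
  define h where "h x \<theta> = cell_mean n Y (\<lambda>i. \<forall>j. \<theta> \<in> Lo i j (x $ j))" for x :: "real ^ 'd" and \<theta>
  define l where "l x \<theta> = (if \<theta> \<in> D x then - B else h x \<theta>)" for x \<theta>
  define u where "u x \<theta> = (if \<theta> \<in> D x then B else h x \<theta>)" for x \<theta>
  have D_ev: "D x \<in> events" if "x \<in> unit_cube" for x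
    unfolding D_def using br[OF _ that] by (intro sets.finite_UN) auto
  have h_bound: "\<bar>h x \<theta>\<bar> \<le> B" for x \<theta>
    unfolding h_def by (rule order_trans[OF abs_cell_mean_le B])
  have h_meas: "h x \<in> borel_measurable P" if x: "x \<in> unit_cube" for x
  proof -
    have "(\<lambda>\<theta>. of_bool (\<forall>j. \<theta> \<in> Lo i j (x $ j)) :: real) \<in> borel_measurable P" if "i < n" for i
    proof -
      have "(\<Inter>j. Lo i j (x $ j)) \<in> events" using br(1)[OF that x] by (intro sets.finite_INT) auto
      moreover have "(\<lambda>\<theta>. of_bool (\<forall>j. \<theta> \<in> Lo i j (x $ j)) :: real) = indicator (\<Inter>j. Lo i j (x $ j))"
        by (auto simp: indicator_def fun_eq_iff)
      ultimately show ?thesis by simp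
    qed
    then show ?thesis unfolding h_def[abs_def] cell_mean_def
      by (intro borel_measurable_divide borel_measurable_sum borel_measurable_times borel_measurable_const) auto
  qed
  have exact: "tree_estimate n X Y (T \<theta>) x = h x \<theta>" if x: "x \<in> unit_cube" and \<theta>: "\<theta> \<in> space P" "\<theta> \<notin> D x" for x \<theta>
  proof -
    have "same_cell (T \<theta>) x (X i) \<longleftrightarrow> (\<forall>j. \<theta> \<in> Lo i j (x $ j))" if i: "i < n" for i
    proof -
      obtain I where I: "\<And>x. same_cell (T \<theta>) x (X i) \<longleftrightarrow> (\<forall>j. x $ j \<in> I j)"
        "\<And>j t. same_cell (T \<theta>) (set_coord (X i) j t) (X i) \<longleftrightarrow> t \<in> I j"
        by (rule same_cell_box[OF cut[OF \<theta>(1)] data[OF i]]) (rule that, assumption+)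
      have "\<theta> \<in> E i j (x $ j) \<longleftrightarrow> x $ j \<in> I j" for j using \<theta>(1) I(2) by (simp add: E_def)
      moreover have "\<theta> \<in> E i j (x $ j) \<longleftrightarrow> \<theta> \<in> Lo i j (x $ j)" for j
      proof -
        have "\<theta> \<notin> Up i j (x $ j) - Lo i j (x $ j)" using \<theta>(2) i by (auto simp: D_def)
        then show ?thesis using br(3,4)[OF i x, of j] by auto
      qed
      ultimately show ?thesis unfolding I(1) by simp
    qed
    then show ?thesis unfolding tree_estimate_eq h_def cell_mean_def by (auto intro!: arg_cong2[where f = "(/)"] sum.cong)
  qed
  have point: "l x \<in> borel_measurable P \<and> u x \<in> borel_measurable P \<and>
      (\<forall>\<theta>\<in>space P. \<bar>l x \<theta>\<bar> \<le> B \<and> \<bar>u x \<theta>\<bar> \<le> B \<and>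
         l x \<theta> \<le> tree_estimate n X Y (T \<theta>) x \<and> tree_estimate n X Y (T \<theta>) x \<le> u x \<theta>) \<and>
      (LINT \<theta>|P. u x \<theta> - l x \<theta>) \<le> 2 * B * real (n * CARD('d)) / m" if x: "x \<in> unit_cube" for x
  proof (intro conjI ballI)
    note [measurable] = h_meas[OF x] D_ev[OF x]
    show "l x \<in> borel_measurable P" "u x \<in> borel_measurable P"
      unfolding l_def[abs_def] u_def[abs_def] by measurable
    fix \<theta> assume \<theta>: "\<theta> \<in> space P"
    show "\<bar>l x \<theta>\<bar> \<le> B" "\<bar>u x \<theta>\<bar> \<le> B" using B0 h_bound by (auto simp: l_def u_def)
    have "\<bar>tree_estimate n X Y (T \<theta>) x\<bar> \<le> B"
      unfolding tree_estimate_eq by (rule order_trans[OF abs_cell_mean_le B])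
    then show "l x \<theta> \<le> tree_estimate n X Y (T \<theta>) x" "tree_estimate n X Y (T \<theta>) x \<le> u x \<theta>"
      using exact[OF x \<theta>] by (auto simp: l_def u_def abs_le_iff)
  next
    have "u x \<theta> - l x \<theta> = 2 * B * indicator (D x) \<theta>" for \<theta>
      by (simp add: l_def u_def indicator_def)
    then have "(LINT \<theta>|P. u x \<theta> - l x \<theta>) = 2 * B * prob (D x)"
      using D_ev[OF x] by simp
    \<comment> \<open>Union bound over all data points and coordinates.\<close>
    also have "prob (D x) \<le> (\<Sum>p\<in>{..<n} \<times> UNIV. prob (case p of (i, j) \<Rightarrow> Up i j (x $ j) - Lo i j (x $ j)))"
      unfolding D_def using br[OF _ x] by (intro finite_measure_subadditive_finite) auto
    also have "\<dots> \<le> (\<Sum>p\<in>{..<n} \<times> (UNIV :: 'd set). 1 / m)"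
      using br(5)[OF _ x] by (intro sum_mono) auto
    also have "\<dots> = real (n * CARD('d)) / m" by (simp add: card_cartesian_product)
    finally show "(LINT \<theta>|P. u x \<theta> - l x \<theta>) \<le> 2 * B * real (n * CARD('d)) / m"
      using B0 by (simp add: mult_left_mono)
  qed
  \<comment> \<open>The pair for \<open>x\<close> is determined by the brackets chosen for each data
    point and coordinate. Hence the number of pairs is at most a product of
    \<open>n * CARD('d)\<close> factors.\<close>
  define key where "key x = (\<lambda>(i, j)\<in>{..<n} \<times> UNIV. (Lo i j (x $ j), Up i j (x $ j)))" for x :: "real ^ 'd"
  define R where "R = (\<lambda>(i, j). (\<lambda>t. (Lo i j t, Up i j t)) ` {0..1})"
  have R: "finite (R p)" "card (R p) \<le> 2 * (m + 1)" if "p \<in> {..<n} \<times> UNIV" for p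
    using LU that by (auto simp: R_def event_brackets_def)
  have fin: "finite (PiE ({..<n} \<times> (UNIV :: 'd set)) R)" using R by (intro finite_PiE) auto
  have key_in: "key ` unit_cube \<subseteq> PiE ({..<n} \<times> UNIV) R"
    using coord by (auto simp: key_def R_def split: if_splits)
  have lu_key: "(l x, u x) = (l x', u x')" if "key x = key x'" for x x'
  proof -
    have *: "Lo i j (x $ j) = Lo i j (x' $ j)" "Up i j (x $ j) = Up i j (x' $ j)" if "i < n" for i j
      using fun_cong[OF \<open>key x = key x'\<close>, of "(i, j)"] that by (simp_all add: key_def)
    have Dx: "D x = D x'" unfolding D_def using * by (intro SUP_cong) auto
    have "h x \<theta> = h x' \<theta>" for \<theta>
      unfolding h_def cell_mean_def using * by (intro arg_cong2[where f = "(/)"] sum.cong) auto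
    then have "l x \<theta> = l x' \<theta>" "u x \<theta> = u x' \<theta>" for \<theta>
      unfolding l_def u_def Dx by simp_all
    then show ?thesis by (simp add: fun_eq_iff)
  qed
  define G where "G \<kappa> = (l (SOME x. key x = \<kappa>), u (SOME x. key x = \<kappa>))" for \<kappa>
  have G: "(l x, u x) = G (key x)" for x
    unfolding G_def by (rule lu_key) (rule someI[of "\<lambda>x'. key x' = key x" x, OF refl, symmetric])
  have img: "(\<lambda>x. (l x, u x)) ` unit_cube = G ` key ` unit_cube" by (simp add: image_image G)
  have finkey: "finite (key ` unit_cube)" by (rule finite_subset[OF key_in fin])
  have "card ((\<lambda>x. (l x, u x)) ` unit_cube) \<le> card (PiE ({..<n} \<times> (UNIV :: 'd set)) R)"
    unfolding img by (rule order_trans[OF card_image_le[OF finkey] card_mono[OF fin key_in]])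
  also have "\<dots> = (\<Prod>p\<in>{..<n} \<times> (UNIV :: 'd set). card (R p))" by (rule card_PiE) simp
  also have "\<dots> \<le> (\<Prod>p\<in>{..<n} \<times> (UNIV :: 'd set). 2 * (m + 1))" using R by (intro prod_mono) auto
  also have "\<dots> = (2 * (m + 1)) ^ (n * CARD('d))" by (simp add: card_cartesian_product)
  finally have "card ((\<lambda>x. (l x, u x)) ` unit_cube) \<le> (2 * (m + 1)) ^ (n * CARD('d))" .
  then show ?thesis using point finkey unfolding img by (intro exI[of _ l] exI[of _ u]) (simp add: img)
qed

lemma forest_fun_eq: "\<theta> \<in> space P \<Longrightarrow> forest_fun n X Y P T x \<theta> = tree_estimate n X Y (T \<theta>) x"
  by (simp add: forest_fun_def)

lemma covariance_cong:
  assumes "\<And>\<omega>. \<omega> \<in> space M \<Longrightarrow> U \<omega> = U' \<omega>" "\<And>\<omega>. \<omega> \<in> space M \<Longrightarrow> V \<omega> = V' \<omega>"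
  shows "covariance M U V = covariance M U' V'"
proof -
  have "(LINT \<omega>|M. U \<omega>) = (LINT \<omega>|M. U' \<omega>)" "(LINT \<omega>|M. V \<omega>) = (LINT \<omega>|M. V' \<omega>)"
    using assms by (auto intro: Bochner_Integration.integral_cong)
  then show ?thesis
    unfolding covariance_def using assms by (auto intro: Bochner_Integration.integral_cong)
qed

text \<open>The class is indexed by its own members, with the identity as \<open>f\<close>, because
  the limit lives on functions of the class and not of points of the cube.\<close>

lemma forest_class_bracketed:
  fixes X :: "nat \<Rightarrow> real ^ 'd" and T :: "'t \<Rightarrow> (real ^ 'd) set set"
  assumes data: "\<And>i. i < n \<Longrightarrow> X i \<in> unit_cube" and forest: "random_forest P T"
  shows "\<exists>l u B c. bracketed_class P (forest_class n X Y P T) (\<lambda>g. g) l u B c"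
proof -
  let ?F = "forest_class n X Y P T"
  \<comment> \<open>The summand 1 secures \<open>1 \<le> B\<close> even when all responses
    vanish.\<close>
  define B where "B = 1 + (\<Sum>i<n. \<bar>Y i\<bar>)"
  define q where "q = n * CARD('d)"
  \<comment> \<open>Chosen so that \<open>b * 64 ^ k\<close> dominates \<open>2 * (m k + 1)\<close>;
    the 6 collects the rounding in \<open>m k\<close>.\<close>
  define b where "b = 4 * B * q + 6"
  define c where "c = q * (ln b + ln 64)"
  have B: "1 \<le> B" by (simp add: B_def sum_nonneg)
  have b: "1 \<le> b" using B by (simp add: b_def)
  \<comment> \<open>The resolution at which the bracket width \<open>2 * B * q / m k\<close> drops
    to \<open>1 / 64 ^ k\<close>. The \<open>+ 1\<close> keeps it positive when there are no
    data.\<close>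
  define m where "m k = nat \<lceil>2 * B * q * 64 ^ k\<rceil> + 1" for k :: nat
  have m: "2 * B * q * 64 ^ k \<le> real (m k)" "real (m k) \<le> 2 * B * q * 64 ^ k + 2" "m k > 0" for k
  proof -
    have "0 \<le> 2 * B * q * 64 ^ k" using B by simp
    then show "2 * B * q * 64 ^ k \<le> real (m k)" "real (m k) \<le> 2 * B * q * 64 ^ k + 2"
      unfolding m_def by linarith+
  qed (simp add: m_def)
  have size: "2 * B * q / m k \<le> 1 / 64 ^ k" for k
    using m(1)[of k] m(3)[of k] by (simp add: field_simps)
  have card_le: "real ((2 * (m k + 1)) ^ q) \<le> exp (c * (real k + 1))" for k
  proof -
    have "real (2 * (m k + 1)) \<le> 4 * B * q * 64 ^ k + 6" using m(2)[of k] by simp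
    also have "\<dots> \<le> 4 * B * q * 64 ^ k + 6 * 64 ^ k" by simp
    also have "\<dots> = b * 64 ^ k" by (simp add: b_def algebra_simps)
    also have "\<dots> = exp (ln b + k * ln 64)"
      using b by (simp add: exp_add exp_of_nat_mult)
    also have "\<dots> \<le> exp ((ln b + ln 64) * (real k + 1))"
    proof -
      have "0 \<le> ln b * k" "0 \<le> ln (64 :: real)" using b by simp_all
      then show ?thesis by (simp add: algebra_simps)
    qed
    finally have "real (2 * (m k + 1)) ^ q \<le> exp ((ln b + ln 64) * (real k + 1)) ^ q"
      by (intro power_mono) auto
    also have "\<dots> = exp (c * (real k + 1))" by (simp add: c_def exp_of_nat_mult[symmetric] mult_ac)
    finally show ?thesis by simp
  qed
  have sumB: "(\<Sum>i<n. \<bar>Y i\<bar>) \<le> B" by (simp add: B_def)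
  have "\<forall>k. \<exists>l u :: real ^ 'd \<Rightarrow> 't \<Rightarrow> real.
    (\<forall>x\<in>unit_cube. l x \<in> borel_measurable P \<and> u x \<in> borel_measurable P \<and>
      (\<forall>\<theta>\<in>space P. \<bar>l x \<theta>\<bar> \<le> B \<and> \<bar>u x \<theta>\<bar> \<le> B \<and>
         l x \<theta> \<le> tree_estimate n X Y (T \<theta>) x \<and> tree_estimate n X Y (T \<theta>) x \<le> u x \<theta>) \<and>
      (LINT \<theta>|P. u x \<theta> - l x \<theta>) \<le> 2 * B * q / m k) \<and>
    finite ((\<lambda>x. (l x, u x)) ` unit_cube) \<and>
    card ((\<lambda>x. (l x, u x)) ` unit_cube) \<le> (2 * (m k + 1)) ^ q"
    unfolding q_def by (intro allI forest_brackets[OF data forest sumB m(3)])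
  then obtain l u where lu: "\<And>k. (\<forall>x\<in>unit_cube. l k x \<in> borel_measurable P \<and> u k x \<in> borel_measurable P \<and>
      (\<forall>\<theta>\<in>space P. \<bar>l k x \<theta>\<bar> \<le> B \<and> \<bar>u k x \<theta>\<bar> \<le> B \<and>
         l k x \<theta> \<le> tree_estimate n X Y (T \<theta>) x \<and> tree_estimate n X Y (T \<theta>) x \<le> u k x \<theta>) \<and>
      (LINT \<theta>|P. u k x \<theta> - l k x \<theta>) \<le> 2 * B * q / m k) \<and>
    finite ((\<lambda>x. (l k x, u k x)) ` unit_cube) \<and>
    card ((\<lambda>x. (l k x, u k x)) ` unit_cube) \<le> (2 * (m k + 1)) ^ q"
    unfolding choice_iff by blast
  \<comment> \<open>Different points may give the same function; brackets are transferred from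
    points to functions through a chosen representative, which cannot increase their number.\<close>
  define rep where "rep g = (SOME x. x \<in> unit_cube \<and> g = forest_fun n X Y P T x)" for g
  have rep: "rep g \<in> unit_cube" "g = forest_fun n X Y P T (rep g)" if "g \<in> ?F" for g
  proof -
    have "\<exists>x. x \<in> unit_cube \<and> g = forest_fun n X Y P T x" using that by (auto simp: forest_class_def)
    from someI_ex[OF this] show "rep g \<in> unit_cube" "g = forest_fun n X Y P T (rep g)" by (simp_all add: rep_def)
  qed
  have g_eq: "g \<theta> = tree_estimate n X Y (T \<theta>) (rep g)" if "g \<in> ?F" "\<theta> \<in> space P" for g \<theta>
    by (subst rep(2)[OF that(1)]) (rule forest_fun_eq[OF that(2)])
  have sub: "(\<lambda>g. (l k (rep g), u k (rep g))) ` ?F \<subseteq> (\<lambda>x. (l k x, u k x)) ` unit_cube" for k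
    using rep(1) by auto
  interpret prob_space P using forest by (simp add: random_forest_def)
  have "bracketed_class P ?F (\<lambda>g. g) (\<lambda>k g. l k (rep g)) (\<lambda>k g. u k (rep g)) B c"
  proof (unfold_locales)
    have "(0 :: real ^ 'd) \<in> unit_cube" by (simp add: mem_box_cart)
    then show "?F \<noteq> {}" unfolding forest_class_def by blast
    show "1 \<le> B" by (rule B)
    show "0 \<le> c" using b by (simp add: c_def)
    fix g k assume g: "g \<in> ?F"
    note x = rep(1)[OF g]
    show "l k (rep g) \<in> borel_measurable P" "u k (rep g) \<in> borel_measurable P"
      using lu[of k] x by blast+
    show "(LINT \<theta>|P. u k (rep g) \<theta> - l k (rep g) \<theta>) \<le> 1 / 64 ^ k"
      using lu[of k] x size[of k] by (meson order_trans)
    fix \<theta> assume \<theta>: "\<theta> \<in> space P"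
    show "\<bar>l k (rep g) \<theta>\<bar> \<le> B" "\<bar>u k (rep g) \<theta>\<bar> \<le> B" "l k (rep g) \<theta> \<le> g \<theta>" "g \<theta> \<le> u k (rep g) \<theta>"
      unfolding g_eq[OF g \<theta>] using lu[of k] x \<theta> by blast+
  next
    fix g assume g: "g \<in> ?F"
    have ev: "{\<theta> \<in> space P. same_cell (T \<theta>) (rep g) (X i)} \<in> sets P" if "i < n" for i
      using forest rep(1)[OF g] data[OF that] by (simp add: random_forest_def)
    have "(\<lambda>\<theta>. cell_mean n Y (\<lambda>i. same_cell (T \<theta>) (rep g) (X i))) \<in> borel_measurable P"
    proof -
      have "(\<lambda>\<theta>. of_bool (same_cell (T \<theta>) (rep g) (X i)) :: real) \<in> borel_measurable P" if "i < n" for i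
        using ev[OF that] unfolding of_bool_def by (intro measurable_If measurable_const) auto
      then show ?thesis unfolding cell_mean_def
        by (intro borel_measurable_divide borel_measurable_sum borel_measurable_times borel_measurable_const) auto
    qed
    then show "g \<in> borel_measurable P"
      by (subst measurable_cong[OF g_eq[OF g]]) (simp_all add: tree_estimate_eq)
  next
    fix k
    show "finite ((\<lambda>g. (l k (rep g), u k (rep g))) ` ?F)"
      using lu[of k] finite_subset[OF sub] by blast
    have "card ((\<lambda>g. (l k (rep g), u k (rep g))) ` ?F) \<le> (2 * (m k + 1)) ^ q"
      using lu[of k] card_mono[OF _ sub, of k] by (meson order_trans)
    then have "real (card ((\<lambda>g. (l k (rep g), u k (rep g))) ` ?F)) \<le> real ((2 * (m k + 1)) ^ q)"
      by (rule of_nat_mono)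
    then show "real (card ((\<lambda>g. (l k (rep g), u k (rep g))) ` ?F)) \<le> exp (c * (real k + 1))"
      using card_le[of k] by (rule order_trans)
  qed
  then show ?thesis by blast
qed

theorem theorem3p2:
  fixes n :: nat and X :: "nat \<Rightarrow> real ^ 'd" and Y :: "nat \<Rightarrow> real"
    and P :: "'t measure" and T :: "'t \<Rightarrow> (real ^ 'd) set set"
    and \<Omega> :: "'w measure" and \<Theta> :: "nat \<Rightarrow> 'w \<Rightarrow> 't"
  assumes data: "\<And>i. i < n \<Longrightarrow> X i \<in> unit_cube"
    and forest: "random_forest P T"
    and prob: "prob_space \<Omega>"
    and indep: "prob_space.indep_vars \<Omega> (\<lambda>_. P) \<Theta> UNIV"
    and law: "\<And>m. distr \<Omega> P (\<Theta> m) = P"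
    and discrete_or_grid: "discrete_forest P T \<or>
      (\<exists>C A \<alpha> :: real. C > 0 \<and> A > 0 \<and> \<alpha> < 2 \<and>
         (\<forall>\<epsilon>>0. grid_step P T \<epsilon> \<ge> ereal (C * exp (- A / \<epsilon> powr \<alpha>))))"
  shows
    "(\<forall>M. \<forall>\<omega>\<in>space \<Omega>. \<forall>x\<in>unit_cube.
        empirical_process P (\<lambda>m. \<Theta> m \<omega>) M (forest_fun n X Y P T x) =
        sqrt (real M) * (finite_forest n X Y T (\<lambda>m. \<Theta> m \<omega>) M x - infinite_forest n X Y P T x)) \<and>
     (\<exists>L :: (('t \<Rightarrow> real) \<Rightarrow> real) measure.
        converges_in_law (linf (forest_class n X Y P T)) \<Omega>
          (\<lambda>M \<omega>. \<lambda>g\<in>forest_class n X Y P T. empirical_process P (\<lambda>m. \<Theta> m \<omega>) M g) L \<and>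
        tight_law (linf (forest_class n X Y P T)) L \<and>
        gaussian_process L (forest_class n X Y P T) (\<lambda>g G. G g) \<and>
        (\<forall>x\<in>unit_cube. (LINT G|L. G (forest_fun n X Y P T x)) = 0) \<and>
        (\<forall>x\<in>unit_cube. \<forall>z\<in>unit_cube.
           covariance L (\<lambda>G. G (forest_fun n X Y P T x)) (\<lambda>G. G (forest_fun n X Y P T z)) =
           covariance P
             (\<lambda>\<theta>. \<Sum>i<n. Y i * of_bool (same_cell (T \<theta>) x (X i)) / real (cell_count n X (T \<theta>) x))
             (\<lambda>\<theta>. \<Sum>i<n. Y i * of_bool (same_cell (T \<theta>) z (X i)) / real (cell_count n X (T \<theta>) z))))"
proof (intro conjI)
  let ?F = "forest_class n X Y P T"
  have iid: "iid_sample \<Omega> P \<Theta>"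
    using prob forest indep law
    by (intro iid_sample.intro iid_sample_axioms.intro) (auto simp: random_forest_def)
  interpret S: iid_sample \<Omega> P \<Theta> by (rule iid)
  have integral_eq: "(LINT t|P. forest_fun n X Y P T x t) = infinite_forest n X Y P T x" for x
    unfolding infinite_forest_def by (rule Bochner_Integration.integral_cong[OF refl]) (rule forest_fun_eq)
  show "\<forall>M. \<forall>\<omega>\<in>space \<Omega>. \<forall>x\<in>unit_cube.
      empirical_process P (\<lambda>m. \<Theta> m \<omega>) M (forest_fun n X Y P T x) =
      sqrt (real M) * (finite_forest n X Y T (\<lambda>m. \<Theta> m \<omega>) M x - infinite_forest n X Y P T x)"
    by (simp add: empirical_process_def finite_forest_def integral_eq forest_fun_eq S.\<Theta>_space)
  obtain l u B c where "bracketed_class P ?F (\<lambda>g. g) l u B c"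
    using forest_class_bracketed[where n = n and X = X and Y = Y and P = P and T = T] data forest by blast
  then obtain e a r where "gaussian_limit P ?F (\<lambda>g. g) l u B c e a r"
    using bracketed_class.gaussian_limit_exists by blast
  then interpret E: empirical_limit P ?F "\<lambda>g. g" l u B c e a r \<Omega> \<Theta>
    using iid by (rule empirical_limit.intro)
  have in_F: "forest_fun n X Y P T x \<in> ?F" if "x \<in> unit_cube" for x
    using that by (auto simp: forest_class_def)
  let ?g = "\<lambda>x \<theta>. \<Sum>i<n. Y i * of_bool (same_cell (T \<theta>) x (X i)) / real (cell_count n X (T \<theta>) x)"
  \<comment> \<open>Members of the class are restricted to \<open>space P\<close>, where they agree
    with the explicit sums; integrals see nothing else.\<close>
  have cov: "covariance E.limit_law (\<lambda>G. G (forest_fun n X Y P T x)) (\<lambda>G. G (forest_fun n X Y P T z)) =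
      covariance P (?g x) (?g z)" if "x \<in> unit_cube" "z \<in> unit_cube" for x z
    unfolding E.covariance_limit_law[OF in_F[OF that(1)] in_F[OF that(2)]]
    by (rule covariance_cong) (simp_all add: forest_fun_eq tree_estimate_def)
  have conv: "converges_in_law (linf ?F) \<Omega>
      (\<lambda>M \<omega>. \<lambda>g\<in>?F. empirical_process P (\<lambda>m. \<Theta> m \<omega>) M g) E.limit_law"
    using E.donsker unfolding E.emp_fun_def[abs_def] .
  show "\<exists>L :: (('t \<Rightarrow> real) \<Rightarrow> real) measure.
      converges_in_law (linf ?F) \<Omega> (\<lambda>M \<omega>. \<lambda>g\<in>?F. empirical_process P (\<lambda>m. \<Theta> m \<omega>) M g) L \<and>
      tight_law (linf ?F) L \<and>
      gaussian_process L ?F (\<lambda>g G. G g) \<and>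
      (\<forall>x\<in>unit_cube. (LINT G|L. G (forest_fun n X Y P T x)) = 0) \<and>
      (\<forall>x\<in>unit_cube. \<forall>z\<in>unit_cube.
         covariance L (\<lambda>G. G (forest_fun n X Y P T x)) (\<lambda>G. G (forest_fun n X Y P T z)) =
         covariance P (?g x) (?g z))"
    by (intro exI[of _ E.limit_law] conjI ballI conv E.tight_limit_law E.gaussian_limit_law
        E.mean_limit_law in_F cov)
qed

end
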